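(* Assume, in the standing setting, that $\mathbf A^{\sharp}\mathbf A$ and $\mathbf B\mathbf B^{\sharp}$ are both non-Hermitian. Then for all $i=1,\dots,n$, $j=1,\dots,p$ the entries of $\mathbf X=\mathbf A^{\dagger}_{M,N}\mathbf D\mathbf B^{\dagger}_{P,Q}$ satisfy the following, where in each case $\widetilde{\mathbf D}=(\widetilde d_{tf})\in\mathbb H^{n\times p}$ has rows $\widetilde{\mathbf d}_{t.}$ and columns $\widetilde{\mathbf d}_{.f}$, and $\Delta_A=\sum_{\beta\in J_{r_1,n}}\det((\widetilde{\mathbf A}^*\widetilde{\mathbf A})^{\beta}_{\beta})$, $\Delta_B=\sum_{\alpha\in I_{r_2,p}}\det((\widetilde{\mathbf B}\widetilde{\mathbf B}^* )^{\alpha}_{\alpha})$. (i) If $r_1<n$, $r_2<p$: let $\widetilde{\mathbf D}=\mathbf N^{-1/2}\mathbf A^*\mathbf M\mathbf D\mathbf Q^{-1}\mathbf B^*\mathbf P^{1/2}$; let $\mathbf d^{\mathbf B}_{.j}\in\mathbb H^{n\times1}$ have $t$-th entry $\sum_{l=1}^{p}\sum_{\alpha\in I_{r_2,p}\{l\}}\operatorname{rdet}_l\big((\widetilde{\mathbf B}\widetilde{\mathbf B}^* )_{l.}(\widetilde{\mathbf d}_{t.})\big)^{\alpha}_{\alpha}\,p^{(1/2)}_{lj}$ and $\mathbf d^{\mathbf A}_{i.}\in\mathbb H^{1\times p}$ have $f$-th entry $\sum_{k=1}^{n}n^{(-1/2)}_{ik}\sum_{\beta\in J_{r_1,n}\{k\}}\operatorname{cdet}_k\big((\widetilde{\mathbf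 A}^*\widetilde{\mathbf A})_{.k}(\widetilde{\mathbf d}_{.f})\big)^{\beta}_{\beta}$. Then $$x_{ij}=\frac{\sum_{k=1}^{n}n^{(-1/2)}_{ik}\sum_{\beta\in J_{r_1,n}\{k\}}\operatorname{cdet}_k\big((\widetilde{\mathbf A}^*\widetilde{\mathbf A})_{.k}(\mathbf d^{\mathbf B}_{.j})\big)^{\beta}_{\beta}}{\Delta_A\Delta_B}=\frac{\sum_{l=1}^{p}\sum_{\alpha\in I_{r_2,p}\{l\}}\operatorname{rdet}_l\big((\widetilde{\mathbf B}\widetilde{\mathbf B}^* )_{l.}(\mathbf d^{\mathbf A}_{i.})\big)^{\alpha}_{\alpha}\,p^{(1/2)}_{lj}}{\Delta_A\Delta_B}.$$ (ii) If $r_1=n$, $r_2=p$: let $\widetilde{\mathbf D}=\mathbf A^*\mathbf M\mathbf D\mathbf Q^{-1}\mathbf B^*$; let $\mathbf d^{\mathbf B}_{.j}$ have $t$-th entry $\operatorname{rdet}_j(\mathbf B\mathbf Q^{-1}\mathbf B^* )_{j.}(\widetilde{\mathbf d}_{t.})$ and $\mathbf d^{\mathbf A}_{i.}$ have $f$-th entry $\operatorname{cdet}_i(\mathbf A^*\mathbf M\mathbf A)_{.i}(\widetilde{\mathbf d}_{.f})$. Then $$x_{ij}=\frac{\operatorname{cdet}_i(\mathbf A^*\mathbf M\mathbf A)_{.i}(\mathbf d^{\mathbf B}_{.j})}{\det(\mathbf A^*\mathbf M\mathbf A)\det(\mathbf B\mathbf Q^{-1}\mathbf B^* )}=\frac{\operatorname{rdet}_j(\mathbf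 B\mathbf Q^{-1}\mathbf B^* )_{j.}(\mathbf d^{\mathbf A}_{i.})}{\det(\mathbf A^*\mathbf M\mathbf A)\det(\mathbf B\mathbf Q^{-1}\mathbf B^* )}.$$ (iii) If $r_1=n$, $r_2<p$: let $\widetilde{\mathbf D}=\mathbf A^*\mathbf M\mathbf D\mathbf Q^{-1}\mathbf B^*\mathbf P^{1/2}$; define $\mathbf d^{\mathbf B}_{.j}$ by the formula of (i) and $\mathbf d^{\mathbf A}_{i.}$ by the formula of (ii), both using this $\widetilde{\mathbf D}$. Then $$x_{ij}=\frac{\operatorname{cdet}_i(\mathbf A^*\mathbf M\mathbf A)_{.i}(\mathbf d^{\mathbf B}_{.j})}{\det(\mathbf A^*\mathbf M\mathbf A)\,\Delta_B}=\frac{\sum_{l=1}^{p}\sum_{\alpha\in I_{r_2,p}\{l\}}\operatorname{rdet}_l\big((\widetilde{\mathbf B}\widetilde{\mathbf B}^* )_{l.}(\mathbf d^{\mathbf A}_{i.})\big)^{\alpha}_{\alpha}\,p^{(1/2)}_{lj}}{\det(\mathbf A^*\mathbf M\mathbf A)\,\Delta_B}.$$ (iv) If $r_1<n$, $r_2=p$: let $\widetilde{\mathbf D}=\mathbf N^{-1/2}\mathbf A^*\mathbf M\mathbf D\mathbf Q^{-1}\mathbf B^*$; define $\mathbf d^{\mathbf B}_{.j}$ by the formula of (ii) and $\mathbf d^{\mathbf A}_{i.}$ by the formula of (i), both using this $\widetilde{\mathbf D}$. Then $$x_{ij}=\frac{\operatorname{rdet}_j(\mathbf B\mathbf Q^{-1}\mathbf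 B^* )_{j.}(\mathbf d^{\mathbf A}_{i.})}{\Delta_A\det(\mathbf B\mathbf Q^{-1}\mathbf B^* )}=\frac{\sum_{k=1}^{n}n^{(-1/2)}_{ik}\sum_{\beta\in J_{r_1,n}\{k\}}\operatorname{cdet}_k\big((\widetilde{\mathbf A}^*\widetilde{\mathbf A})_{.k}(\mathbf d^{\mathbf B}_{.j})\big)^{\beta}_{\beta}}{\Delta_A\det(\mathbf B\mathbf Q^{-1}\mathbf B^* )}.$$
   Context: $\mathbb H$ is the real quaternion skew field; $\mathbb H^{m\times n}$ the $m\times n$ quaternion matrices; $\mathrm M(n,\mathbb H)=\mathbb H^{n\times n}$; $\mathbf C^*$ the conjugate transpose; rank is the maximal number of right-linearly independent columns. A square $\mathbf H$ is Hermitian if $\mathbf H^*=\mathbf H$, positive definite if also $\mathbf x^*\mathbf H\mathbf x>0$ for all nonzero $\mathbf x$. For Hermitian positive definite $\mathbf H$, $\mathbf H^{1/2}$ is its unique Hermitian positive definite square root and $\mathbf H^{-1/2}=(\mathbf H^{1/2})^{-1}$. Row and column determinants of $\mathbf C=(c_{ij})\in\mathrm M(n,\mathbb H)$: for $i\in\{1,\dots,n\}$, write each $\sigma\in S_n$ as a product of $r$ disjoint cycles (fixed points included) as $\sigma=(i\,i_{k_1}\,i_{k_1+1}\dots i_{k_1+l_1})(i_{k_2}\dots i_{k_2+l_2})\cdots(i_{k_r}\dots i_{k_r+l_r})$, where the first cycle contains $i$ and starts with $i$, every other cycle starts with its smallest element, and $i_{k_2}<\dots<i_{k_r}$; then $\operatorname{rdet}_i\mathbf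 C=\sum_{\sigma\in S_n}(-1)^{n-r}(c_{i\,i_{k_1}}c_{i_{k_1}i_{k_1+1}}\cdots c_{i_{k_1+l_1}\,i})\cdots(c_{i_{k_r}i_{k_r+1}}\cdots c_{i_{k_r+l_r}i_{k_r}})$. For $j\in\{1,\dots,n\}$, write each $\tau\in S_n$ as $\tau=(j_{k_r+l_r}\dots j_{k_r+1}j_{k_r})\cdots(j_{k_2+l_2}\dots j_{k_2})(j_{k_1+l_1}\dots j_{k_1+1}j_{k_1}\,j)$, where the last cycle contains $j$ and ends with $j$, every other cycle ends with its smallest element, and $j_{k_2}<\dots<j_{k_r}$; then $\operatorname{cdet}_j\mathbf C=\sum_{\tau\in S_n}(-1)^{n-r}(c_{j_{k_r}j_{k_r+l_r}}\cdots c_{j_{k_r+1}j_{k_r}})\cdots(c_{j\,j_{k_1+l_1}}\cdots c_{j_{k_1+1}j_{k_1}}c_{j_{k_1}j})$. For Hermitian $\mathbf C$ all $\operatorname{rdet}_i\mathbf C$ and $\operatorname{cdet}_j\mathbf C$ coincide and are real; this common value is $\det\mathbf C$. Notation: $\mathbf c_{.j}$, $\mathbf c_{i.}$ are the $j$-th column and $i$-th row of $\mathbf C$; $\mathbf C_{.j}(\mathbf b)$ (resp. $\mathbf C_{i.}(\mathbf b)$) is $\mathbf C$ with its $j$-th column (resp. $i$-th row) replaced by $\mathbf b$. $\mathbf C^{\alpha}_{\beta}$ is the submatrix with rows indexed by $\alpha$ and columns by $\beta$. $L_{k,n}$ is the set of strictly increasing sequences of $k$ integers from $\{1,\dots,n\}$;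 $I_{r,m}\{i\}=\{\alpha\in L_{r,m}: i\in\alpha\}$, $J_{r,n}\{j\}=\{\beta\in L_{r,n}: j\in\beta\}$, and $I_{r,m}=L_{r,m}$, $J_{r,n}=L_{r,n}$. For $i\in\beta$, $\operatorname{cdet}_i(\mathbf C_{.i}(\mathbf b))^{\beta}_{\beta}$ is the column determinant of the square matrix $(\mathbf C_{.i}(\mathbf b))^{\beta}_{\beta}$ with respect to its column corresponding to index $i$; similarly $\operatorname{rdet}_j(\mathbf C_{j.}(\mathbf b))^{\alpha}_{\alpha}$ for $j\in\alpha$ with respect to the row corresponding to $j$. Weighted Moore–Penrose inverse: for $\mathbf A\in\mathbb H^{m\times n}$ and Hermitian positive definite $\mathbf M$ (order $m$), $\mathbf N$ (order $n$), $\mathbf A^{\dagger}_{M,N}$ is the unique $\mathbf Y\in\mathbb H^{n\times m}$ with $\mathbf A\mathbf Y\mathbf A=\mathbf A$, $\mathbf Y\mathbf A\mathbf Y=\mathbf Y$, $(\mathbf M\mathbf A\mathbf Y)^*=\mathbf M\mathbf A\mathbf Y$, $(\mathbf N\mathbf Y\mathbf A)^*=\mathbf N\mathbf Y\mathbf A$. Standing setting: $\mathbf A\in\mathbb H^{m\times n}$ of rank $r_1\ge1$, $\mathbf B\in\mathbb H^{p\times q}$ of rank $r_2\ge1$, $\mathbf D\in\mathbb H^{m\times q}$; $\mathbf M,\mathbf N,\mathbf P,\mathbf Q$ Hermitian positive definite of orders $m,n,p,q$. $\mathbf A^{\sharp}=\mathbf N^{-1}\mathbf A^*\mathbf M$,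 $\mathbf B^{\sharp}=\mathbf Q^{-1}\mathbf B^*\mathbf P$, $\widetilde{\mathbf A}=\mathbf M^{1/2}\mathbf A\mathbf N^{-1/2}$, $\widetilde{\mathbf B}=\mathbf P^{1/2}\mathbf B\mathbf Q^{-1/2}$; $n^{(-1/2)}_{ik}$ are the entries of $\mathbf N^{-1/2}$ and $p^{(1/2)}_{lj}$ those of $\mathbf P^{1/2}$. $\mathbf X=(x_{ij}):=\mathbf A^{\dagger}_{M,N}\mathbf D\mathbf B^{\dagger}_{P,Q}\in\mathbb H^{n\times p}$ (this is the unique solution of $\mathbf A\mathbf X\mathbf B=\mathbf D$ under the paper's range restrictions). *)

theory Defs
  imports "Jordan_Normal_Form.DL_Submatrix" "HOL-Combinatorics.Permutations"
begin

codatatype quat = Quat (Re: real) (Im1: real) (Im2: real) (Im3: real)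

lemma quat_eq_iff: "x = y \<longleftrightarrow> Re x = Re y \<and> Im1 x = Im1 y \<and> Im2 x = Im2 y \<and> Im3 x = Im3 y"
  by (auto intro: quat.expand)

instantiation quat :: "{zero,one,plus,minus,uminus,times,inverse}"
begin
primcorec zero_quat where "Re 0 = 0" | "Im1 0 = 0" | "Im2 0 = 0" | "Im3 0 = 0"
primcorec one_quat where "Re 1 = 1" | "Im1 1 = 0" | "Im2 1 = 0" | "Im3 1 = 0"
primcorec plus_quat where
  "Re (x + y) = Re x + Re y" | "Im1 (x + y) = Im1 x + Im1 y"
| "Im2 (x + y) = Im2 x + Im2 y" | "Im3 (x + y) = Im3 x + Im3 y"
primcorec minus_quat where
  "Re (x - y) = Re x - Re y" | "Im1 (x - y) = Im1 x - Im1 y"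
| "Im2 (x - y) = Im2 x - Im2 y" | "Im3 (x - y) = Im3 x - Im3 y"
primcorec uminus_quat where
  "Re (- x) = - Re x" | "Im1 (- x) = - Im1 x" | "Im2 (- x) = - Im2 x" | "Im3 (- x) = - Im3 x"
primcorec times_quat where
  "Re (x * y) = Re x * Re y - Im1 x * Im1 y - Im2 x * Im2 y - Im3 x * Im3 y"
| "Im1 (x * y) = Re x * Im1 y + Im1 x * Re y + Im2 x * Im3 y - Im3 x * Im2 y"
| "Im2 (x * y) = Re x * Im2 y - Im1 x * Im3 y + Im2 x * Re y + Im3 x * Im1 y"
| "Im3 (x * y) = Re x * Im3 y + Im1 x * Im2 y - Im2 x * Im1 y + Im3 x * Re y"
primcorec inverse_quat where
  "Re (inverse x) = Re x / ((Re x)\<^sup>2 + (Im1 x)\<^sup>2 + (Im2 x)\<^sup>2 + (Im3 x)\<^sup>2)"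
| "Im1 (inverse x) = - Im1 x / ((Re x)\<^sup>2 + (Im1 x)\<^sup>2 + (Im2 x)\<^sup>2 + (Im3 x)\<^sup>2)"
| "Im2 (inverse x) = - Im2 x / ((Re x)\<^sup>2 + (Im1 x)\<^sup>2 + (Im2 x)\<^sup>2 + (Im3 x)\<^sup>2)"
| "Im3 (inverse x) = - Im3 x / ((Re x)\<^sup>2 + (Im1 x)\<^sup>2 + (Im2 x)\<^sup>2 + (Im3 x)\<^sup>2)"
definition divide_quat :: "quat \<Rightarrow> quat \<Rightarrow> quat" where "divide_quat x y = x * inverse y"
instance ..
end

instance quat :: ring_1
  by standard (simp_all add: quat_eq_iff algebra_simps)

lemma quat_norm_pos: "x \<noteq> 0 \<Longrightarrow> (Re x)\<^sup>2 + (Im1 x)\<^sup>2 + (Im2 x)\<^sup>2 + (Im3 x)\<^sup>2 > 0"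
proof -
  assume "x \<noteq> 0"
  then have "Re x \<noteq> 0 \<or> Im1 x \<noteq> 0 \<or> Im2 x \<noteq> 0 \<or> Im3 x \<noteq> 0" by (simp add: quat_eq_iff)
  then show ?thesis
    by (metis add_nonneg_nonneg add_nonneg_pos add_pos_nonneg zero_le_power2 zero_less_power2)
qed

instance quat :: division_ring
proof
  fix x :: quat
  assume x: "x \<noteq> 0"
  define s where "s = (Re x)\<^sup>2 + (Im1 x)\<^sup>2 + (Im2 x)\<^sup>2 + (Im3 x)\<^sup>2"
  have s: "s \<noteq> 0" using quat_norm_pos[OF x] s_def by simp
  show "inverse x * x = 1"
    using s by (simp add: quat_eq_iff s_def[symmetric] field_simps) (simp add: add_divide_distrib[symmetric] ac_simps s_def power2_eq_square)
  show "x * inverse x = 1"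
    using s by (simp add: quat_eq_iff s_def[symmetric] field_simps) (simp add: add_divide_distrib[symmetric] ac_simps s_def power2_eq_square)
next
  show "inverse (0::quat) = 0" by (simp add: quat_eq_iff)
next
  fix x y :: quat show "x / y = x * inverse y" by (simp add: divide_quat_def)
qed

primcorec qcnj :: "quat \<Rightarrow> quat" where
  "Re (qcnj x) = Re x" | "Im1 (qcnj x) = - Im1 x" | "Im2 (qcnj x) = - Im2 x" | "Im3 (qcnj x) = - Im3 x"

definition is_pos_real :: "quat \<Rightarrow> bool" where
  "is_pos_real z \<longleftrightarrow> Im1 z = 0 \<and> Im2 z = 0 \<and> Im3 z = 0 \<and> Re z > 0"

definition cstar :: "quat mat \<Rightarrow> quat mat" where
  "cstar C = mat (dim_col C) (dim_row C) (\<lambda>(i,j). qcnj (C $$ (j,i)))"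

definition hermitian :: "quat mat \<Rightarrow> bool" where
  "hermitian H \<longleftrightarrow> square_mat H \<and> cstar H = H"

definition hpd :: "quat mat \<Rightarrow> bool" where
  "hpd H \<longleftrightarrow> hermitian H \<and>
     (\<forall>x \<in> carrier_vec (dim_row H). x \<noteq> 0\<^sub>v (dim_row H) \<longrightarrow>
        is_pos_real (\<Sum>i<dim_row H. \<Sum>j<dim_row H. qcnj (x $ i) * H $$ (i,j) * x $ j))"

definition minv :: "quat mat \<Rightarrow> quat mat" where
  "minv H = (THE Y. Y \<in> carrier_mat (dim_row H) (dim_row H) \<and>
               H * Y = 1\<^sub>m (dim_row H) \<and> Y * H = 1\<^sub>m (dim_row H))"

definition hpd_sqrt :: "quat mat \<Rightarrow> quat mat" where
  "hpd_sqrt H = (THE S. hpd S \<and> dim_row S = dim_row H \<and> S * S = H)"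

definition hpd_isqrt :: "quat mat \<Rightarrow> quat mat" where
  "hpd_isqrt H = minv (hpd_sqrt H)"

definition right_lin_indep_cols :: "quat mat \<Rightarrow> nat set \<Rightarrow> bool" where
  "right_lin_indep_cols C S \<longleftrightarrow>
     (\<forall>c :: nat \<Rightarrow> quat. (\<forall>i<dim_row C. (\<Sum>j\<in>S. C $$ (i,j) * c j) = 0) \<longrightarrow> (\<forall>j\<in>S. c j = 0))"

definition qrank :: "quat mat \<Rightarrow> nat" where
  "qrank C = Max {card S | S. S \<subseteq> {0..<dim_col C} \<and> right_lin_indep_cols C S}"

definition wmp_inv :: "quat mat \<Rightarrow> quat mat \<Rightarrow> quat mat \<Rightarrow> quat mat" where
  "wmp_inv A M N = (THE Y. Y \<in> carrier_mat (dim_col A) (dim_row A) \<and>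
      A * Y * A = A \<and> Y * A * Y = Y \<and>
      cstar (M * A * Y) = M * A * Y \<and> cstar (N * Y * A) = N * Y * A)"

definition cyc :: "(nat \<Rightarrow> nat) \<Rightarrow> nat \<Rightarrow> nat set" where
  "cyc \<sigma> x = {(\<sigma> ^^ k) x | k. True}"

definition cyc_len :: "(nat \<Rightarrow> nat) \<Rightarrow> nat \<Rightarrow> nat" where
  "cyc_len \<sigma> x = (LEAST k. k > 0 \<and> (\<sigma> ^^ k) x = x)"

definition cyc_prod :: "quat mat \<Rightarrow> (nat \<Rightarrow> nat) \<Rightarrow> nat \<Rightarrow> quat" where
  "cyc_prod C \<sigma> x = prod_list (map (\<lambda>t. C $$ ((\<sigma> ^^ t) x, (\<sigma> ^^ Suc t) x)) [0..<cyc_len \<sigma> x])"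

definition num_cycles :: "nat \<Rightarrow> (nat \<Rightarrow> nat) \<Rightarrow> nat" where
  "num_cycles n \<sigma> = card {cyc \<sigma> x | x. x < n}"

definition other_cycle_heads :: "nat \<Rightarrow> (nat \<Rightarrow> nat) \<Rightarrow> nat \<Rightarrow> nat list" where
  "other_cycle_heads n \<sigma> i =
     sorted_list_of_set {x. x < n \<and> x = Min (cyc \<sigma> x) \<and> i \<notin> cyc \<sigma> x}"

definition rdet :: "nat \<Rightarrow> quat mat \<Rightarrow> quat" where
  "rdet i C = (let n = dim_row C in
     \<Sum>\<sigma> | \<sigma> permutes {0..<n}.
       (-1) ^ (n - num_cycles n \<sigma>) *
       (cyc_prod C \<sigma> i * prod_list (map (cyc_prod C \<sigma>) (other_cycle_heads n \<sigma> i))))"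

definition cdet :: "nat \<Rightarrow> quat mat \<Rightarrow> quat" where
  "cdet j C = (let n = dim_row C in
     \<Sum>\<tau> | \<tau> permutes {0..<n}.
       (-1) ^ (n - num_cycles n \<tau>) *
       (prod_list (map (cyc_prod C \<tau>) (rev (other_cycle_heads n \<tau> j))) * cyc_prod C \<tau> j))"

text \<open>Determinant of a Hermitian matrix: the common value of all row/column determinants.\<close>
definition hdet :: "quat mat \<Rightarrow> quat" where
  "hdet C = rdet 0 C"

definition repl_col :: "quat mat \<Rightarrow> nat \<Rightarrow> quat vec \<Rightarrow> quat mat" where
  "repl_col C j b = mat (dim_row C) (dim_col C) (\<lambda>(i,k). if k = j then b $ i else C $$ (i,k))"

definition repl_row :: "quat mat \<Rightarrow> nat \<Rightarrow> quat vec \<Rightarrow> quat mat" where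
  "repl_row C i b = mat (dim_row C) (dim_col C) (\<lambda>(k,l). if k = i then b $ l else C $$ (k,l))"

definition pos_in :: "nat set \<Rightarrow> nat \<Rightarrow> nat" where
  "pos_in \<beta> k = card {x \<in> \<beta>. x < k}"

text \<open>\<open>L_{r,n}\<close> with a required element: \<open>{\<beta> \<in> L_{r,n}. k \<in> \<beta>}\<close> (strictly increasing
  sequences identified with their sets).\<close>
definition seqs_with :: "nat \<Rightarrow> nat \<Rightarrow> nat \<Rightarrow> nat set set" where
  "seqs_with r n k = {\<beta>. \<beta> \<subseteq> {0..<n} \<and> card \<beta> = r \<and> k \<in> \<beta>}"

definition seqs :: "nat \<Rightarrow> nat \<Rightarrow> nat set set" where
  "seqs r n = {\<beta>. \<beta> \<subseteq> {0..<n} \<and> card \<beta> = r}"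

definition cdet_minor_sum :: "nat \<Rightarrow> quat mat \<Rightarrow> nat \<Rightarrow> quat vec \<Rightarrow> quat" where
  "cdet_minor_sum r H k b =
     (\<Sum>\<beta>\<in>seqs_with r (dim_row H) k. cdet (pos_in \<beta> k) (submatrix (repl_col H k b) \<beta> \<beta>))"

definition rdet_minor_sum :: "nat \<Rightarrow> quat mat \<Rightarrow> nat \<Rightarrow> quat vec \<Rightarrow> quat" where
  "rdet_minor_sum r H l b =
     (\<Sum>\<alpha>\<in>seqs_with r (dim_row H) l. rdet (pos_in \<alpha> l) (submatrix (repl_row H l b) \<alpha> \<alpha>))"

definition principal_minor_sum :: "nat \<Rightarrow> quat mat \<Rightarrow> quat" where
  "principal_minor_sum r H = (\<Sum>\<beta>\<in>seqs r (dim_row H). hdet (submatrix H \<beta> \<beta>))"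

end

theory Submission
  imports Defs "HOL-Combinatorics.Cycles" "HOL-Computational_Algebra.Fundamental_Theorem_Algebra"
begin

text \<open>
  For Hermitian \<open>H\<close>, a cycle and its inverse contribute conjugate products, so in
  \<open>rdet\<^sub>i (H\<^sub>i\<^sub>.(b))\<close> all cycles avoiding \<open>i\<close> sum up to real determinants of principal
  submatrices. What remains is \<open>\<Sum>\<^sub>k b\<^sub>k adj(H)\<^sub>k\<^sub>i\<close>, where \<open>adj(H)\<^sub>k\<^sub>i\<close> is a signed sum over the
  simple paths from \<open>k\<close> to \<open>i\<close>, and \<open>H adj(H) = det(H) I\<close>.

  Let \<open>Adj\<^sub>s\<close> and \<open>\<Delta>\<^sub>s\<close> be the sums of the adjugates and of the determinants of all principal
  submatrices of order \<open>s\<close>. Then \<open>H Adj\<^sub>s + Adj\<^sub>s\<^sub>+\<^sub>1 = \<Delta>\<^sub>s I\<close>. For \<open>H = A\<^sup>*A\<close> of rank \<open>r\<close> we have \<open>\<Delta>\<^sub>r > 0\<close>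
  and \<open>\<Delta>\<^sub>s = 0\<close> for \<open>s > r\<close>; since \<open>Adj\<^sub>n\<^sub>+\<^sub>1 = 0\<close> and \<open>H\<^sup>2Z = 0\<close> forces \<open>HZ = 0\<close>, descending in \<open>s\<close>
  gives \<open>H Adj\<^sub>r\<^sub>+\<^sub>1 = 0\<close>. So \<open>G = Adj\<^sub>r / \<Delta>\<^sub>r\<close> commutes with \<open>H\<close> and satisfies \<open>H\<^sup>2G = H\<close>, hence \<open>GA\<^sup>*\<close> is
  the Moore--Penrose inverse of \<open>A\<close>. The weighted inverse is obtained from that of
  \<open>M\<^sup>1\<^sup>/\<^sup>2AN\<^sup>-\<^sup>1\<^sup>/\<^sup>2\<close>; the same recursion also provides inverses and, through an annihilating real
  polynomial, square roots of positive definite matrices.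
\<close>

subsection \<open>Quaternions\<close>

text \<open>On general quaternion matrices row and column determinants are neither multiplicative
  nor alternating, so the usual route to Cramer's rule is closed. Two facts about Hermitian data
  take its place: the determinant may be expanded at any index, and a path sum whose starting point
  may be revisited vanishes, the substitute for a determinant with two equal rows. Both rest on the
  reality of smaller determinants, as exactly the real quaternions can be moved through a product.
  The replaced vector stays outermost: on the left for rows, on the right for columns.
  \<open>minv\<close>, \<open>hpd_sqrt\<close> and \<open>wmp_inv\<close> are definite descriptions,
  so existence and uniqueness are needed before any formula can be used. Eigenvectors are avoided:
  the square root is a real polynomial in the matrix, found by interpolation on the positive roots
  of an annihilating polynomial. The four cases share one argument: each weighted inverse contains a
  square factor \<open>L\<close> or \<open>R\<close> (or an inverse in its place) whose action on
  vectors is, up to a positive real scalar, the numerator in the formula.\<close>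

lemma qcnj_simps [simp]:
  "qcnj 0 = 0" "qcnj 1 = 1" "qcnj (x + y) = qcnj x + qcnj y" "qcnj (- x) = - qcnj x"
  "qcnj (x - y) = qcnj x - qcnj y" "qcnj (x * y) = qcnj y * qcnj x" "qcnj (qcnj x) = x"
  by (simp_all add: quat_eq_iff)

lemma qcnj_sum: "qcnj (sum f A) = (\<Sum>x\<in>A. qcnj (f x))"
  by (induction A rule: infinite_finite_induct) simp_all

lemma qcnj_power: "qcnj (x ^ n) = qcnj x ^ n"
  by (induction n) (simp_all add: power_commutes)

lemma qcnj_fixed_iff: "qcnj d = d \<longleftrightarrow> Im1 d = 0 \<and> Im2 d = 0 \<and> Im3 d = 0"
  by (auto simp: quat_eq_iff)

lemma qcnj_fixed_commute: "qcnj d = d \<Longrightarrow> d * x = x * d"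
  by (simp add: qcnj_fixed_iff quat_eq_iff algebra_simps)

lemma minus_one_power_commute: "(-1) ^ k * x = x * (-1 :: quat) ^ k"
  by (rule qcnj_fixed_commute) (simp add: qcnj_power)

subsection \<open>Distinct lists and walks\<close>

text \<open>These lists serve as the interiors of simple paths and as cycles with their starting
  point removed.\<close>

definition dlists :: "nat set \<Rightarrow> nat list set" where
  "dlists S = {ys. distinct ys \<and> set ys \<subseteq> S}"

text \<open>Only interior vertices are listed, so \<open>a = b\<close> gives the product around a
  cycle and \<open>a \<noteq> b\<close> the product along a path. The factors keep the order of
  traversal.\<close>

fun walk :: "(nat \<Rightarrow> nat \<Rightarrow> quat) \<Rightarrow> nat \<Rightarrow> nat list \<Rightarrow> nat \<Rightarrow> quat" where
  "walk h a [] b = h a b"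
| "walk h a (y # ys) b = h a y * walk h y ys b"

lemma walk_append: "walk h a (us @ j # vs) b = walk h a us j * walk h j vs b"
  by (induction us arbitrary: a) (simp_all add: mult.assoc)

lemma walk_map: "(\<And>x y. x \<in> insert a (insert b (set ys)) \<Longrightarrow> y \<in> insert a (insert b (set ys)) \<Longrightarrow> h' x y = h (f x) (f y))
  \<Longrightarrow> walk h' a ys b = walk h (f a) (map f ys) (f b)"
proof (induction ys arbitrary: a)
  case (Cons y ys)
  have "walk h' y ys b = walk h (f y) (map f ys) (f b)"
    by (rule Cons.IH) (use Cons.prems in auto)
  then show ?case using Cons.prems by simp
qed simp

lemma finite_dlists: "finite S \<Longrightarrow> finite (dlists S)"
  unfolding dlists_def
  by (rule finite_subset[OF _ finite_subset_distinct[of S]]) auto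

lemma sum_dlists_Cons:
  assumes "finite T"
  shows "sum f (dlists T) = f [] + (\<Sum>k\<in>T. \<Sum>ys\<in>dlists (T - {k}). f (k # ys))"
proof -
  have "dlists T = insert [] ((\<lambda>(k, ys). k # ys) ` Sigma T (\<lambda>k. dlists (T - {k})))"
  proof (rule Set.set_eqI)
    fix xs show "xs \<in> dlists T \<longleftrightarrow> xs \<in> insert [] ((\<lambda>(k, ys). k # ys) ` Sigma T (\<lambda>k. dlists (T - {k})))"
      by (cases xs) (auto simp: dlists_def image_iff)
  qed
  moreover have "sum f ((\<lambda>(k, ys). k # ys) ` Sigma T (\<lambda>k. dlists (T - {k})))
      = (\<Sum>k\<in>T. \<Sum>ys\<in>dlists (T - {k}). f (k # ys))"
    using assms
    by (subst sum.reindex) (auto simp: inj_on_def sum.Sigma finite_dlists case_prod_unfold)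
  ultimately show ?thesis
    using assms by (simp add: finite_dlists image_iff case_prod_unfold)
qed

text \<open>Both sides run over the ordered pairs of disjoint distinct lists in
  \<open>U\<close>.\<close>

lemma sum_dlists_swap:
  assumes "finite U"
  shows "(\<Sum>us\<in>dlists U. \<Sum>vs\<in>dlists (U - set us). f us vs)
       = (\<Sum>vs\<in>dlists U. \<Sum>us\<in>dlists (U - set vs). f us vs)"
  using assms
  by (simp add: sum.Sigma finite_dlists)
    (rule sum.reindex_bij_witness[of _ "\<lambda>(a, b). (b, a)" "\<lambda>(a, b). (b, a)"]; auto simp: dlists_def)

text \<open>A distinct list either avoids \<open>j\<close> or is cut uniquely at its only occurrence
  of \<open>j\<close>.\<close>

lemma sum_dlists_split:
  assumes "finite T" "j \<in> T"
  shows "sum f (dlists T) = sum f (dlists (T - {j}))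
    + (\<Sum>us\<in>dlists (T - {j}). \<Sum>vs\<in>dlists (T - {j} - set us). f (us @ j # vs))"
proof -
  let ?A = "{ys \<in> dlists T. j \<in> set ys}"
  let ?g = "\<lambda>(us, vs). us @ j # vs"
  let ?B = "Sigma (dlists (T - {j})) (\<lambda>us. dlists (T - {j} - set us))"
  have "dlists T = dlists (T - {j}) \<union> ?A" "dlists (T - {j}) \<inter> ?A = {}"
    by (auto simp: dlists_def)
  then have "sum f (dlists T) = sum f (dlists (T - {j})) + sum f ?A"
    using assms by (metis (no_types, lifting) finite_Diff finite_dlists finite_Un sum.union_disjoint)
  moreover have "?A = ?g ` ?B"
  proof
    show "?A \<subseteq> ?g ` ?B"
    proof
      fix ys assume ys: "ys \<in> ?A"
      then obtain us vs where "ys = us @ j # vs" by (auto dest: split_list)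
      with ys show "ys \<in> ?g ` ?B"
        by (intro image_eqI[of _ _ "(us, vs)"]) (auto simp: dlists_def)
    qed
  qed (use assms in \<open>auto simp: dlists_def\<close>)
  moreover have "inj_on ?g ?B"
    by (auto simp: inj_on_def dlists_def append_eq_Cons_conv append_eq_append_conv2 Cons_eq_append_conv)
  ultimately show ?thesis
    using assms by (simp add: sum.reindex sum.Sigma finite_dlists case_prod_unfold)
qed

subsection \<open>Splitting off the cycle of a permutation\<close>

definition orb :: "(nat \<Rightarrow> nat) \<Rightarrow> nat \<Rightarrow> nat list" where
  "orb \<sigma> x = map (\<lambda>t. (\<sigma> ^^ t) x) [0..<cyc_len \<sigma> x]"

definition cprod :: "(nat \<Rightarrow> nat \<Rightarrow> quat) \<Rightarrow> (nat \<Rightarrow> nat) \<Rightarrow> nat \<Rightarrow> quat" where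
  "cprod h \<sigma> x = prod_list (map (\<lambda>t. h ((\<sigma> ^^ t) x) ((\<sigma> ^^ Suc t) x)) [0..<cyc_len \<sigma> x])"

definition heads :: "nat set \<Rightarrow> (nat \<Rightarrow> nat) \<Rightarrow> nat list" where
  "heads S \<sigma> = sorted_list_of_set {x\<in>S. x = Min (cyc \<sigma> x)}"

definition ncyc :: "nat set \<Rightarrow> (nat \<Rightarrow> nat) \<Rightarrow> nat" where
  "ncyc S \<sigma> = card (cyc \<sigma> ` S)"

lemma cyc_len_props:
  assumes "\<sigma> permutes S" "finite S"
  shows "cyc_len \<sigma> x > 0" "(\<sigma> ^^ cyc_len \<sigma> x) x = x"
    and "0 < k \<Longrightarrow> k < cyc_len \<sigma> x \<Longrightarrow> (\<sigma> ^^ k) x \<noteq> x"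
proof -
  have "\<exists>k>0. (\<sigma> ^^ k) x = x"
    using permutation_self[of \<sigma> x] permutation_permutes[of \<sigma>] assms by auto
  then have "cyc_len \<sigma> x > 0 \<and> (\<sigma> ^^ cyc_len \<sigma> x) x = x"
    unfolding cyc_len_def by (metis (mono_tags, lifting) LeastI_ex)
  then show "cyc_len \<sigma> x > 0" "(\<sigma> ^^ cyc_len \<sigma> x) x = x" by auto
  show "0 < k \<Longrightarrow> k < cyc_len \<sigma> x \<Longrightarrow> (\<sigma> ^^ k) x \<noteq> x"
    unfolding cyc_len_def by (metis (mono_tags, lifting) not_less_Least)
qed

lemma cyc_eq_image_upt:
  assumes "\<sigma> permutes S" "finite S"
  shows "cyc \<sigma> x = (\<lambda>t. (\<sigma> ^^ t) x) ` {0..<cyc_len \<sigma> x}"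
proof -
  note p = cyc_len_props[OF assms, of x]
  have "(\<sigma> ^^ k) x = (\<sigma> ^^ (k mod cyc_len \<sigma> x)) x" for k
    using funpow_mod_eq[OF p(2)] by simp
  then show ?thesis
    unfolding cyc_def using p(1) by (fastforce simp: image_iff)
qed

lemma set_orb: "\<sigma> permutes S \<Longrightarrow> finite S \<Longrightarrow> set (orb \<sigma> x) = cyc \<sigma> x"
  by (simp add: orb_def cyc_eq_image_upt)

lemma distinct_orb:
  assumes "\<sigma> permutes S" "finite S"
  shows "distinct (orb \<sigma> x)"
proof -
  note p = cyc_len_props[OF assms, of x]
  have inj: "inj (\<sigma> ^^ k)" for k
    using assms(1) by (simp add: inj_fn permutes_inj)
  have False if "s < t" "t < cyc_len \<sigma> x" "(\<sigma> ^^ s) x = (\<sigma> ^^ t) x" for s t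
  proof -
    have "(\<sigma> ^^ s) ((\<sigma> ^^ (t - s)) x) = (\<sigma> ^^ s) x"
      using that by (metis add_diff_inverse_nat comp_apply funpow_add less_imp_le not_less_iff_gr_or_eq)
    then have "(\<sigma> ^^ (t - s)) x = x" using inj by (simp add: inj_eq)
    with cyc_len_props(3)[OF assms, of "t - s" x] that show False by linarith
  qed
  then have "inj_on (\<lambda>t. (\<sigma> ^^ t) x) {0..<cyc_len \<sigma> x}"
    by (intro linorder_inj_onI') (metis atLeastLessThan_iff)
  then show ?thesis
    unfolding orb_def by (simp add: distinct_map)
qed

lemma hd_orb: "\<sigma> permutes S \<Longrightarrow> finite S \<Longrightarrow> orb \<sigma> x = x # tl (orb \<sigma> x)"
  using cyc_len_props(1)[of \<sigma> S x] by (simp add: orb_def upt_conv_Cons)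

lemma cyc_subset: "\<sigma> permutes S \<Longrightarrow> x \<in> S \<Longrightarrow> cyc \<sigma> x \<subseteq> S"
proof -
  assume *: "\<sigma> permutes S" "x \<in> S"
  have "(\<sigma> ^^ k) x \<in> S" for k
    using * by (induction k) (auto simp: permutes_in_image)
  then show ?thesis by (auto simp: cyc_def)
qed

lemma self_in_cyc: "x \<in> cyc \<sigma> x"
  unfolding cyc_def by (auto intro: exI[of _ 0])

lemma cycle_of_list_nth:
  assumes "distinct cs" "k < length cs"
  shows "cycle_of_list cs (cs ! k) = cs ! (Suc k mod length cs)"
proof -
  have "map (cycle_of_list cs) cs ! k = rotate1 cs ! k"
    using cyclic_rotation[OF assms(1), of 1] by simp
  then show ?thesis using assms by (simp add: nth_rotate1)
qed

text \<open>A permutation with its cycle through \<open>i\<close> made explicit: the cycle is listed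
  as \<open>i # ys\<close>, and \<open>\<tau>\<close> permutes the remaining points. Cycles, heads,
  sign and products of the composite are computed from these data, so that a sum over permutations
  becomes a double sum over \<open>ys\<close> and \<open>\<tau>\<close>.\<close>

locale cycle_split =
  fixes S :: "nat set" and i :: nat and ys :: "nat list" and \<tau> :: "nat \<Rightarrow> nat"
  assumes finS: "finite S" and iS: "i \<in> S" and ys: "ys \<in> dlists (S - {i})"
    and tau: "\<tau> permutes (S - {i} - set ys)"
begin

abbreviation "cs \<equiv> i # ys"
abbreviation "S' \<equiv> S - {i} - set ys"
definition "\<sigma> = cycle_of_list cs \<circ> \<tau>"

lemma cs: "distinct cs" "set cs \<subseteq> S"
  using ys iS by (auto simp: dlists_def)

lemma sigma_permutes: "\<sigma> permutes S"
  unfolding \<sigma>_def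
  by (rule permutes_compose[OF permutes_subset[OF tau] permutes_subset[OF cycle_permutes]])
    (use cs in auto)

lemma sigma_nth: "k < length cs \<Longrightarrow> \<sigma> (cs ! k) = cs ! (Suc k mod length cs)"
proof -
  assume k: "k < length cs"
  then have "cs ! k \<in> set cs" by (rule nth_mem)
  then have "\<tau> (cs ! k) = cs ! k"
    by (intro permutes_not_in[OF tau]) auto
  then show ?thesis using cycle_of_list_nth[OF cs(1) k] by (simp add: \<sigma>_def)
qed

lemma sigma_outside: "x \<notin> set cs \<Longrightarrow> \<sigma> x = \<tau> x"
proof -
  assume x: "x \<notin> set cs"
  have "\<tau> x \<notin> set cs"
  proof (cases "x \<in> S'")
    case True then show ?thesis using permutes_in_image[OF tau, of x] by auto
  next
    case False then show ?thesis using permutes_not_in[OF tau] x by simp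
  qed
  then have "cycle_of_list cs (\<tau> x) = \<tau> x" by (rule id_outside_supp)
  then show ?thesis by (simp only: \<sigma>_def comp_apply)
qed

lemma sigma_pow: "(\<sigma> ^^ t) i = cs ! (t mod length cs)"
proof (induction t)
  case (Suc t)
  have "(\<sigma> ^^ Suc t) i = \<sigma> (cs ! (t mod length cs))" using Suc by simp
  also have "\<dots> = cs ! (Suc (t mod length cs) mod length cs)" by (rule sigma_nth) simp
  finally show ?case by (simp only: mod_Suc_eq)
qed simp

lemma cyc_len_i: "cyc_len \<sigma> i = length cs"
  unfolding cyc_len_def
proof (rule Least_equality)
  show "0 < length cs \<and> (\<sigma> ^^ length cs) i = i" by (simp only: sigma_pow) simp
next
  fix k assume k: "0 < k \<and> (\<sigma> ^^ k) i = i"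
  show "length cs \<le> k"
  proof (rule ccontr)
    assume "\<not> length cs \<le> k"
    then have "cs ! k = cs ! 0" "k < length cs" using k by (simp_all only: sigma_pow) simp_all
    then show False using cs(1) k nth_eq_iff_index_eq[of cs k 0] by auto
  qed
qed

lemma orb_i: "orb \<sigma> i = cs"
  unfolding orb_def cyc_len_i by (rule nth_equalityI) (simp_all add: sigma_pow del: upt_Suc)

lemma cyc_on_cs: "x \<in> set cs \<Longrightarrow> cyc \<sigma> x = set cs"
proof -
  assume "x \<in> set cs"
  then obtain k where k: "k < length cs" "x = cs ! k" by (metis in_set_conv_nth)
  have x: "(\<sigma> ^^ t) x = cs ! ((t + k) mod length cs)" for t
  proof -
    have "(\<sigma> ^^ t) x = (\<sigma> ^^ (t + k)) i"
      using k sigma_pow[of k] by (simp add: funpow_add)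
    then show ?thesis by (simp only: sigma_pow)
  qed
  show ?thesis
  proof
    have "(t + k) mod length cs < length cs" for t
      by (rule mod_less_divisor) simp
    then show "cyc \<sigma> x \<subseteq> set cs" unfolding cyc_def x by (auto simp only: nth_mem)
    show "set cs \<subseteq> cyc \<sigma> x"
    proof
      fix y assume "y \<in> set cs"
      then obtain l where l: "l < length cs" "y = cs ! l" by (metis in_set_conv_nth)
      have "(\<sigma> ^^ (l + length cs - k)) x = y"
      proof -
        have "l + length cs - k + k = l + length cs" using k by simp
        then have "(l + length cs - k + k) mod length cs = l" using l(1) by (metis mod_add_self2 mod_less)
        then show ?thesis unfolding x using l(2) by (simp only:)
      qed
      then show "y \<in> cyc \<sigma> x" unfolding cyc_def by blast
    qed
  qed
qed

lemma sigma_pow_outside: "x \<in> S' \<Longrightarrow> (\<sigma> ^^ t) x = (\<tau> ^^ t) x \<and> (\<tau> ^^ t) x \<in> S'"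
proof (induction t)
  case (Suc t)
  then have *: "(\<sigma> ^^ t) x = (\<tau> ^^ t) x" "(\<tau> ^^ t) x \<in> S'" by auto
  then have "\<sigma> ((\<tau> ^^ t) x) = \<tau> ((\<tau> ^^ t) x)" by (intro sigma_outside) auto
  moreover have "\<tau> ((\<tau> ^^ t) x) \<in> S'" using * permutes_in_image[OF tau] by blast
  ultimately show ?case using * by simp
qed simp

lemma outside:
  assumes "x \<in> S'"
  shows "cyc \<sigma> x = cyc \<tau> x" "cyc_len \<sigma> x = cyc_len \<tau> x" "cprod h \<sigma> x = cprod h \<tau> x"
proof -
  have p: "(\<sigma> ^^ t) x = (\<tau> ^^ t) x" for t using sigma_pow_outside[OF assms] by blast
  show "cyc \<sigma> x = cyc \<tau> x" "cyc_len \<sigma> x = cyc_len \<tau> x" by (simp_all only: cyc_def cyc_len_def p)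
  then show "cprod h \<sigma> x = cprod h \<tau> x" by (simp only: cprod_def p)
qed

lemma restrict_sigma: "(\<lambda>x. if x \<in> set cs then x else \<sigma> x) = \<tau>"
proof
  fix x show "(if x \<in> set cs then x else \<sigma> x) = \<tau> x"
  proof (cases "x \<in> set cs")
    case True
    then have "x \<notin> S'" by auto
    with True show ?thesis using permutes_not_in[OF tau] by simp
  qed (use sigma_outside in simp)
qed

lemma S_eq: "S = set cs \<union> S'" "set cs \<inter> S' = {}" "card S = length cs + card S'"
proof -
  show *: "S = set cs \<union> S'" "set cs \<inter> S' = {}" using cs by auto
  have "card S = card (set cs) + card S'"
    by (subst *(1), rule card_Un_disjoint) (use finS *(2) in auto)
  then show "card S = length cs + card S'" using distinct_card[OF cs(1)] by simp
qed

lemma ncyc_sigma: "ncyc S \<sigma> = Suc (ncyc S' \<tau>)"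
proof -
  have "cyc \<sigma> ` S = cyc \<sigma> ` set cs \<union> cyc \<sigma> ` S'" using S_eq(1) by (metis image_Un)
  also have "cyc \<sigma> ` set cs = {set cs}" using cyc_on_cs by auto
  also have "cyc \<sigma> ` S' = cyc \<tau> ` S'" using outside(1) by (intro image_cong) auto
  finally have "cyc \<sigma> ` S = insert (set cs) (cyc \<tau> ` S')" by simp
  moreover have "set cs \<notin> cyc \<tau> ` S'" using self_in_cyc by force
  ultimately show ?thesis using finS by (simp add: ncyc_def)
qed

text \<open>A cycle with \<open>length ys + 1\<close> points contributes \<open>length ys\<close> to
  the exponent. The bound on the number of cycles keeps the truncated subtraction exact.\<close>

lemma sign_sigma: "card S - ncyc S \<sigma> = length ys + (card S' - ncyc S' \<tau>)"
proof -
  have "ncyc S' \<tau> \<le> card S'" unfolding ncyc_def using finS by (simp add: card_image_le)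
  then show ?thesis using S_eq(3) by (simp add: ncyc_sigma)
qed

lemma heads_other: "sorted_list_of_set {x\<in>S. x = Min (cyc \<sigma> x) \<and> i \<notin> cyc \<sigma> x} = heads S' \<tau>"
proof -
  have "{x\<in>S. x = Min (cyc \<sigma> x) \<and> i \<notin> cyc \<sigma> x} = {x\<in>S'. x = Min (cyc \<tau> x)}"
  proof (rule Set.set_eqI)
    fix x
    show "x \<in> {x\<in>S. x = Min (cyc \<sigma> x) \<and> i \<notin> cyc \<sigma> x} \<longleftrightarrow> x \<in> {x\<in>S'. x = Min (cyc \<tau> x)}"
    proof (cases "x \<in> S'")
      case True
      have "i \<notin> cyc \<tau> x" using cyc_subset[OF tau True] by auto
      with True show ?thesis using outside(1)[OF True] by auto
    next
      case False
      then have "x \<notin> S \<or> x \<in> set cs" by auto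
      then show ?thesis using False cyc_on_cs[of x] by auto
    qed
  qed
  then show ?thesis by (simp add: heads_def)
qed

lemma cprod_heads: "map (cprod h \<sigma>) (heads S' \<tau>) = map (cprod h \<tau>) (heads S' \<tau>)"
  using finS outside(3) by (intro map_cong) (auto simp: heads_def)

lemma cprod_i: "cprod h \<sigma> i = walk h i ys i"
proof -
  have walk_nth: "walk h a zs b = prod_list (map (\<lambda>t. h ((a # zs) ! t) ((zs @ [b]) ! t)) [0..<Suc (length zs)])"
    for a b :: nat and zs
    by (induction zs arbitrary: a) (simp_all add: upt_conv_Cons del: upt_Suc, simp add: map_Suc_upt[symmetric] comp_def del: upt_Suc)
  have "cprod h \<sigma> i = prod_list (map (\<lambda>t. h (cs ! (t mod length cs)) (cs ! (Suc t mod length cs))) [0..<length cs])"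
    unfolding cprod_def cyc_len_i by (simp only: sigma_pow)
  also have "\<dots> = prod_list (map (\<lambda>t. h (cs ! t) ((ys @ [i]) ! t)) [0..<length cs])"
  proof (intro arg_cong[where f = prod_list] map_cong refl)
    fix t assume "t \<in> set [0..<length cs]"
    then have t: "t < length cs" by (simp only: set_upt atLeastLessThan_iff)
    have "cs ! (Suc t mod length cs) = (ys @ [i]) ! t"
    proof (cases "t = length ys")
      case False
      then have "Suc t < length cs" using t by simp
      then show ?thesis by (simp only: mod_less) (simp add: nth_append)
    qed simp
    then show "h (cs ! (t mod length cs)) (cs ! (Suc t mod length cs)) = h (cs ! t) ((ys @ [i]) ! t)"
      by (simp only: mod_less[OF t])
  qed
  finally show ?thesis by (simp add: walk_nth del: upt_Suc)
qed

end

text \<open>Listing the cycle from \<open>i\<close> and restricting to its complement is a bijection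
  onto the pairs of \<open>ys\<close> and \<open>\<tau>\<close>. The function \<open>G\<close> stays
  abstract because the row and column conventions multiply the same cycle products in opposite
  orders.\<close>

lemma sum_permutes_split_cycle:
  assumes "finite S" "i \<in> S"
  shows "(\<Sum>\<sigma> | \<sigma> permutes S. (-1) ^ (card S - ncyc S \<sigma>) *
            G (cprod h \<sigma> i) (map (cprod h \<sigma>) (sorted_list_of_set {x\<in>S. x = Min (cyc \<sigma> x) \<and> i \<notin> cyc \<sigma> x})))
       = (\<Sum>ys\<in>dlists (S - {i}). \<Sum>\<tau> | \<tau> permutes (S - {i} - set ys).
            (-1) ^ length ys * ((-1) ^ (card (S - {i} - set ys) - ncyc (S - {i} - set ys) \<tau>) *
            G (walk h i ys i) (map (cprod h \<tau>) (heads (S - {i} - set ys) \<tau>)) :: quat))"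
    (is "?L = _")
proof -
  let ?D = "Sigma (dlists (S - {i})) (\<lambda>ys. {\<tau>. \<tau> permutes (S - {i} - set ys)})"
  let ?f = "\<lambda>(ys, \<tau>). cycle_of_list (i # ys) \<circ> \<tau>"
  let ?g = "\<lambda>\<sigma>. (tl (orb \<sigma> i), \<lambda>x. if x \<in> set (orb \<sigma> i) then x else \<sigma> x)"
  let ?F = "\<lambda>\<sigma>. (-1) ^ (card S - ncyc S \<sigma>) *
            G (cprod h \<sigma> i) (map (cprod h \<sigma>) (sorted_list_of_set {x\<in>S. x = Min (cyc \<sigma> x) \<and> i \<notin> cyc \<sigma> x}))"
  have locI: "cycle_split S i ys \<tau>" if "(ys, \<tau>) \<in> ?D" for ys \<tau>
    using that assms by unfold_locales auto
  have "?L = (\<Sum>(ys, \<tau>)\<in>?D. (-1) ^ length ys * ((-1) ^ (card (S - {i} - set ys) - ncyc (S - {i} - set ys) \<tau>) *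
            G (walk h i ys i) (map (cprod h \<tau>) (heads (S - {i} - set ys) \<tau>))))"
  proof (rule sum.reindex_bij_witness[where i = ?f and j = ?g])
    fix d assume "d \<in> ?D"
    then obtain ys \<tau> where d: "d = (ys, \<tau>)" "(ys, \<tau>) \<in> ?D" by auto
    interpret cycle_split S i ys \<tau> by (rule locI[OF d(2)])
    have f: "?f d = \<sigma>" by (simp add: d \<sigma>_def)
    show "?f d \<in> {\<sigma>. \<sigma> permutes S}" using sigma_permutes f by simp
    show "?g (?f d) = d" unfolding f orb_i restrict_sigma by (simp add: d)
  next
    fix \<sigma> assume "\<sigma> \<in> {\<sigma>. \<sigma> permutes S}"
    then have s: "\<sigma> permutes S" by simp
    let ?c = "orb \<sigma> i"
    define ys where "ys = tl ?c"
    define \<tau> where "\<tau> = (\<lambda>x. if x \<in> set ?c then x else \<sigma> x)"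
    have c: "?c = i # ys" using hd_orb[OF s assms(1)] by (simp add: ys_def)
    have sc: "set ?c = cyc \<sigma> i" by (rule set_orb[OF s assms(1)])
    have inv: "\<sigma> x \<in> cyc \<sigma> i \<longleftrightarrow> x \<in> cyc \<sigma> i" for x
    proof
      assume "x \<in> cyc \<sigma> i"
      then obtain k where "x = (\<sigma> ^^ k) i" by (auto simp: cyc_def)
      then have "\<sigma> x = (\<sigma> ^^ Suc k) i" by simp
      then show "\<sigma> x \<in> cyc \<sigma> i" unfolding cyc_def by blast
    next
      assume "\<sigma> x \<in> cyc \<sigma> i"
      then obtain k where k: "\<sigma> x = (\<sigma> ^^ k) i" by (auto simp: cyc_def)
      \<comment> \<open>One step back along the cycle; adding the full length first avoids a
        predecessor of \<open>0\<close>.\<close>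
      define k' where "k' = k + cyc_len \<sigma> i - 1"
      have "(\<sigma> ^^ (k + cyc_len \<sigma> i)) i = \<sigma> x"
        using k cyc_len_props(2)[OF s assms(1), of i] by (simp add: funpow_add)
      moreover have "k + cyc_len \<sigma> i = Suc k'" using cyc_len_props(1)[OF s assms(1), of i] by (simp add: k'_def)
      ultimately have "\<sigma> ((\<sigma> ^^ k') i) = \<sigma> x" by simp
      then have "x = (\<sigma> ^^ k') i" using permutes_inj[OF s] by (metis injD)
      then show "x \<in> cyc \<sigma> i" unfolding cyc_def by blast
    qed
    have ysd: "ys \<in> dlists (S - {i})"
      using distinct_orb[OF s assms(1), of i] cyc_subset[OF s assms(2)] sc c by (auto simp: dlists_def)
    have fin: "finite (S - {i} - set ys)" using assms(1) by simp
    have ran: "\<tau> x \<in> S - {i} - set ys" if "x \<in> S - {i} - set ys" for x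
    proof -
      have x: "x \<in> S" "x \<notin> cyc \<sigma> i" using that sc c by auto
      then have "\<sigma> x \<in> S" "\<sigma> x \<notin> cyc \<sigma> i" using inv permutes_in_image[OF s] by auto
      then have "\<sigma> x \<in> S - {i} - set ys" using sc c by auto
      with x sc show ?thesis by (simp add: \<tau>_def)
    qed
    have "inj_on \<tau> (S - {i} - set ys)"
    proof (rule inj_onI)
      fix x y assume *: "x \<in> S - {i} - set ys" "y \<in> S - {i} - set ys" "\<tau> x = \<tau> y"
      then have "\<sigma> x = \<sigma> y" using c by (simp add: \<tau>_def)
      then show "x = y" using permutes_inj[OF s] by (metis injD)
    qed
    then have "bij_betw \<tau> (S - {i} - set ys) (S - {i} - set ys)"
      unfolding bij_betw_def using endo_inj_surj[OF fin, of \<tau>] ran by auto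
    moreover have "\<tau> x = x" if "x \<notin> S - {i} - set ys" for x
    proof (cases "x \<in> set ?c")
      case False
      then have "x \<notin> S" using that c by auto
      then show ?thesis using permutes_not_in[OF s] by (simp add: \<tau>_def)
    qed (simp add: \<tau>_def)
    ultimately have tau: "\<tau> permutes (S - {i} - set ys)"
      by (intro bij_imp_permutes) auto
    show "?g \<sigma> \<in> ?D" using ysd tau by (simp add: ys_def \<tau>_def)
    interpret cycle_split S i ys \<tau>
      using assms ysd tau by unfold_locales
    have "cycle_split.\<sigma> i ys \<tau> = \<sigma>"
    proof
      fix x
      show "cycle_split.\<sigma> i ys \<tau> x = \<sigma> x"
      proof (cases "x \<in> set cs")
        case False
        then show ?thesis using sigma_outside c by (simp add: \<tau>_def)
      next
        case True
        then obtain k where k: "k < length cs" "x = cs ! k" by (metis in_set_conv_nth)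
        have len: "length cs = cyc_len \<sigma> i" using c by (metis length_map length_upt minus_nat.diff_0 orb_def)
        have nth: "cs ! t = (\<sigma> ^^ t) i" if "t < length cs" for t
          using that len unfolding c[symmetric] by (simp add: orb_def)
        have "\<sigma> x = (\<sigma> ^^ Suc k) i" using k nth by simp
        also have "\<dots> = (\<sigma> ^^ (Suc k mod length cs)) i"
          using funpow_mod_eq[OF cyc_len_props(2)[OF s assms(1), of i]] len by simp
        also have "\<dots> = cs ! (Suc k mod length cs)" by (rule nth[symmetric]) simp
        also have "\<dots> = cycle_split.\<sigma> i ys \<tau> x" using sigma_nth[OF k(1)] k(2) by simp
        finally show ?thesis ..
      qed
    qed
    then have sg: "cycle_of_list (i # ys) \<circ> \<tau> = \<sigma>" by (simp add: \<sigma>_def)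
    then show "?f (?g \<sigma>) = \<sigma>" by (simp add: ys_def \<tau>_def)
    have sg': "cycle_split.\<sigma> i ys \<tau> = \<sigma>" using sg by (simp add: \<sigma>_def)
    have "?F \<sigma> = (-1) ^ length ys * ((-1) ^ (card S' - ncyc S' \<tau>) * G (walk h i ys i) (map (cprod h \<tau>) (heads S' \<tau>)))"
      using sign_sigma heads_other cprod_heads[of h] cprod_i[of h]
      unfolding sg' by (simp only: power_add mult.assoc)
    then show "(case ?g \<sigma> of (ys, \<tau>) \<Rightarrow> (-1) ^ length ys * ((-1) ^ (card (S - {i} - set ys) - ncyc (S - {i} - set ys) \<tau>) *
            G (walk h i ys i) (map (cprod h \<tau>) (heads (S - {i} - set ys) \<tau>)))) = ?F \<sigma>"
      by (simp add: ys_def \<tau>_def)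
  qed
  also have "\<dots> = (\<Sum>ys\<in>dlists (S - {i}). \<Sum>\<tau> | \<tau> permutes (S - {i} - set ys).
            (-1) ^ length ys * ((-1) ^ (card (S - {i} - set ys) - ncyc (S - {i} - set ys) \<tau>) *
            G (walk h i ys i) (map (cprod h \<tau>) (heads (S - {i} - set ys) \<tau>))))"
    using assms by (subst sum.Sigma) (auto simp: finite_dlists finite_permutations)
  finally show ?thesis .
qed

subsection \<open>Row and column determinants as sums over cycles\<close>

text \<open>The flag selects the order of the factors: \<open>False\<close> is the row determinant convention,
  \<open>True\<close> the column determinant convention.\<close>

definition tmult :: "bool \<Rightarrow> quat \<Rightarrow> quat \<Rightarrow> quat" where
  "tmult r a b = (if r then b * a else a * b)"

definition tprod :: "bool \<Rightarrow> quat list \<Rightarrow> quat" where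
  "tprod r l = (if r then prod_list (rev l) else prod_list l)"

lemma tprod_Cons: "tprod r (a # l) = tmult r a (tprod r l)"
  by (simp add: tprod_def tmult_def)

text \<open>For Hermitian \<open>h\<close> this is Moore's determinant: no index is distinguished
  and every cycle starts at its minimum. Indexing by a set of naturals makes all principal
  submatrices available without renumbering.\<close>

definition mdetg :: "bool \<Rightarrow> (nat \<Rightarrow> nat \<Rightarrow> quat) \<Rightarrow> nat set \<Rightarrow> quat" where
  "mdetg r h S = (\<Sum>\<sigma> | \<sigma> permutes S. (-1) ^ (card S - ncyc S \<sigma>) * tprod r (map (cprod h \<sigma>) (heads S \<sigma>)))"

text \<open>With \<open>j = i\<close> this is a row or column determinant sorted by the cycle
  through \<open>i\<close>; with \<open>j \<noteq> i\<close> it is a cofactor up to sign. The points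
  of \<open>T\<close> off the path are collected in a determinant.\<close>

definition pathsumg :: "bool \<Rightarrow> (nat \<Rightarrow> nat \<Rightarrow> quat) \<Rightarrow> nat set \<Rightarrow> nat \<Rightarrow> nat \<Rightarrow> quat" where
  "pathsumg r h T j i = (\<Sum>ys\<in>dlists T. (-1) ^ length ys * tmult r (walk h j ys i) (mdetg r h (T - set ys)))"

abbreviation "mdet \<equiv> mdetg False"
abbreviation "pathsum \<equiv> pathsumg False"

lemma sign_right: "x * (-1) ^ k = (-1 :: quat) ^ k * x"
  by (simp add: minus_one_power_commute)

lemma sign_left: "x * ((-1) ^ k * y) = (-1 :: quat) ^ k * (x * y)"
  by (metis mult.assoc sign_right)

lemma sign2: "(-1) ^ a * (x * ((-1) ^ b * y)) = (-1 :: quat) ^ (a + b) * (x * y)"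
  by (metis sign_left mult.assoc power_add)

lemma sign3: "(-1) ^ a * (x * (y * ((-1) ^ b * z))) = (-1 :: quat) ^ (a + b) * (x * (y * z))"
  by (metis sign_left mult.assoc power_add)

lemma sum_tmult_right: "finite A \<Longrightarrow> (\<Sum>x\<in>A. tmult r a (f x)) = tmult r a (sum f A)"
  by (simp add: tmult_def sum_distrib_left sum_distrib_right)

lemma tmult_sign: "(-1) ^ k * tmult r a b = tmult r a ((-1) ^ k * b)"
proof (cases r)
  case False
  then show ?thesis by (simp add: tmult_def mult.assoc[symmetric]) (simp add: minus_one_power_commute)
qed (simp add: tmult_def mult.assoc)

lemma sum_permutes_pathsumg:
  assumes "finite S" "i \<in> S"
  shows "(\<Sum>\<sigma> | \<sigma> permutes S. (-1) ^ (card S - ncyc S \<sigma>) *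
            tmult r (cprod h \<sigma> i) (tprod r (map (cprod h \<sigma>) (sorted_list_of_set {x\<in>S. x = Min (cyc \<sigma> x) \<and> i \<notin> cyc \<sigma> x}))))
       = pathsumg r h (S - {i}) i i"
proof -
  let ?R = "\<lambda>ys. S - {i} - set ys"
  have "(\<Sum>\<tau> | \<tau> permutes (?R ys). (-1) ^ length ys * ((-1) ^ (card (?R ys) - ncyc (?R ys) \<tau>) *
            tmult r (walk h i ys i) (tprod r (map (cprod h \<tau>) (heads (?R ys) \<tau>)))))
      = (-1) ^ length ys * tmult r (walk h i ys i) (mdetg r h (?R ys))" for ys
    unfolding sum_distrib_left[symmetric] tmult_sign[of "card _ - _"] mdetg_def
    by (simp add: sum_tmult_right finite_permutations assms(1))
  then show ?thesis
    by (subst sum_permutes_split_cycle[OF assms, where G = "\<lambda>a l. tmult r a (tprod r l)"])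
      (simp add: pathsumg_def)
qed

text \<open>The least element of \<open>S\<close> heads its own cycle and is the smallest head.
  Hence \<open>mdetg\<close> is the row or column determinant expanded at
  \<open>Min S\<close>.\<close>

lemma heads_Min:
  assumes S: "finite S" "S \<noteq> {}" and s: "\<sigma> permutes S"
  shows "heads S \<sigma> = Min S # sorted_list_of_set {x\<in>S. x = Min (cyc \<sigma> x) \<and> Min S \<notin> cyc \<sigma> x}"
proof -
  let ?m = "Min S" and ?B = "{x\<in>S. x = Min (cyc \<sigma> x) \<and> Min S \<notin> cyc \<sigma> x}"
  have m: "?m \<in> S" using S by simp
  have fin: "finite (cyc \<sigma> x)" if "x \<in> S" for x
    using cyc_subset[OF s that] S(1) by (rule finite_subset)
  have "Min (cyc \<sigma> ?m) = ?m"
    using cyc_subset[OF s m] fin[OF m] self_in_cyc[of ?m \<sigma>] S(1)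
    by (intro Min_eqI) auto
  moreover have "x = ?m" if "x \<in> S" "x = Min (cyc \<sigma> x)" "?m \<in> cyc \<sigma> x" for x
    using that fin[OF that(1)] S(1) by (metis Min_le antisym)
  ultimately have eq: "{x\<in>S. x = Min (cyc \<sigma> x)} = insert ?m ?B"
    using m by auto
  have nin: "?m \<notin> ?B" using self_in_cyc by auto
  have "sorted_list_of_set (insert ?m ?B) = insort ?m (sorted_list_of_set ?B)"
    using S(1) nin by (intro sorted_list_of_set_insert) auto
  also have "\<dots> = ?m # sorted_list_of_set ?B"
    using S(1) by (intro insort_is_Cons) auto
  finally show ?thesis by (simp add: heads_def eq)
qed

lemma mdetg_empty [simp]: "mdetg r h {} = 1"
  by (simp add: mdetg_def heads_def tprod_def)

lemma mdetg_Min: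
  assumes "finite S" "S \<noteq> {}"
  shows "mdetg r h S = pathsumg r h (S - {Min S}) (Min S) (Min S)"
proof -
  have "mdetg r h S = (\<Sum>\<sigma> | \<sigma> permutes S. (-1) ^ (card S - ncyc S \<sigma>) *
            tmult r (cprod h \<sigma> (Min S)) (tprod r (map (cprod h \<sigma>)
              (sorted_list_of_set {x\<in>S. x = Min (cyc \<sigma> x) \<and> Min S \<notin> cyc \<sigma> x}))))"
    unfolding mdetg_def using heads_Min[OF assms] by (intro sum.cong) (simp_all add: tprod_Cons)
  then show ?thesis using assms by (simp add: sum_permutes_pathsumg)
qed

lemma det_defs:
  shows "cyc_prod C \<sigma> = cprod (\<lambda>i j. C $$ (i, j)) \<sigma>"
    and "num_cycles n \<sigma> = ncyc {0..<n} \<sigma>"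
    and "other_cycle_heads n \<sigma> i = sorted_list_of_set {x\<in>{0..<n}. x = Min (cyc \<sigma> x) \<and> i \<notin> cyc \<sigma> x}"
proof -
  have "{cyc \<sigma> x |x. x < n} = cyc \<sigma> ` {0..<n}" by auto
  then show "num_cycles n \<sigma> = ncyc {0..<n} \<sigma>" by (simp add: num_cycles_def ncyc_def)
qed (auto simp: fun_eq_iff cyc_prod_def cprod_def other_cycle_heads_def)

lemma rdet_pathsumg:
  "i < dim_row C \<Longrightarrow> rdet i C = pathsumg False (\<lambda>i j. C $$ (i, j)) ({0..<dim_row C} - {i}) i i"
  by (subst sum_permutes_pathsumg[symmetric]) (auto simp: rdet_def det_defs tmult_def tprod_def Let_def)

lemma cdet_pathsumg:
  "i < dim_row C \<Longrightarrow> cdet i C = pathsumg True (\<lambda>i j. C $$ (i, j)) ({0..<dim_row C} - {i}) i i"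
  by (subst sum_permutes_pathsumg[symmetric]) (auto simp: cdet_def det_defs tmult_def tprod_def Let_def rev_map)

text \<open>Paths survive any injective relabelling; determinants need not, because cycle heads are
  minima. The behaviour of the determinants is therefore a separate assumption.\<close>

lemma pathsumg_relabel:
  assumes "inj_on f T"
    and "\<And>x y. x \<in> insert j (insert i T) \<Longrightarrow> y \<in> insert j (insert i T) \<Longrightarrow> h' x y = h (f x) (f y)"
    and "\<And>U. U \<subseteq> T \<Longrightarrow> mdetg r h' U = mdetg r h (f ` U)"
  shows "pathsumg r h' T j i = pathsumg r h (f ` T) (f j) (f i)"
proof -
  let ?g = "the_inv_into T f"
  have "map ?g (map f ys) = ys" if "ys \<in> dlists T" for ys
    unfolding map_map by (rule map_idI) (use that assms(1) in \<open>auto simp: dlists_def the_inv_into_f_f\<close>)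
  moreover have "map f (map ?g zs) = zs" if "zs \<in> dlists (f ` T)" for zs
    unfolding map_map by (rule map_idI) (use that assms(1) in \<open>auto simp: dlists_def f_the_inv_into_f\<close>)
  moreover have "map f ys \<in> dlists (f ` T)" if "ys \<in> dlists T" for ys
    using that assms(1) by (auto simp: dlists_def distinct_map inj_on_subset)
  moreover have "map ?g zs \<in> dlists T" if "zs \<in> dlists (f ` T)" for zs
    using that assms(1)
    by (auto simp: dlists_def distinct_map the_inv_into_f_f
        intro: inj_on_subset[OF inj_on_the_inv_into[OF assms(1)]] the_inv_into_into)
  moreover have "(-1) ^ length (map f ys) * tmult r (walk h (f j) (map f ys) (f i)) (mdetg r h (f ` T - set (map f ys)))
      = (-1) ^ length ys * tmult r (walk h' j ys i) (mdetg r h' (T - set ys))" if "ys \<in> dlists T" for ys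
  proof -
    have ys: "set ys \<subseteq> T" using that by (simp add: dlists_def)
    have "walk h' j ys i = walk h (f j) (map f ys) (f i)"
      by (rule walk_map) (use assms(2) ys in blast)
    moreover have "mdetg r h' (T - set ys) = mdetg r h (f ` T - set (map f ys))"
      using assms(3)[of "T - set ys"] inj_on_image_set_diff[OF assms(1), of T "set ys"] ys by simp
    ultimately show ?thesis by simp
  qed
  ultimately show ?thesis
    unfolding pathsumg_def
    by (intro sum.reindex_bij_witness[where i = "map ?g" and j = "map f"]) blast+
qed

text \<open>Monotonicity preserves the minimum of each set and thus the index of expansion. Removing
  a cycle shrinks the set, which suits induction over proper subsets.\<close>

lemma mdetg_relabel:
  assumes "finite S" "strict_mono_on S f" "\<And>x y. x \<in> S \<Longrightarrow> y \<in> S \<Longrightarrow> h' x y = h (f x) (f y)"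
  shows "mdetg r h' S = mdetg r h (f ` S)"
  using assms
proof (induction S rule: finite_psubset_induct)
  case (psubset S)
  show ?case
  proof (cases "S = {}")
    case False
    let ?m = "Min S"
    have m: "?m \<in> S" using psubset.hyps False by simp
    have fm: "Min (f ` S) = f ?m"
    proof (rule Min_eqI)
      fix y assume "y \<in> f ` S"
      then obtain x where "x \<in> S" "y = f x" by auto
      moreover have "?m \<le> x" using \<open>x \<in> S\<close> psubset.hyps by simp
      ultimately show "f ?m \<le> y"
        using psubset.prems(1) m strict_mono_on_leD by blast
    qed (use psubset.hyps m in auto)
    have inj: "inj_on f S" using psubset.prems(1) by (rule strict_mono_on_imp_inj_on)
    have "mdetg r h' S = pathsumg r h' (S - {?m}) ?m ?m"
      by (rule mdetg_Min[OF psubset.hyps False])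
    also have "\<dots> = pathsumg r h (f ` (S - {?m})) (f ?m) (f ?m)"
    proof (rule pathsumg_relabel)
      fix U assume U: "U \<subseteq> S - {?m}"
      then have "U \<subset> S" using m by auto
      then show "mdetg r h' U = mdetg r h (f ` U)"
      proof (rule psubset.IH)
        show "strict_mono_on U f"
          using psubset.prems(1) \<open>U \<subset> S\<close> by (simp add: strict_mono_on_def psubset_eq subset_iff)
        show "h' x y = h (f x) (f y)" if "x \<in> U" "y \<in> U" for x y
          using psubset.prems(2) that \<open>U \<subset> S\<close> by blast
      qed
    qed (use inj m psubset.prems(2) in \<open>auto intro: inj_on_subset\<close>)
    also have "f ` (S - {?m}) = f ` S - {f ?m}"
      using inj m by (simp add: inj_on_image_set_diff[OF inj])
    finally show ?thesis
      using mdetg_Min[of "f ` S" r h] psubset.hyps False fm by simp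
  qed simp
qed

lemma mdetg_cong:
  "finite S \<Longrightarrow> (\<And>x y. x \<in> S \<Longrightarrow> y \<in> S \<Longrightarrow> h' x y = h x y) \<Longrightarrow> mdetg r h' S = mdetg r h S"
  using mdetg_relabel[of S id h' h r] by (simp add: strict_mono_on_def)

text \<open>Paths are sorted by their first interior vertex, whose removal flips the sign. The empty
  path contributes the direct edge times the determinant of all of \<open>T\<close>.\<close>

lemma pathsum_rec:
  assumes "finite T"
  shows "pathsum h T j i = h j i * mdet h T - (\<Sum>k\<in>T. h j k * pathsum h (T - {k}) k i)"
proof -
  have "(-1) ^ length (k # ys) * tmult False (walk h j (k # ys) i) (mdet h (T - set (k # ys)))
      = - (h j k * ((-1) ^ length ys * tmult False (walk h k ys i) (mdet h (T - {k} - set ys))))" for k ys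
  proof -
    have "T - set (k # ys) = T - {k} - set ys" by auto
    then show ?thesis
      by (simp add: tmult_def mult.assoc sign_left)
  qed
  then show ?thesis
    unfolding pathsumg_def by (subst sum_dlists_Cons[OF assms])
      (simp add: sum_distrib_left sum_negf tmult_def)
qed

text \<open>Entry \<open>(k, i)\<close> of the adjugate. A path from \<open>k\<close> to
  \<open>i\<close> with \<open>l\<close> interior vertices is closed by an edge from
  \<open>i\<close> to \<open>k\<close> into a cycle of length \<open>l + 2\<close>, whose sign
  exponent is \<open>l + 1\<close>; this accounts for the minus sign in front of
  \<open>pathsum\<close>.\<close>

definition adjf :: "(nat \<Rightarrow> nat \<Rightarrow> quat) \<Rightarrow> nat set \<Rightarrow> nat \<Rightarrow> nat \<Rightarrow> quat" where
  "adjf h S k i = (if k = i then mdet h (S - {i}) else - pathsum h (S - {i} - {k}) k i)"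

lemma sum_mult_adjf:
  assumes "finite S" "i \<in> S"
  shows "(\<Sum>k\<in>S. b k * adjf h S k i) = b i * mdet h (S - {i}) - (\<Sum>k\<in>S - {i}. b k * pathsum h (S - {i} - {k}) k i)"
  using assms by (simp add: sum.remove[OF assms] adjf_def sum_negf)

text \<open>The adjugate column is chosen so that \<open>pathsum_rec\<close> becomes a matrix
  product. The resulting path sum is evaluated later, for Hermitian \<open>h\<close>.\<close>

lemma sum_row_adjf:
  assumes "finite S" "i \<in> S"
  shows "(\<Sum>k\<in>S. h j k * adjf h S k i) = pathsum h (S - {i}) j i"
  using assms by (simp add: sum_mult_adjf pathsum_rec[of "S - {i}"])

lemma walk_cong_row:
  "(\<And>x y. x \<in> insert a (set ys) \<Longrightarrow> y \<in> insert b (set ys) \<Longrightarrow> h' x y = h x y) \<Longrightarrow> walk h' a ys b = walk h a ys b"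
proof (induction ys arbitrary: a)
  case (Cons y ys)
  have "walk h' y ys b = walk h y ys b"
    by (rule Cons.IH) (use Cons.prems in auto)
  then show ?case using Cons.prems by simp
qed simp

text \<open>A cycle at \<open>i\<close> leaves \<open>i\<close> only in its first step, so the
  replaced row is read exactly once and as the leftmost factor. The rest of the cycle and the
  complementary determinants see only entries of \<open>h\<close>.\<close>

lemma pathsum_replace_row:
  assumes "finite S" "i \<in> S" and b: "\<And>k. k \<in> S \<Longrightarrow> c i k = b k"
    and h: "\<And>x y. x \<in> S - {i} \<Longrightarrow> y \<in> S \<Longrightarrow> c x y = h x y"
  shows "pathsum c (S - {i}) i i = (\<Sum>k\<in>S. b k * adjf h S k i)"
proof -
  have m: "mdet c U = mdet h U" if "U \<subseteq> S - {i}" for U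
    using that assms(1) h by (intro mdetg_cong) (auto intro: finite_subset)
  have p: "pathsum c (S - {i} - {k}) k i = pathsum h (S - {i} - {k}) k i" if "k \<in> S - {i}" for k
    unfolding pathsumg_def
  proof (intro sum.cong refl)
    fix ys assume "ys \<in> dlists (S - {i} - {k})"
    then have ys: "set ys \<subseteq> S - {i}" by (auto simp: dlists_def)
    have "walk c k ys i = walk h k ys i"
      by (rule walk_cong_row) (use ys that assms(2) h in blast)
    then show "(-1) ^ length ys * tmult False (walk c k ys i) (mdet c (S - {i} - {k} - set ys))
       = (-1) ^ length ys * tmult False (walk h k ys i) (mdet h (S - {i} - {k} - set ys))"
      by (simp add: m Diff_subset subset_trans[OF Diff_subset])
  qed
  show ?thesis
    using assms(1,2) by (simp add: sum_mult_adjf pathsum_rec[of "S - {i}"] m p b)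
qed

subsection \<open>The Moore determinant of a Hermitian matrix\<close>

definition rpart :: "quat \<Rightarrow> quat" where "rpart z = Quat (Re z) 0 0 0"

lemma rpart_simps: "Re (rpart z) = Re z" "Im1 (rpart z) = 0" "Im2 (rpart z) = 0" "Im3 (rpart z) = 0"
  by (simp_all add: rpart_def)

lemma rpart_fixed: "qcnj z = z \<Longrightarrow> rpart z = z"
  by (simp add: qcnj_fixed_iff quat_eq_iff rpart_simps)

lemma rpart_mult_fixed: "qcnj d = d \<Longrightarrow> rpart (x * d) = rpart x * d"
  by (simp add: qcnj_fixed_iff quat_eq_iff rpart_simps)

lemma rpart_mult_commute: "rpart (x * y) = rpart (y * x)"
  by (simp add: quat_eq_iff rpart_simps algebra_simps)

lemma rpart_commute: "rpart x * y = y * rpart x"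
  by (simp add: quat_eq_iff rpart_simps algebra_simps)

lemma rpart_sum: "rpart (sum f A) = (\<Sum>x\<in>A. rpart (f x))"
proof (induction A rule: infinite_finite_induct)
  case (insert x F)
  have "rpart (a + b) = rpart a + rpart b" for a b by (simp add: quat_eq_iff rpart_simps)
  with insert show ?case by simp
qed (simp_all add: quat_eq_iff rpart_simps)

lemma rpart_sign: "rpart ((-1) ^ k * x) = (-1) ^ k * rpart x"
  by (metis minus_one_power_commute qcnj_power qcnj_simps(2,4) rpart_mult_fixed)

lemma qcnj_walk_adjoint:
  "qcnj (walk h a ys b) = walk (\<lambda>x y. qcnj (h y x)) b (rev ys) a"
  by (induction ys arbitrary: a) (simp_all add: walk_append)

locale hermitian_function =
  fixes h :: "nat \<Rightarrow> nat \<Rightarrow> quat"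
  assumes herm: "qcnj (h i j) = h j i"
begin

lemma qcnj_walk: "qcnj (walk h a ys b) = walk h b (rev ys) a"
  by (simp add: qcnj_walk_adjoint herm)

text \<open>Conjugation reverses every path. Reality of the determinants is an assumption here
  because the lemma first serves inside the induction that establishes it.\<close>

lemma qcnj_pathsum_aux:
  assumes "\<And>U. U \<subseteq> T \<Longrightarrow> qcnj (mdet h U) = mdet h U"
  shows "qcnj (pathsum h T j i) = pathsum h T i j"
  unfolding pathsumg_def qcnj_sum
proof (rule sum.reindex_bij_witness[of _ rev rev])
  fix ys
  have m: "qcnj (mdet h (T - set ys)) = mdet h (T - set ys)" by (rule assms) auto
  show "(-1) ^ length (rev ys) * tmult False (walk h i (rev ys) j) (mdet h (T - set (rev ys)))
    = qcnj ((-1) ^ length ys * tmult False (walk h j ys i) (mdet h (T - set ys)))"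
    by (simp add: tmult_def qcnj_power m qcnj_walk qcnj_fixed_commute[OF m] mult.assoc sign_right)
qed (auto simp: dlists_def)

text \<open>The sum over all cycles at \<open>i\<close> is self-conjugate, hence equal to its real
  part, and the real part may be taken term by term because the determinant factors are
  real.\<close>

lemma pathsum_rpart_aux:
  assumes "\<And>U. U \<subseteq> T \<Longrightarrow> qcnj (mdet h U) = mdet h U"
  shows "pathsum h T i i = (\<Sum>ys\<in>dlists T. (-1) ^ length ys * (rpart (walk h i ys i) * mdet h (T - set ys)))"
proof -
  have "pathsum h T i i = rpart (pathsum h T i i)"
    using qcnj_pathsum_aux[OF assms] by (simp add: rpart_fixed)
  also have "\<dots> = (\<Sum>ys\<in>dlists T. (-1) ^ length ys * (rpart (walk h i ys i) * mdet h (T - set ys)))"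
    unfolding pathsumg_def rpart_sum
    by (intro sum.cong) (simp_all add: rpart_sign tmult_def rpart_mult_fixed assms)
  finally show ?thesis .
qed

text \<open>The Moore determinant does not depend on the index at which it is expanded: pairs of disjoint
  cycles at \<open>a\<close> and \<open>b\<close> enter symmetrically, and a cycle through both indices can be rotated, as only
  the real part of its product matters.\<close>

lemma mdet_aux:
  assumes "finite S"
  shows "mdetg True h S = mdet h S \<and> qcnj (mdet h S) = mdet h S \<and> (\<forall>i\<in>S. mdet h S = pathsum h (S - {i}) i i)"
  using assms
proof (induction S rule: finite_psubset_induct)
  case (psubset S)
  show ?case
  proof (cases "S = {}")
    case False
    let ?m = "Min S"
    have m: "?m \<in> S" using psubset.hyps False by simp
    \<comment> \<open>The three claims need a joint induction: each of them for \<open>S\<close>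
      uses the reality of the determinants of proper subsets.\<close>
    have re: "qcnj (mdet h U) = mdet h U" if "U \<subseteq> S - {i}" "i \<in> S" for U i
      using psubset.IH[of U] that by auto
    have exp: "mdet h U = pathsum h (U - {i}) i i" if "U \<subset> S" "i \<in> U" for U i
      using psubset.IH[of U] that by blast
    have rev: "mdetg True h U = mdet h U" if "U \<subset> S" for U
      using psubset.IH[of U] that by blast
    have "mdetg True h S = pathsumg True h (S - {?m}) ?m ?m"
      by (rule mdetg_Min[OF psubset.hyps False])
    also have "\<dots> = pathsum h (S - {?m}) ?m ?m"
      unfolding pathsumg_def
    proof (intro sum.cong refl)
      fix ys
      have U: "S - {?m} - set ys \<subset> S" using m by auto
      have "qcnj (mdet h (S - {?m} - set ys)) = mdet h (S - {?m} - set ys)"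
        using re[of _ ?m] m by auto
      then show "(-1) ^ length ys * tmult True (walk h ?m ys ?m) (mdetg True h (S - {?m} - set ys))
        = (-1) ^ length ys * tmult False (walk h ?m ys ?m) (mdet h (S - {?m} - set ys))"
        by (simp add: rev[OF U] tmult_def qcnj_fixed_commute)
    qed
    finally have 1: "mdetg True h S = mdet h S"
      using mdetg_Min[OF psubset.hyps False, of False] by simp
    have 2: "qcnj (mdet h S) = mdet h S"
      unfolding mdetg_Min[OF psubset.hyps False, of False]
      by (rule qcnj_pathsum_aux) (use re m in blast)
    \<comment> \<open>The case of \<open>b\<close> off the cycle at \<open>a\<close>: two disjoint
      cycles, symmetric in \<open>a\<close> and \<open>b\<close>.\<close>
    define w where "w a b us vs = (-1) ^ (length us + length vs) * (rpart (walk h a us a) * (rpart (walk h b vs b)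
        * mdet h (S - {a} - {b} - set us - set vs)))" for a b us vs
    \<comment> \<open>The case of \<open>b\<close> on the cycle at \<open>a\<close>, which is cut
      there; \<open>b\<close> itself counts as an interior vertex, whence the minus sign.\<close>
    define v where "v a b us vs = - ((-1) ^ (length us + length vs) * (rpart (walk h a us b * walk h b vs a)
        * mdet h (S - {a} - {b} - set us - set vs)))" for a b us vs
    have key: "pathsum h (S - {a}) a a
        = (\<Sum>us\<in>dlists (S - {a} - {b}). \<Sum>vs\<in>dlists (S - {a} - {b} - set us). w a b us vs)
        + (\<Sum>us\<in>dlists (S - {a} - {b}). \<Sum>vs\<in>dlists (S - {a} - {b} - set us). v a b us vs)"
      if a: "a \<in> S" and b: "b \<in> S" and ab: "a \<noteq> b" for a b
    proof -
      have b': "b \<in> S - {a}" using b ab by simp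
      have fin: "finite (S - {a})" using psubset.hyps by simp
      have "(-1) ^ length us * (rpart (walk h a us a) * mdet h (S - {a} - set us))
         = (\<Sum>vs\<in>dlists (S - {a} - {b} - set us). w a b us vs)" if us: "us \<in> dlists (S - {a} - {b})" for us
      proof -
        have bU: "b \<in> S - {a} - set us" using b' us by (auto simp: dlists_def)
        have U: "S - {a} - set us \<subset> S" using a by auto
        have eqs: "S - {a} - set us - {b} = S - {a} - {b} - set us" by auto
        have "mdet h (S - {a} - set us) = pathsum h (S - {a} - {b} - set us) b b"
          using exp[OF U bU] eqs by simp
        also have "\<dots> = (\<Sum>vs\<in>dlists (S - {a} - {b} - set us). (-1) ^ length vs
            * (rpart (walk h b vs b) * mdet h (S - {a} - {b} - set us - set vs)))"
          by (rule pathsum_rpart_aux) (use re[OF _ a] in auto)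
        finally show ?thesis
          by (simp add: sum_distrib_left w_def sign2)
      qed
      moreover have "(-1) ^ length (us @ b # vs) * (rpart (walk h a (us @ b # vs) a) * mdet h (S - {a} - set (us @ b # vs)))
          = v a b us vs" for us vs
      proof -
        have "S - {a} - set (us @ b # vs) = S - {a} - {b} - set us - set vs" by auto
        then show ?thesis by (simp add: v_def walk_append)
      qed
      ultimately show ?thesis
        unfolding pathsum_rpart_aux[OF re[OF _ a], of "S - {a}", simplified] sum_dlists_split[OF fin b']
        by simp
    qed
    have 3: "pathsum h (S - {a}) a a = pathsum h (S - {b}) b b" if "a \<in> S" "b \<in> S" "a \<noteq> b" for a b
    proof -
      have eq: "S - {b} - {a} = S - {a} - {b}" by auto
      have U: "finite (S - {a} - {b})" using psubset.hyps by simp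
      have "w a b us vs = w b a vs us" for us vs
      proof -
        have "S - {a} - {b} - set us - set vs = S - {b} - {a} - set vs - set us" by auto
        moreover have "rpart x * (rpart y * z) = rpart y * (rpart x * z)" for x y z
          by (metis mult.assoc rpart_commute)
        ultimately show ?thesis
          unfolding w_def by (simp only: add.commute)
      qed
      moreover have "v a b us vs = v b a vs us" for us vs
      proof -
        have "S - {a} - {b} - set us - set vs = S - {b} - {a} - set vs - set us" by auto
        then show ?thesis
          unfolding v_def by (simp add: add.commute rpart_mult_commute[of "walk h a us b"])
      qed
      ultimately show ?thesis
        using key[OF that] key[OF that(2,1) that(3)[symmetric]] eq
          sum_dlists_swap[OF U, of "w a b"] sum_dlists_swap[OF U, of "v a b"] by simp
    qed
    have "\<forall>i\<in>S. mdet h S = pathsum h (S - {i}) i i"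
      using 3 m mdetg_Min[OF psubset.hyps False, of False] by metis
    with 1 2 show ?thesis by blast
  qed simp
qed

lemma mdetg_True: "finite S \<Longrightarrow> mdetg True h S = mdet h S"
  and qcnj_mdet: "finite S \<Longrightarrow> qcnj (mdet h S) = mdet h S"
  and mdet_expand: "finite S \<Longrightarrow> i \<in> S \<Longrightarrow> mdet h S = pathsum h (S - {i}) i i"
  using mdet_aux by blast+

lemma mdet_commute: "finite S \<Longrightarrow> mdet h S * x = x * mdet h S"
  by (simp add: qcnj_mdet qcnj_fixed_commute)

lemma qcnj_pathsum: "finite T \<Longrightarrow> qcnj (pathsum h T j i) = pathsum h T i j"
  by (rule qcnj_pathsum_aux) (auto intro: qcnj_mdet finite_subset)

text \<open>A path from \<open>j\<close> to \<open>i\<close> that revisits \<open>j\<close> is a cycle at \<open>j\<close> followed by a path avoiding \<open>j\<close>;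
  it cancels against the same path with the cycle moved into the determinant of the complement.\<close>

lemma pathsum_repeated_row:
  assumes "finite T" "j \<in> T"
  shows "pathsum h T j i = 0"
proof -
  let ?U = "T - {j}"
  have U: "finite ?U" using assms by simp
  \<comment> \<open>The cycle at \<open>j\<close> split off from a path that revisits
    \<open>j\<close>, with the determinant of what remains. Summed over \<open>us\<close> it is the
    expansion at \<open>j\<close> of the determinant of \<open>T - set vs\<close>.\<close>
  let ?A = "\<lambda>us vs. (-1) ^ length us * (walk h j us j * mdet h (?U - set us - set vs))"
  have split: "(-1) ^ length (us @ j # vs) * tmult False (walk h j (us @ j # vs) i) (mdet h (T - set (us @ j # vs)))
     = - (?A us vs * ((-1) ^ length vs * walk h j vs i))" for us vs
  proof -
    have eq: "T - set (us @ j # vs) = ?U - set us - set vs" by auto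
    have c: "walk h j vs i * mdet h (?U - set us - set vs) = mdet h (?U - set us - set vs) * walk h j vs i"
      using assms(1) by (simp add: mdet_commute)
    show ?thesis
      unfolding eq tmult_def walk_append
      by (simp add: mult.assoc c sign3)
  qed
  have sumA: "(\<Sum>us\<in>dlists (?U - set vs). ?A us vs) = mdet h (T - set vs)" if "vs \<in> dlists ?U" for vs
  proof -
    have j: "j \<in> T - set vs" using that assms(2) by (auto simp: dlists_def)
    have eq: "T - set vs - {j} = ?U - set vs" "\<And>us. ?U - set vs - set us = ?U - set us - set vs" by auto
    show ?thesis
      using mdet_expand[of "T - set vs" j] assms(1) j by (simp add: pathsumg_def eq tmult_def)
  qed
  have "pathsum h T j i = (\<Sum>vs\<in>dlists ?U. (-1) ^ length vs * (walk h j vs i * mdet h (T - set vs)))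
     + (\<Sum>us\<in>dlists ?U. \<Sum>vs\<in>dlists (?U - set us). - (?A us vs * ((-1) ^ length vs * walk h j vs i)))"
    unfolding pathsumg_def sum_dlists_split[OF assms] split by (simp add: tmult_def)
  also have "(\<Sum>us\<in>dlists ?U. \<Sum>vs\<in>dlists (?U - set us). - (?A us vs * ((-1) ^ length vs * walk h j vs i)))
     = (\<Sum>vs\<in>dlists ?U. \<Sum>us\<in>dlists (?U - set vs). - (?A us vs * ((-1) ^ length vs * walk h j vs i)))"
    by (rule sum_dlists_swap[OF U])
  also have "\<dots> = (\<Sum>vs\<in>dlists ?U. - (mdet h (T - set vs) * ((-1) ^ length vs * walk h j vs i)))"
    by (intro sum.cong refl) (simp add: sum_negf sum_distrib_right[symmetric] sumA)
  also have "\<dots> = - (\<Sum>vs\<in>dlists ?U. (-1) ^ length vs * (walk h j vs i * mdet h (T - set vs)))"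
    using assms(1) by (simp add: sum_negf mdet_commute mult.assoc sign_left)
  finally show ?thesis by simp
qed

lemma qcnj_adjf: "finite S \<Longrightarrow> qcnj (adjf h S k i) = adjf h S i k"
proof -
  assume S: "finite S"
  have "S - {k} - {i} = S - {i} - {k}" by auto
  with S show ?thesis by (simp add: adjf_def qcnj_mdet qcnj_pathsum)
qed

text \<open>Besides the two classical cases there is a row \<open>j\<close> outside
  \<open>S\<close>. It yields, up to sign, an adjugate entry of \<open>insert j S\<close>, and this
  term links the adjugates of consecutive orders.\<close>

lemma sum_row_adjf_cases:
  assumes "finite S" "i \<in> S"
  shows "(\<Sum>k\<in>S. h j k * adjf h S k i)
    = (if j = i then mdet h S else if j \<in> S then 0 else - adjf h (insert j S) j i)"
proof -
  have "insert j S - {i} - {j} = S - {i}" if "j \<notin> S" using that by auto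
  then show ?thesis
    using assms sum_row_adjf[OF assms, of h j] mdet_expand[OF assms] pathsum_repeated_row[of "S - {i}" j i]
    by (auto simp: adjf_def)
qed

text \<open>Obtained from the row version applied to the conjugate transpose of \<open>c\<close>.
  Although \<open>c\<close> need not be Hermitian, all complementary determinants avoid
  \<open>i\<close> and therefore are those of \<open>h\<close>.\<close>

lemma pathsumg_replace_col:
  assumes S: "finite S" "i \<in> S" and b: "\<And>k. k \<in> S \<Longrightarrow> c k i = b k"
    and h: "\<And>x y. x \<in> S \<Longrightarrow> y \<in> S - {i} \<Longrightarrow> c x y = h x y"
  shows "pathsumg True c (S - {i}) i i = (\<Sum>k\<in>S. adjf h S i k * b k)"
proof -
  let ?T = "S - {i}" and ?c = "\<lambda>x y. qcnj (c y x)"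
  have m: "mdetg True c U = mdet h U" "mdet ?c U = mdet h U" if "U \<subseteq> ?T" for U
  proof -
    have U: "finite U" using that S(1) finite_subset by blast
    have "mdetg True c U = mdetg True h U" by (rule mdetg_cong[OF U]) (use that h in blast)
    then show "mdetg True c U = mdet h U" using U by (simp add: mdetg_True)
    show "mdet ?c U = mdet h U"
    proof (rule mdetg_cong[OF U])
      fix x y assume "x \<in> U" "y \<in> U"
      then have "c y x = h y x" using that by (intro h) auto
      then show "qcnj (c y x) = h x y" by (simp add: herm)
    qed
  qed
  have "pathsumg True c ?T i i = qcnj (pathsum ?c ?T i i)"
    unfolding pathsumg_def qcnj_sum
  proof (rule sum.reindex_bij_witness[of _ rev rev])
    fix ys
    have U: "?T - set ys \<subseteq> ?T" by auto
    have "qcnj (walk ?c i (rev ys) i) = walk c i ys i" by (simp add: qcnj_walk_adjoint)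
    then show "qcnj ((-1) ^ length (rev ys) * tmult False (walk ?c i (rev ys) i) (mdet ?c (?T - set (rev ys))))
      = (-1) ^ length ys * tmult True (walk c i ys i) (mdetg True c (?T - set ys))"
      using S(1) by (simp add: tmult_def qcnj_power m[OF U] qcnj_mdet mult.assoc sign_right)
  qed (auto simp: dlists_def)
  also have "pathsum ?c ?T i i = (\<Sum>k\<in>S. qcnj (b k) * adjf h S k i)"
    by (rule pathsum_replace_row[OF S]) (use b h herm in auto)
  also have "qcnj \<dots> = (\<Sum>k\<in>S. adjf h S i k * b k)"
    using S(1) by (simp add: qcnj_sum qcnj_adjf)
  finally show ?thesis .
qed

end

subsection \<open>Quaternion matrices\<close>

lemma mult_entry:
  "A \<in> carrier_mat m k \<Longrightarrow> B \<in> carrier_mat k n \<Longrightarrow> i < m \<Longrightarrow> j < n \<Longrightarrow>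
    (A * B) $$ (i, j) = (\<Sum>t\<in>{0..<k}. A $$ (i, t) * B $$ (t, j))"
  by (auto simp: scalar_prod_def)

lemma cstar_carrier [simp]: "A \<in> carrier_mat m n \<Longrightarrow> cstar A \<in> carrier_mat n m"
  by (auto simp: cstar_def)

lemma cstar_dims [simp]: "dim_row (cstar A) = dim_col A" "dim_col (cstar A) = dim_row A"
  by (auto simp: cstar_def)

lemma cstar_entry: "i < dim_col A \<Longrightarrow> j < dim_row A \<Longrightarrow> cstar A $$ (i, j) = qcnj (A $$ (j, i))"
  by (simp add: cstar_def)

lemma cstar_cstar [simp]: "cstar (cstar A) = A"
  by (rule eq_matI) (auto simp: cstar_entry)

lemma cstar_mult: "A \<in> carrier_mat m k \<Longrightarrow> B \<in> carrier_mat k n \<Longrightarrow> cstar (A * B) = cstar B * cstar A"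
  by (rule eq_matI) (auto simp: cstar_entry mult_entry[of A m k B n] mult_entry[of "cstar B" n k "cstar A" m] qcnj_sum
      simp del: index_mult_mat(1))

lemma cstar_add: "A \<in> carrier_mat m n \<Longrightarrow> B \<in> carrier_mat m n \<Longrightarrow> cstar (A + B) = cstar A + cstar B"
  by (rule eq_matI) (auto simp: cstar_entry)

lemma cstar_minus: "A \<in> carrier_mat m n \<Longrightarrow> B \<in> carrier_mat m n \<Longrightarrow> cstar (A - B) = cstar A - cstar B"
  by (rule eq_matI) (auto simp: cstar_entry)

lemma cstar_one [simp]: "cstar (1\<^sub>m n) = 1\<^sub>m n"
  by (rule eq_matI) (auto simp: cstar_entry)

lemma cstar_smult: "qcnj d = d \<Longrightarrow> cstar (d \<cdot>\<^sub>m A) = d \<cdot>\<^sub>m cstar A"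
  by (rule eq_matI) (auto simp: cstar_entry qcnj_fixed_commute[of d])

lemma smult_mult_left: "A \<in> carrier_mat m k \<Longrightarrow> B \<in> carrier_mat k n \<Longrightarrow> (d \<cdot>\<^sub>m A) * B = d \<cdot>\<^sub>m (A * B :: quat mat)"
  by (rule eq_matI)
    (auto simp: mult_entry[of A m k B n] mult_entry[of "d \<cdot>\<^sub>m A" m k B n] sum_distrib_left mult.assoc simp del: index_mult_mat(1))

lemma smult_mult_right:
  "qcnj d = d \<Longrightarrow> A \<in> carrier_mat m k \<Longrightarrow> B \<in> carrier_mat k n \<Longrightarrow> A * (d \<cdot>\<^sub>m B) = d \<cdot>\<^sub>m (A * B)"
proof -
  assume *: "qcnj d = d" "A \<in> carrier_mat m k" "B \<in> carrier_mat k n"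
  have "x * (d * y) = d * (x * y)" for x y
    by (metis mult.assoc qcnj_fixed_commute[OF *(1)])
  with * show ?thesis
    by (intro eq_matI) (auto simp: mult_entry[of A m k B n] mult_entry[of A m k "d \<cdot>\<^sub>m B" n] sum_distrib_left
      simp del: index_mult_mat(1))
qed

lemma smult_mat_smult: "a \<cdot>\<^sub>m (b \<cdot>\<^sub>m A) = (a * b) \<cdot>\<^sub>m (A :: quat mat)"
  by (rule eq_matI) (auto simp: mult.assoc)

lemma one_smult [simp]: "(1 :: quat) \<cdot>\<^sub>m A = A"
  by (rule eq_matI) auto

lemma qcnj_inverse: "qcnj (inverse d) = inverse (qcnj d)"
  by (simp add: quat_eq_iff)

text \<open>A total entry function, zero outside the matrix, so that
  \<open>hermitian_function\<close> can demand symmetry at all pairs of indices.\<close>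

definition ent :: "quat mat \<Rightarrow> nat \<Rightarrow> nat \<Rightarrow> quat" where
  "ent C i j = (if i < dim_row C \<and> j < dim_col C then C $$ (i, j) else 0)"

lemma ent_carrier: "C \<in> carrier_mat m n \<Longrightarrow> i < m \<Longrightarrow> j < n \<Longrightarrow> ent C i j = C $$ (i, j)"
  by (auto simp: ent_def)

lemma hermitian_function_ent: "hermitian H \<Longrightarrow> hermitian_function (ent H)"
proof
  fix i j assume H: "hermitian H"
  then have sq: "dim_row H = dim_col H" and eq: "cstar H = H" by (auto simp: hermitian_def)
  show "qcnj (ent H i j) = ent H j i"
    using arg_cong[OF eq, of "\<lambda>X. X $$ (j, i)"] sq by (auto simp: ent_def cstar_entry)
qed

lemma hermitianI: "H \<in> carrier_mat n n \<Longrightarrow> cstar H = H \<Longrightarrow> hermitian H"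
  by (auto simp: hermitian_def)

lemma hermitian_cstar: "hermitian H \<Longrightarrow> cstar H = H"
  by (simp add: hermitian_def)

subsection \<open>Compound adjugates\<close>

definition adjm :: "nat \<Rightarrow> quat mat \<Rightarrow> quat mat" where
  "adjm s H = mat (dim_row H) (dim_row H)
     (\<lambda>(k, i). \<Sum>\<beta> | \<beta> \<in> seqs s (dim_row H) \<and> k \<in> \<beta> \<and> i \<in> \<beta>. adjf (ent H) \<beta> k i)"

definition msum :: "nat \<Rightarrow> quat mat \<Rightarrow> quat" where
  "msum s H = (\<Sum>\<beta>\<in>seqs s (dim_row H). mdet (ent H) \<beta>)"

lemma finite_seqs [simp]: "finite (seqs s n)"
  by (rule finite_subset[of _ "Pow {0..<n}"]) (auto simp: seqs_def)

lemma seqs_finite: "\<beta> \<in> seqs s n \<Longrightarrow> finite \<beta>"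
  by (auto simp: seqs_def dest: finite_subset)

lemma seqs_0: "seqs 0 n = {{}}"
  using finite_subset[of _ "{0..<n}"] by (auto simp: seqs_def)

lemma seqs_full: "seqs n n = {{0..<n}}"
  using card_subset_eq[of "{0..<n}"] by (auto simp: seqs_def)

lemma seqs_large: "s > n \<Longrightarrow> seqs s n = {}"
proof -
  assume "s > n"
  then have "card \<beta> \<noteq> s" if "\<beta> \<subseteq> {0..<n}" for \<beta>
    using card_mono[OF _ that] by auto
  then show ?thesis by (auto simp: seqs_def)
qed

lemma adjm_carrier [simp]: "H \<in> carrier_mat n n \<Longrightarrow> adjm s H \<in> carrier_mat n n"
  by (auto simp: adjm_def)

lemma adjm_entry: "H \<in> carrier_mat n n \<Longrightarrow> k < n \<Longrightarrow> i < n \<Longrightarrow>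
    adjm s H $$ (k, i) = (\<Sum>\<beta> | \<beta> \<in> seqs s n \<and> k \<in> \<beta> \<and> i \<in> \<beta>. adjf (ent H) \<beta> k i)"
  by (auto simp: adjm_def)

lemma adjm_0: "H \<in> carrier_mat n n \<Longrightarrow> adjm 0 H = 0\<^sub>m n n"
proof -
  assume H: "H \<in> carrier_mat n n"
  then show ?thesis by (intro eq_matI) (auto simp: adjm_def seqs_0 intro!: sum.neutral)
qed

lemma adjm_large: "H \<in> carrier_mat n n \<Longrightarrow> s > n \<Longrightarrow> adjm s H = 0\<^sub>m n n"
  by (rule eq_matI) (auto simp: adjm_def seqs_large)

lemma adjm_full_entry: "H \<in> carrier_mat n n \<Longrightarrow> k < n \<Longrightarrow> i < n \<Longrightarrow> adjm n H $$ (k, i) = adjf (ent H) {0..<n} k i"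
proof -
  assume *: "H \<in> carrier_mat n n" "k < n" "i < n"
  then have "{\<beta>. \<beta> \<in> seqs n n \<and> k \<in> \<beta> \<and> i \<in> \<beta>} = {{0..<n}}"
    by (auto simp: seqs_full)
  with * show ?thesis by (simp add: adjm_entry)
qed

lemma msum_0: "msum 0 H = 1"
  by (simp add: msum_def seqs_0)

lemma qcnj_msum: "hermitian H \<Longrightarrow> qcnj (msum s H) = msum s H"
  unfolding msum_def qcnj_sum
  by (intro sum.cong refl hermitian_function.qcnj_mdet hermitian_function_ent) (auto dest: seqs_finite)

lemma cstar_adjm:
  assumes "H \<in> carrier_mat n n" "hermitian H"
  shows "cstar (adjm s H) = adjm s H"
proof (rule eq_matI)
  fix k i assume "k < dim_row (adjm s H)" "i < dim_col (adjm s H)"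
  then have ki: "k < n" "i < n" using assms by (auto simp: adjm_def)
  have "cstar (adjm s H) $$ (k, i) = qcnj (adjm s H $$ (i, k))"
    using ki assms by (subst cstar_entry) (auto simp: adjm_def)
  also have "\<dots> = (\<Sum>\<beta> | \<beta> \<in> seqs s n \<and> i \<in> \<beta> \<and> k \<in> \<beta>. adjf (ent H) \<beta> k i)"
    unfolding adjm_entry[OF assms(1) ki(2,1)] qcnj_sum
    by (intro sum.cong refl hermitian_function.qcnj_adjf[OF hermitian_function_ent[OF assms(2)]]) (auto dest: seqs_finite)
  finally show "cstar (adjm s H) $$ (k, i) = adjm s H $$ (k, i)"
    unfolding adjm_entry[OF assms(1) ki] by (simp add: conj_commute)
qed (use assms in \<open>auto simp: adjm_def\<close>)

lemma sum_seqs_insert: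
  assumes "j < n"
  shows "(\<Sum>\<beta> | \<beta> \<in> seqs (Suc s) n \<and> j \<in> \<beta>. f \<beta>) = (\<Sum>\<beta> | \<beta> \<in> seqs s n \<and> j \<notin> \<beta>. f (insert j \<beta>))"
  by (rule sum.reindex_bij_witness[of _ "insert j" "\<lambda>\<beta>. \<beta> - {j}"])
    (use assms in \<open>auto simp: seqs_def insert_absorb dest: finite_subset\<close>)

text \<open>These are the coefficients of \<open>t\<close> in \<open>(H + tI) adj(H + tI) = det(H + tI) I\<close>.\<close>

lemma adjm_rec:
  assumes "H \<in> carrier_mat n n" "hermitian H"
  shows "H * adjm s H + adjm (Suc s) H = msum s H \<cdot>\<^sub>m 1\<^sub>m n"
proof (rule eq_matI)
  interpret hermitian_function "ent H" by (rule hermitian_function_ent[OF assms(2)])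
  let ?h = "ent H"
  fix j i assume "j < dim_row (msum s H \<cdot>\<^sub>m 1\<^sub>m n)" "i < dim_col (msum s H \<cdot>\<^sub>m 1\<^sub>m n)"
  then have ji: "j < n" "i < n" by auto
  let ?S = "{\<beta>. \<beta> \<in> seqs s n \<and> i \<in> \<beta>}"
  have fin: "finite ?S" by (rule finite_subset[OF _ finite_seqs]) auto
  have "(H * adjm s H) $$ (j, i) = (\<Sum>k\<in>{0..<n}. ?h j k * (\<Sum>\<beta>\<in>?S. if k \<in> \<beta> then adjf ?h \<beta> k i else 0))"
  proof (subst mult_entry[OF assms(1) adjm_carrier[OF assms(1)] ji], intro sum.cong refl)
    fix k assume k: "k \<in> {0..<n}"
    have "{\<beta>. \<beta> \<in> seqs s n \<and> k \<in> \<beta> \<and> i \<in> \<beta>} = {\<beta>\<in>?S. k \<in> \<beta>}" by auto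
    then have "adjm s H $$ (k, i) = (\<Sum>\<beta>\<in>?S. if k \<in> \<beta> then adjf ?h \<beta> k i else 0)"
      using k ji assms(1) sum.inter_filter[OF fin, of "\<lambda>\<beta>. adjf ?h \<beta> k i"] by (simp add: adjm_entry)
    then show "H $$ (j, k) * adjm s H $$ (k, i) = ?h j k * (\<Sum>\<beta>\<in>?S. if k \<in> \<beta> then adjf ?h \<beta> k i else 0)"
      using k ji assms(1) by (simp add: ent_carrier)
  qed
  also have "\<dots> = (\<Sum>\<beta>\<in>?S. \<Sum>k\<in>{0..<n}. if k \<in> \<beta> then ?h j k * adjf ?h \<beta> k i else 0)"
    unfolding sum_distrib_left by (subst sum.swap) (simp add: if_distrib cong: if_cong)
  also have "\<dots> = (\<Sum>\<beta>\<in>?S. if j = i then mdet ?h \<beta> else if j \<in> \<beta> then 0 else - adjf ?h (insert j \<beta>) j i)"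
  proof (intro sum.cong refl)
    fix \<beta> assume b: "\<beta> \<in> ?S"
    then have "finite \<beta>" "{0..<n} \<inter> \<beta> = \<beta>" by (auto simp: seqs_def dest: finite_subset)
    then have "(\<Sum>k\<in>{0..<n}. if k \<in> \<beta> then ?h j k * adjf ?h \<beta> k i else 0) = (\<Sum>k\<in>\<beta>. ?h j k * adjf ?h \<beta> k i)"
      by (simp add: sum.inter_restrict[symmetric])
    then show "(\<Sum>k\<in>{0..<n}. if k \<in> \<beta> then ?h j k * adjf ?h \<beta> k i else 0)
      = (if j = i then mdet ?h \<beta> else if j \<in> \<beta> then 0 else - adjf ?h (insert j \<beta>) j i)"
      using b \<open>finite \<beta>\<close> by (simp add: sum_row_adjf_cases)
  qed
  finally have 1: "(H * adjm s H) $$ (j, i) = \<dots>" .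
  \<comment> \<open>Sets of order \<open>Suc s\<close> containing \<open>j\<close> are written as
    \<open>insert j \<beta>\<close>, to be matched with the terms of the matrix product in which
    \<open>j\<close> lies outside \<open>\<beta>\<close>.\<close>
  have 2: "adjm (Suc s) H $$ (j, i) = (\<Sum>\<beta> | \<beta> \<in> seqs s n \<and> j \<notin> \<beta>. if i \<in> insert j \<beta> then adjf ?h (insert j \<beta>) j i else 0)"
  proof -
    have fin': "finite {\<beta>. \<beta> \<in> seqs (Suc s) n \<and> j \<in> \<beta>}" by (rule finite_subset[OF _ finite_seqs]) auto
    have "{\<beta>. \<beta> \<in> seqs (Suc s) n \<and> j \<in> \<beta> \<and> i \<in> \<beta>} = {\<beta>\<in>{\<beta>. \<beta> \<in> seqs (Suc s) n \<and> j \<in> \<beta>}. i \<in> \<beta>}" by auto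
    then show ?thesis
      using sum.inter_filter[OF fin', of "\<lambda>\<beta>. adjf ?h \<beta> j i" "\<lambda>\<beta>. i \<in> \<beta>"]
        sum_seqs_insert[OF ji(1), of "\<lambda>\<beta>. if i \<in> \<beta> then adjf ?h \<beta> j i else 0" s] ji assms(1)
      by (simp add: adjm_entry)
  qed
  have "(H * adjm s H) $$ (j, i) + adjm (Suc s) H $$ (j, i) = (if j = i then msum s H else 0)"
  proof (cases "j = i")
    case True
    have "(H * adjm s H) $$ (j, i) = (\<Sum>\<beta>\<in>?S. mdet ?h \<beta>)"
      using 1 True by simp
    moreover have "adjm (Suc s) H $$ (j, i) = (\<Sum>\<beta> | \<beta> \<in> seqs s n \<and> i \<notin> \<beta>. mdet ?h \<beta>)"
      unfolding 2 using True by (intro sum.cong) (auto simp: adjf_def)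
    moreover have "msum s H = (\<Sum>\<beta>\<in>?S. mdet ?h \<beta>) + (\<Sum>\<beta> | \<beta> \<in> seqs s n \<and> i \<notin> \<beta>. mdet ?h \<beta>)"
    proof -
      have "seqs s n = ?S \<union> {\<beta>. \<beta> \<in> seqs s n \<and> i \<notin> \<beta>}" by auto
      then have "msum s H = sum (mdet ?h) (?S \<union> {\<beta>. \<beta> \<in> seqs s n \<and> i \<notin> \<beta>})"
        using assms(1) by (simp add: msum_def)
      also have "\<dots> = (\<Sum>\<beta>\<in>?S. mdet ?h \<beta>) + (\<Sum>\<beta> | \<beta> \<in> seqs s n \<and> i \<notin> \<beta>. mdet ?h \<beta>)"
        by (rule sum.union_disjoint) (auto intro: finite_subset[OF _ finite_seqs])
      finally show ?thesis .
    qed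
    ultimately show ?thesis using True by simp
  next
    case False
    \<comment> \<open>Off the diagonal both sums run over the sets that contain \<open>i\<close> and
      avoid \<open>j\<close>, with opposite signs.\<close>
    let ?W = "{\<beta>. \<beta> \<in> seqs s n \<and> i \<in> \<beta> \<and> j \<notin> \<beta>}"
    have finW: "finite {\<beta>. \<beta> \<in> seqs s n \<and> j \<notin> \<beta>}" by (rule finite_subset[OF _ finite_seqs]) auto
    have "?W = {\<beta>\<in>?S. j \<notin> \<beta>}" by auto
    then have "(H * adjm s H) $$ (j, i) = (\<Sum>\<beta>\<in>?W. - adjf ?h (insert j \<beta>) j i)"
      unfolding 1 using False sum.inter_filter[OF fin, of "\<lambda>\<beta>. - adjf ?h (insert j \<beta>) j i" "\<lambda>\<beta>. j \<notin> \<beta>"]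
      by (simp add: if_not_P cong: if_cong) (intro sum.cong; simp)
    moreover have "?W = {\<beta>\<in>{\<beta>. \<beta> \<in> seqs s n \<and> j \<notin> \<beta>}. i \<in> \<beta>}" by auto
    then have "adjm (Suc s) H $$ (j, i) = (\<Sum>\<beta>\<in>?W. adjf ?h (insert j \<beta>) j i)"
      unfolding 2 using False sum.inter_filter[OF finW, of "\<lambda>\<beta>. adjf ?h (insert j \<beta>) j i" "\<lambda>\<beta>. i \<in> \<beta>"]
      by simp
    ultimately show ?thesis using False by (simp add: sum_negf)
  qed
  then show "(H * adjm s H + adjm (Suc s) H) $$ (j, i) = (msum s H \<cdot>\<^sub>m 1\<^sub>m n) $$ (j, i)"
    using ji carrier_matD[OF adjm_carrier[OF assms(1), of "Suc s"]]
    by (simp del: index_mult_mat(1))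
qed (use assms in \<open>auto simp: adjm_def\<close>)

text \<open>Taking adjoints in \<open>adjm_rec\<close> swaps the two factors and leaves everything
  else unchanged, since the right-hand side is a real multiple of the identity.\<close>

lemma adjm_commute:
  assumes "H \<in> carrier_mat n n" "hermitian H"
  shows "adjm s H * H = H * adjm s H"
proof -
  have c: "adjm s H \<in> carrier_mat n n" "adjm (Suc s) H \<in> carrier_mat n n" using assms by auto
  have "cstar (H * adjm s H + adjm (Suc s) H) = H * adjm s H + adjm (Suc s) H"
    using adjm_rec[OF assms] qcnj_msum[OF assms(2)] by (simp add: cstar_smult)
  then have "adjm s H * H + adjm (Suc s) H = H * adjm s H + adjm (Suc s) H"
    using c assms by (simp add: cstar_add[of _ n n] cstar_mult[of H n n] cstar_adjm hermitian_cstar)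
  then have "adjm s H * H + adjm (Suc s) H - adjm (Suc s) H = H * adjm s H + adjm (Suc s) H - adjm (Suc s) H" by simp
  moreover have "X + Y - Y = X" if "X \<in> carrier_mat n n" "Y \<in> carrier_mat n n" for X Y :: "quat mat"
    using that by (intro eq_matI) auto
  ultimately show ?thesis using c assms by simp
qed

lemma adjm_full:
  assumes "H \<in> carrier_mat n n" "hermitian H"
  shows "H * adjm n H = msum n H \<cdot>\<^sub>m 1\<^sub>m n" "adjm n H * H = msum n H \<cdot>\<^sub>m 1\<^sub>m n"
proof -
  show "H * adjm n H = msum n H \<cdot>\<^sub>m 1\<^sub>m n"
    using adjm_rec[OF assms, of n] adjm_large[OF assms(1), of "Suc n"] assms right_add_zero_mat[of "H * adjm n H" n n] by simp
  then show "adjm n H * H = msum n H \<cdot>\<^sub>m 1\<^sub>m n" using adjm_commute[OF assms] by simp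
qed

subsection \<open>Minors in terms of compound adjugates\<close>

text \<open>\<open>pick \<alpha>\<close> enumerates \<open>\<alpha>\<close> increasingly, so it
  carries positions in the submatrix to indices in \<open>\<alpha>\<close> and respects cycle
  minima. From here on minors are sums over subsets of the original indices.\<close>

lemma rdet_submatrix_pathsum:
  assumes C: "C \<in> carrier_mat n n" and a: "\<alpha> \<subseteq> {0..<n}" and l: "l \<in> \<alpha>"
  shows "rdet (pos_in \<alpha> l) (submatrix C \<alpha> \<alpha>) = pathsumg False (ent C) (\<alpha> - {l}) l l"
    and "cdet (pos_in \<alpha> l) (submatrix C \<alpha> \<alpha>) = pathsumg True (ent C) (\<alpha> - {l}) l l"
proof -
  let ?r = "card \<alpha>" and ?f = "pick \<alpha>" and ?p = "pos_in \<alpha> l" and ?S = "submatrix C \<alpha> \<alpha>"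
  let ?R = "{0..<?r}" and ?s = "\<lambda>i j. submatrix C \<alpha> \<alpha> $$ (i, j)"
  have fin: "finite \<alpha>" using a finite_subset by blast
  have sets: "{i. i < n \<and> i \<in> \<alpha>} = \<alpha>" using a by auto
  have dim: "dim_row ?S = ?r" using C by (simp add: dim_submatrix sets)
  have p: "?p < ?r" unfolding pos_in_def using l fin by (intro psubset_card_mono) auto
  have fp: "?f ?p = l" using l by (simp add: pos_in_def pick_card_in_set)
  have mono: "strict_mono_on ?R ?f" by (auto simp: strict_mono_on_def intro: pick_mono_le)
  then have inj: "inj_on ?f ?R" by (rule strict_mono_on_imp_inj_on)
  have img: "?f ` ?R = \<alpha>"
    by (rule card_subset_eq[OF fin]) (auto simp: pick_in_set_le card_image[OF inj])
  have e: "?s x y = ent C (?f x) (?f y)" if "x \<in> ?R" "y \<in> ?R" for x y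
  proof -
    have "?f x < n" "?f y < n" using that pick_in_set_le[of x \<alpha>] pick_in_set_le[of y \<alpha>] a by auto
    then show ?thesis using that C by (simp add: submatrix_index sets ent_carrier)
  qed
  have img': "?f ` (?R - {?p}) = \<alpha> - {l}"
    using inj_on_image_set_diff[OF inj, of ?R "{?p}"] p img fp by auto
  have "pathsumg r ?s (?R - {?p}) ?p ?p = pathsumg r (ent C) (?f ` (?R - {?p})) (?f ?p) (?f ?p)" for r
  proof (rule pathsumg_relabel)
    fix U assume U: "U \<subseteq> ?R - {?p}"
    show "mdetg r ?s U = mdetg r (ent C) (?f ` U)"
    proof (rule mdetg_relabel)
      show "?s x y = ent C (?f x) (?f y)" if "x \<in> U" "y \<in> U" for x y
        using that U by (intro e) auto
    qed (use U mono in \<open>auto simp: strict_mono_on_def intro: finite_subset\<close>)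
  qed (use inj e p in \<open>auto intro: inj_on_subset\<close>)
  then have *: "pathsumg r ?s (?R - {?p}) ?p ?p = pathsumg r (ent C) (\<alpha> - {l}) l l" for r
    by (simp only: img' fp)
  show "rdet ?p ?S = pathsumg False (ent C) (\<alpha> - {l}) l l" "cdet ?p ?S = pathsumg True (ent C) (\<alpha> - {l}) l l"
    using p dim * by (simp_all add: rdet_pathsumg cdet_pathsumg)
qed

lemma ent_repl_row: "C \<in> carrier_mat n n \<Longrightarrow> x < n \<Longrightarrow> y < n \<Longrightarrow> ent (repl_row C i b) x y = (if x = i then b $ y else ent C x y)"
  by (auto simp: ent_def repl_row_def)

lemma ent_repl_col: "C \<in> carrier_mat n n \<Longrightarrow> x < n \<Longrightarrow> y < n \<Longrightarrow> ent (repl_col C i b) x y = (if y = i then b $ x else ent C x y)"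
  by (auto simp: ent_def repl_col_def)

lemma repl_carrier [simp]:
  "C \<in> carrier_mat n n \<Longrightarrow> repl_row C i b \<in> carrier_mat n n" "C \<in> carrier_mat n n \<Longrightarrow> repl_col C i b \<in> carrier_mat n n"
  by (auto simp: repl_row_def repl_col_def)

lemma rdet_submatrix_repl_row:
  assumes H: "H \<in> carrier_mat n n" and a: "\<alpha> \<subseteq> {0..<n}" and l: "l \<in> \<alpha>"
  shows "rdet (pos_in \<alpha> l) (submatrix (repl_row H l b) \<alpha> \<alpha>) = (\<Sum>k\<in>\<alpha>. b $ k * adjf (ent H) \<alpha> k l)"
proof -
  have lt: "x < n" if "x \<in> \<alpha>" for x using a that by auto
  have "rdet (pos_in \<alpha> l) (submatrix (repl_row H l b) \<alpha> \<alpha>) = pathsum (ent (repl_row H l b)) (\<alpha> - {l}) l l"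
    using H a l by (intro rdet_submatrix_pathsum) auto
  also have "\<dots> = (\<Sum>k\<in>\<alpha>. b $ k * adjf (ent H) \<alpha> k l)"
    by (rule pathsum_replace_row) (use a l lt in \<open>auto simp: ent_repl_row[OF H] intro: finite_subset\<close>)
  finally show ?thesis .
qed

lemma cdet_submatrix_repl_col:
  assumes H: "H \<in> carrier_mat n n" "hermitian H" and a: "\<beta> \<subseteq> {0..<n}" and l: "l \<in> \<beta>"
  shows "cdet (pos_in \<beta> l) (submatrix (repl_col H l b) \<beta> \<beta>) = (\<Sum>k\<in>\<beta>. adjf (ent H) \<beta> l k * b $ k)"
proof -
  have lt: "x < n" if "x \<in> \<beta>" for x using a that by auto
  have "cdet (pos_in \<beta> l) (submatrix (repl_col H l b) \<beta> \<beta>) = pathsumg True (ent (repl_col H l b)) (\<beta> - {l}) l l"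
    using H a l by (intro rdet_submatrix_pathsum) auto
  also have "\<dots> = (\<Sum>k\<in>\<beta>. adjf (ent H) \<beta> l k * b $ k)"
    by (rule hermitian_function.pathsumg_replace_col[OF hermitian_function_ent[OF H(2)]])
      (use a l lt in \<open>auto simp: ent_repl_col[OF H(1)] intro: finite_subset\<close>)
  finally show ?thesis .
qed

lemma sum_seqs_with_swap:
  fixes F :: "nat set \<Rightarrow> nat \<Rightarrow> quat"
  shows "(\<Sum>\<beta>\<in>seqs_with r n l. \<Sum>k\<in>\<beta>. F \<beta> k) = (\<Sum>k\<in>{0..<n}. \<Sum>\<beta> | \<beta> \<in> seqs r n \<and> k \<in> \<beta> \<and> l \<in> \<beta>. F \<beta> k)"
proof -
  have fin: "finite (seqs_with r n l)" by (rule finite_subset[OF _ finite_seqs[of r n]]) (auto simp: seqs_with_def seqs_def)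
  have "(\<Sum>\<beta>\<in>seqs_with r n l. \<Sum>k\<in>\<beta>. F \<beta> k) = (\<Sum>\<beta>\<in>seqs_with r n l. \<Sum>k\<in>{0..<n}. if k \<in> \<beta> then F \<beta> k else 0)"
  proof (rule sum.cong[OF refl])
    fix \<beta> assume "\<beta> \<in> seqs_with r n l"
    then have "{0..<n} \<inter> \<beta> = \<beta>" by (auto simp: seqs_with_def)
    then show "sum (F \<beta>) \<beta> = (\<Sum>k\<in>{0..<n}. if k \<in> \<beta> then F \<beta> k else 0)"
      using sum.inter_restrict[of "{0..<n}" "F \<beta>" \<beta>] by simp
  qed
  also have "\<dots> = (\<Sum>k\<in>{0..<n}. \<Sum>\<beta>\<in>seqs_with r n l. if k \<in> \<beta> then F \<beta> k else 0)" by (rule sum.swap)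
  also have "\<dots> = (\<Sum>k\<in>{0..<n}. \<Sum>\<beta> | \<beta> \<in> seqs r n \<and> k \<in> \<beta> \<and> l \<in> \<beta>. F \<beta> k)"
  proof (rule sum.cong[OF refl])
    fix k
    have "{\<beta>. \<beta> \<in> seqs r n \<and> k \<in> \<beta> \<and> l \<in> \<beta>} = {\<beta>\<in>seqs_with r n l. k \<in> \<beta>}"
      by (auto simp: seqs_with_def seqs_def)
    then show "(\<Sum>\<beta>\<in>seqs_with r n l. if k \<in> \<beta> then F \<beta> k else 0) = (\<Sum>\<beta> | \<beta> \<in> seqs r n \<and> k \<in> \<beta> \<and> l \<in> \<beta>. F \<beta> k)"
      using sum.inter_filter[OF fin, of "\<lambda>\<beta>. F \<beta> k" "\<lambda>\<beta>. k \<in> \<beta>"] by simp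
  qed
  finally show ?thesis .
qed

text \<open>The sum of row minors is a row vector times a column of the compound adjugate; this
  turns the numerators of the theorem into matrix algebra.\<close>

lemma rdet_minor_sum_adjm:
  assumes H: "H \<in> carrier_mat n n" and l: "l < n"
  shows "rdet_minor_sum r H l b = (\<Sum>k\<in>{0..<n}. b $ k * adjm r H $$ (k, l))"
proof -
  have "rdet_minor_sum r H l b = (\<Sum>\<alpha>\<in>seqs_with r n l. \<Sum>k\<in>\<alpha>. b $ k * adjf (ent H) \<alpha> k l)"
    unfolding rdet_minor_sum_def using H
    by (intro sum.cong rdet_submatrix_repl_row[OF H]) (auto simp: seqs_with_def)
  also have "\<dots> = (\<Sum>k\<in>{0..<n}. b $ k * adjm r H $$ (k, l))"
    unfolding sum_seqs_with_swap using H l by (intro sum.cong) (simp_all add: adjm_entry sum_distrib_left)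
  finally show ?thesis .
qed

lemma cdet_minor_sum_adjm:
  assumes H: "H \<in> carrier_mat n n" "hermitian H" and l: "l < n"
  shows "cdet_minor_sum r H l b = (\<Sum>k\<in>{0..<n}. adjm r H $$ (l, k) * b $ k)"
proof -
  have "cdet_minor_sum r H l b = (\<Sum>\<alpha>\<in>seqs_with r n l. \<Sum>k\<in>\<alpha>. adjf (ent H) \<alpha> l k * b $ k)"
    unfolding cdet_minor_sum_def using H
    by (intro sum.cong cdet_submatrix_repl_col[OF H]) (auto simp: seqs_with_def)
  also have "\<dots> = (\<Sum>k\<in>{0..<n}. adjm r H $$ (l, k) * b $ k)"
    unfolding sum_seqs_with_swap using H l
    by (intro sum.cong) (simp_all add: adjm_entry sum_distrib_right conj_commute)
  finally show ?thesis .
qed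

lemma rdet_repl_row_adjm:
  assumes H: "H \<in> carrier_mat n n" and l: "l < n"
  shows "rdet l (repl_row H l b) = (\<Sum>k\<in>{0..<n}. b $ k * adjm n H $$ (k, l))"
proof -
  have d: "dim_row (repl_row H l b) = n" using H by (simp add: repl_row_def)
  have "rdet l (repl_row H l b) = pathsum (\<lambda>i j. repl_row H l b $$ (i, j)) ({0..<n} - {l}) l l"
    using l d by (simp add: rdet_pathsumg)
  also have "\<dots> = (\<Sum>k\<in>{0..<n}. b $ k * adjf (ent H) {0..<n} k l)"
    by (rule pathsum_replace_row) (use H l in \<open>auto simp: repl_row_def ent_carrier\<close>)
  finally show ?thesis using H l by (simp add: adjm_full_entry)
qed

lemma cdet_repl_col_adjm:
  assumes H: "H \<in> carrier_mat n n" "hermitian H" and l: "l < n"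
  shows "cdet l (repl_col H l b) = (\<Sum>k\<in>{0..<n}. adjm n H $$ (l, k) * b $ k)"
proof -
  have d: "dim_row (repl_col H l b) = n" using H by (simp add: repl_col_def)
  have "cdet l (repl_col H l b) = pathsumg True (\<lambda>i j. repl_col H l b $$ (i, j)) ({0..<n} - {l}) l l"
    using l d by (simp add: cdet_pathsumg)
  also have "\<dots> = (\<Sum>k\<in>{0..<n}. adjf (ent H) {0..<n} l k * b $ k)"
    by (rule hermitian_function.pathsumg_replace_col[OF hermitian_function_ent[OF H(2)]])
      (use H l in \<open>auto simp: repl_col_def ent_carrier\<close>)
  finally show ?thesis using H l by (simp add: adjm_full_entry)
qed

text \<open>\<open>hdet\<close> expands at position \<open>0\<close>, which is the position of
  \<open>Min \<beta>\<close>, and that is where \<open>mdet\<close> expands.\<close>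

lemma hdet_submatrix:
  assumes H: "H \<in> carrier_mat n n" and b: "\<beta> \<subseteq> {0..<n}" "\<beta> \<noteq> {}"
  shows "hdet (submatrix H \<beta> \<beta>) = mdet (ent H) \<beta>"
proof -
  have fin: "finite \<beta>" using b finite_subset by blast
  then have "{x\<in>\<beta>. x < Min \<beta>} = {}" by (auto simp: leD[OF Min_le])
  then have "pos_in \<beta> (Min \<beta>) = 0" by (simp add: pos_in_def)
  then show ?thesis
    using rdet_submatrix_pathsum(1)[OF H b(1), of "Min \<beta>"] fin b(2) by (simp add: hdet_def mdetg_Min)
qed

text \<open>Positive order excludes the empty minor, for which \<open>rdet 0\<close> would read an
  entry outside the matrix.\<close>

lemma principal_minor_sum_msum:
  assumes "H \<in> carrier_mat n n" "r \<ge> 1"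
  shows "principal_minor_sum r H = msum r H"
  unfolding principal_minor_sum_def msum_def using assms
  by (intro sum.cong hdet_submatrix) (auto simp: seqs_def)

lemma hdet_msum:
  assumes "H \<in> carrier_mat n n" "n \<ge> 1"
  shows "hdet H = msum n H"
proof -
  have "hdet H = mdet (\<lambda>i j. H $$ (i, j)) {0..<n}"
  proof -
    have "Min {0..<n} = 0" using assms(2) by (intro Min_eqI) auto
    then show ?thesis
      using assms mdetg_Min[of "{0..<n}" False "\<lambda>i j. H $$ (i, j)"] by (simp add: hdet_def rdet_pathsumg)
  qed
  also have "\<dots> = mdet (ent H) {0..<n}"
    by (rule mdetg_cong) (use assms in \<open>auto simp: ent_carrier\<close>)
  finally show ?thesis using assms by (simp add: msum_def seqs_full)
qed

text \<open>Side conditions on dimensions instead of carrier sets let the simplifier reassociate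
  long products once the dimensions are known.\<close>

lemma mat_assoc: "dim_col A = dim_row B \<Longrightarrow> dim_col B = dim_row C \<Longrightarrow> A * B * C = A * (B * C :: quat mat)"
  by (rule assoc_mult_mat[of A "dim_row A" "dim_row B" B "dim_row C" C "dim_col C"]) auto

lemma cstar_mult': "dim_col A = dim_row B \<Longrightarrow> cstar (A * B) = cstar B * cstar A"
  by (rule cstar_mult[of A "dim_row A" "dim_row B" B "dim_col B"]) auto

lemma smult_left: "dim_col A = dim_row B \<Longrightarrow> (d \<cdot>\<^sub>m A) * B = d \<cdot>\<^sub>m (A * B :: quat mat)"
  by (rule smult_mult_left[of A "dim_row A" "dim_row B" B "dim_col B"]) auto

lemma smult_right: "qcnj d = d \<Longrightarrow> dim_col A = dim_row B \<Longrightarrow> A * (d \<cdot>\<^sub>m B) = d \<cdot>\<^sub>m (A * B :: quat mat)"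
  by (rule smult_mult_right[of d A "dim_row A" "dim_row B" B "dim_col B"]) auto

lemma mat_distrib:
  fixes A B C :: "quat mat"
  shows "dim_col A = dim_row B \<Longrightarrow> dim_row B = dim_row C \<Longrightarrow> dim_col B = dim_col C \<Longrightarrow> A * (B + C) = A * B + A * C"
    and "dim_row A = dim_row B \<Longrightarrow> dim_col A = dim_col B \<Longrightarrow> dim_col B = dim_row C \<Longrightarrow> (A + B) * C = A * C + B * C"
    and "dim_col A = dim_row B \<Longrightarrow> dim_row B = dim_row C \<Longrightarrow> dim_col B = dim_col C \<Longrightarrow> A * (B - C) = A * B - A * C"
    and "dim_row A = dim_row B \<Longrightarrow> dim_col A = dim_col B \<Longrightarrow> dim_col B = dim_row C \<Longrightarrow> (A - B) * C = A * C - B * C"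
proof -
  show "dim_col A = dim_row B \<Longrightarrow> dim_row B = dim_row C \<Longrightarrow> dim_col B = dim_col C \<Longrightarrow> A * (B + C) = A * B + A * C"
    by (rule mult_add_distrib_mat[of A "dim_row A" "dim_col A" B "dim_col C" C]) (rule carrier_matI; metis)+
  show "dim_row A = dim_row B \<Longrightarrow> dim_col A = dim_col B \<Longrightarrow> dim_col B = dim_row C \<Longrightarrow> (A + B) * C = A * C + B * C"
    by (rule add_mult_distrib_mat[of A "dim_row A" "dim_col A" B C "dim_col C"]) (rule carrier_matI; metis)+
  show "dim_col A = dim_row B \<Longrightarrow> dim_row B = dim_row C \<Longrightarrow> dim_col B = dim_col C \<Longrightarrow> A * (B - C) = A * B - A * C"
    by (rule mult_minus_distrib_mat[of A "dim_row A" "dim_col A" B "dim_col C" C]) (rule carrier_matI; metis)+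
  show "dim_row A = dim_row B \<Longrightarrow> dim_col A = dim_col B \<Longrightarrow> dim_col B = dim_row C \<Longrightarrow> (A - B) * C = A * C - B * C"
    by (rule minus_mult_distrib_mat[of A "dim_row A" "dim_col A" B C "dim_col C"]) (rule carrier_matI; metis)+
qed

lemma adjm_dims [simp]: "dim_row (adjm s H) = dim_row H" "dim_col (adjm s H) = dim_row H"
  by (simp_all add: adjm_def)

lemma column_nonzero:
  assumes "X \<in> carrier_mat n 1" "X \<noteq> 0\<^sub>m n 1"
  obtains k where "k < n" "X $$ (k, 0) \<noteq> 0"
  using assms by (metis One_nat_def carrier_matD eq_matI index_zero_mat less_Suc0)

subsection \<open>Positivity\<close>

lemma quat_component_sums:
  "Re (sum f A) = (\<Sum>x\<in>A. Re (f x))" "Im1 (sum f A) = (\<Sum>x\<in>A. Im1 (f x))"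
  "Im2 (sum f A) = (\<Sum>x\<in>A. Im2 (f x))" "Im3 (sum f A) = (\<Sum>x\<in>A. Im3 (f x))"
  by (induction A rule: infinite_finite_induct) simp_all

lemma qcnj_mult_self:
  "Re (qcnj z * z) = (Re z)\<^sup>2 + (Im1 z)\<^sup>2 + (Im2 z)\<^sup>2 + (Im3 z)\<^sup>2"
  "Im1 (qcnj z * z) = 0" "Im2 (qcnj z * z) = 0" "Im3 (qcnj z * z) = 0"
  by (simp_all add: power2_eq_square)

lemma is_pos_real_norm_sum:
  assumes "finite I" "k \<in> I" "z k \<noteq> 0"
  shows "is_pos_real (\<Sum>i\<in>I. qcnj (z i) * z i)"
proof -
  have "0 < (\<Sum>i\<in>I. Re (qcnj (z i) * z i))"
    using assms quat_norm_pos[OF assms(3)] by (intro sum_pos2[of I k]) (auto simp: qcnj_mult_self simp del: times_quat.simps)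
  then show ?thesis
    unfolding is_pos_real_def quat_component_sums qcnj_mult_self by simp
qed

lemma is_pos_real_mult_cancel: "is_pos_real a \<Longrightarrow> qcnj b = b \<Longrightarrow> is_pos_real (a * b) \<Longrightarrow> is_pos_real b"
  by (auto simp: is_pos_real_def qcnj_fixed_iff zero_less_mult_iff)

lemma is_pos_realD: "is_pos_real a \<Longrightarrow> qcnj a = a" "is_pos_real a \<Longrightarrow> a \<noteq> 0"
  by (auto simp: is_pos_real_def qcnj_fixed_iff)

lemma is_pos_real_add: "is_pos_real a \<Longrightarrow> is_pos_real b \<Longrightarrow> is_pos_real (a + b)"
  by (auto simp: is_pos_real_def)

lemma is_pos_real_inverse: "is_pos_real d \<Longrightarrow> qcnj (inverse d) = inverse d"
  by (simp add: qcnj_inverse is_pos_realD)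

text \<open>Each diagonal entry of the product is the sum of the squared moduli in one column of
  \<open>Z\<close>.\<close>

lemma cstar_self_zero:
  assumes "cstar Z * Z = 0\<^sub>m (dim_col Z) (dim_col Z)"
  shows "Z = 0\<^sub>m (dim_row Z) (dim_col Z)"
proof (rule eq_matI)
  fix i j assume "i < dim_row (0\<^sub>m (dim_row Z) (dim_col Z) :: quat mat)" "j < dim_col (0\<^sub>m (dim_row Z) (dim_col Z) :: quat mat)"
  then have ij: "i < dim_row Z" "j < dim_col Z" by auto
  have "(\<Sum>t\<in>{0..<dim_row Z}. qcnj (Z $$ (t, j)) * Z $$ (t, j)) = (cstar Z * Z) $$ (j, j)"
    using ij by (subst mult_entry[of _ "dim_col Z" "dim_row Z" _ "dim_col Z"]) (auto simp: cstar_entry)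
  also have "\<dots> = 0" using assms ij by simp
  finally show "Z $$ (i, j) = 0\<^sub>m (dim_row Z) (dim_col Z) $$ (i, j)"
    using is_pos_real_norm_sum[of "{0..<dim_row Z}" i "\<lambda>t. Z $$ (t, j)"] ij is_pos_realD(2) by force
qed auto

lemma quadratic_form_entry:
  assumes "H \<in> carrier_mat n n" "X \<in> carrier_mat n 1"
  shows "(cstar X * H * X) $$ (0, 0) = (\<Sum>i<n. \<Sum>j<n. qcnj (X $$ (i, 0)) * H $$ (i, j) * X $$ (j, 0))"
proof -
  have "(cstar X * H * X) $$ (0, 0) = (\<Sum>j\<in>{0..<n}. (cstar X * H) $$ (0, j) * X $$ (j, 0))"
    using assms by (intro mult_entry[of _ 1 n _ 1]) auto
  also have "\<dots> = (\<Sum>j\<in>{0..<n}. \<Sum>i\<in>{0..<n}. qcnj (X $$ (i, 0)) * H $$ (i, j) * X $$ (j, 0))"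
    using assms by (intro sum.cong refl, subst mult_entry[of _ 1 n _ n]) (auto simp: cstar_entry sum_distrib_right)
  finally show ?thesis by (subst (asm) sum.swap) (simp add: lessThan_atLeast0)
qed

text \<open>Treating vectors as one-column matrices turns the quadratic form into a matrix product,
  to which \<open>cstar\<close> and associativity apply.\<close>

lemma hpd_iff:
  assumes H: "H \<in> carrier_mat n n"
  shows "hpd H \<longleftrightarrow> cstar H = H \<and> (\<forall>X\<in>carrier_mat n 1. X \<noteq> 0\<^sub>m n 1 \<longrightarrow> is_pos_real ((cstar X * H * X) $$ (0, 0)))"
proof -
  let ?q = "\<lambda>x. \<Sum>i<n. \<Sum>j<n. qcnj (x i) * H $$ (i, j) * x j"
  have "(\<forall>x\<in>carrier_vec n. x \<noteq> 0\<^sub>v n \<longrightarrow> is_pos_real (?q (\<lambda>i. x $ i)))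
    \<longleftrightarrow> (\<forall>X\<in>carrier_mat n 1. X \<noteq> 0\<^sub>m n 1 \<longrightarrow> is_pos_real (?q (\<lambda>i. X $$ (i, 0))))"
  proof safe
    fix X :: "quat mat" assume *: "\<forall>x\<in>carrier_vec n. x \<noteq> 0\<^sub>v n \<longrightarrow> is_pos_real (?q (\<lambda>i. x $ i))"
      and X: "X \<in> carrier_mat n 1" "X \<noteq> 0\<^sub>m n 1"
    then have "\<exists>i<n. X $$ (i, 0) \<noteq> 0" by (metis One_nat_def carrier_matD eq_matI index_zero_mat less_Suc0)
    then have "vec n (\<lambda>i. X $$ (i, 0)) \<noteq> 0\<^sub>v n" by (metis index_vec index_zero_vec(1))
    then show "is_pos_real (?q (\<lambda>i. X $$ (i, 0)))" using *[rule_format, of "vec n (\<lambda>i. X $$ (i, 0))"] by simp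
  next
    fix x :: "quat vec" assume *: "\<forall>X\<in>carrier_mat n 1. X \<noteq> 0\<^sub>m n 1 \<longrightarrow> is_pos_real (?q (\<lambda>i. X $$ (i, 0)))"
      and x: "x \<in> carrier_vec n" "x \<noteq> 0\<^sub>v n"
    then have "\<exists>i<n. x $ i \<noteq> 0" by (metis carrier_vecD eq_vecI index_zero_vec)
    then obtain i where i: "i < n" "x $ i \<noteq> 0" by blast
    have "mat n 1 (\<lambda>(i, j). x $ i) $$ (i, 0) \<noteq> 0\<^sub>m n 1 $$ (i, 0)" using i by simp
    then have "mat n 1 (\<lambda>(i, j). x $ i) \<noteq> 0\<^sub>m n 1" by metis
    then show "is_pos_real (?q (\<lambda>i. x $ i))" using *[rule_format, of "mat n 1 (\<lambda>(i, j). x $ i)"] by simp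
  qed
  also have "\<dots> \<longleftrightarrow> (\<forall>X\<in>carrier_mat n 1. X \<noteq> 0\<^sub>m n 1 \<longrightarrow> is_pos_real ((cstar X * H * X) $$ (0, 0)))"
    by (intro ball_cong refl imp_cong) (simp only: quadratic_form_entry[OF H])
  finally show ?thesis
    using H by (simp only: hpd_def hermitian_def square_mat.simps carrier_matD simp_thms)
qed

lemma hpdD:
  "H \<in> carrier_mat n n \<Longrightarrow> hpd H \<Longrightarrow> X \<in> carrier_mat n 1 \<Longrightarrow> X \<noteq> 0\<^sub>m n 1 \<Longrightarrow> is_pos_real ((cstar X * H * X) $$ (0, 0))"
  using hpd_iff by blast

lemma hpdI:
  assumes "H \<in> carrier_mat n n" "cstar H = H"
    and "\<And>X. X \<in> carrier_mat n 1 \<Longrightarrow> X \<noteq> 0\<^sub>m n 1 \<Longrightarrow> is_pos_real ((cstar X * H * X) $$ (0, 0))"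
  shows "hpd H"
  using assms hpd_iff by blast

lemma hpd_hermitian: "hpd H \<Longrightarrow> hermitian H"
  by (simp add: hpd_def)

lemma hpd_cstar: "hpd H \<Longrightarrow> cstar H = H"
  by (simp add: hpd_def hermitian_def)

lemma hpd_congruence:
  assumes M: "M \<in> carrier_mat m m" "hpd M" and C: "C \<in> carrier_mat m n"
    and inj: "\<And>X. X \<in> carrier_mat n 1 \<Longrightarrow> C * X = 0\<^sub>m m 1 \<Longrightarrow> X = 0\<^sub>m n 1"
  shows "hpd (cstar C * M * C)"
proof -
  have c: "cstar C * M * C \<in> carrier_mat n n" using M C by auto
  note d = carrier_matD[OF M(1)] carrier_matD[OF C]
  have "cstar (cstar C * M * C) = cstar C * M * C"
    using hpd_cstar[OF M(2)] by (simp add: cstar_mult' mat_assoc d)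
  moreover have "is_pos_real ((cstar X * (cstar C * M * C) * X) $$ (0, 0))"
    if X: "X \<in> carrier_mat n 1" "X \<noteq> 0\<^sub>m n 1" for X
  proof -
    have "cstar X * (cstar C * M * C) * X = cstar (C * X) * M * (C * X)"
      using carrier_matD[OF X(1)] by (simp add: cstar_mult' mat_assoc d)
    moreover have "C * X \<noteq> 0\<^sub>m m 1" "C * X \<in> carrier_mat m 1" using inj X C by auto
    ultimately show ?thesis using hpdD[OF M, of "C * X"] by simp
  qed
  ultimately show ?thesis by (intro hpdI[OF c])
qed

lemma hpd_one: "hpd (1\<^sub>m n)"
proof -
  have "is_pos_real ((cstar X * 1\<^sub>m n * X) $$ (0, 0))" if X: "X \<in> carrier_mat n 1" "X \<noteq> 0\<^sub>m n 1" for X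
  proof -
    obtain k where k: "k < n" "X $$ (k, 0) \<noteq> 0" using column_nonzero[OF X] .
    have "(cstar X * 1\<^sub>m n * X) $$ (0, 0) = (cstar X * X) $$ (0, 0)" using X by simp
    also have "\<dots> = (\<Sum>t\<in>{0..<n}. qcnj (X $$ (t, 0)) * X $$ (t, 0))"
      using X by (subst mult_entry[of _ 1 n _ 1]) (auto simp: cstar_entry)
    finally show ?thesis using is_pos_real_norm_sum[of "{0..<n}" k "\<lambda>t. X $$ (t, 0)"] k by simp
  qed
  then show ?thesis by (intro hpdI[of _ n]) simp_all
qed

lemma hpd_gram:
  assumes C: "C \<in> carrier_mat m n"
    and inj: "\<And>X. X \<in> carrier_mat n 1 \<Longrightarrow> C * X = 0\<^sub>m m 1 \<Longrightarrow> X = 0\<^sub>m n 1"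
  shows "hpd (cstar C * C)"
  using hpd_congruence[OF one_carrier_mat hpd_one C inj] C by simp

lemma hpd_add:
  assumes "H \<in> carrier_mat n n" "hpd H" "K \<in> carrier_mat n n" "hpd K"
  shows "hpd (H + K)"
proof -
  have "is_pos_real ((cstar X * (H + K) * X) $$ (0, 0))" if X: "X \<in> carrier_mat n 1" "X \<noteq> 0\<^sub>m n 1" for X
  proof -
    have "cstar X * (H + K) * X = cstar X * H * X + cstar X * K * X"
      using carrier_matD[OF assms(1)] carrier_matD[OF assms(3)] carrier_matD[OF X(1)] by (simp add: mat_distrib)
    then have "(cstar X * (H + K) * X) $$ (0, 0) = (cstar X * H * X) $$ (0, 0) + (cstar X * K * X) $$ (0, 0)"
      using X by (simp del: index_mult_mat(1))
    then show ?thesis using hpdD[OF assms(1,2) X] hpdD[OF assms(3,4) X] by (simp only: is_pos_real_add)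
  qed
  then show ?thesis
    using assms by (intro hpdI[of _ n]) (auto simp: cstar_add[of _ n n] hpd_cstar)
qed

lemma hpd_inj:
  assumes "H \<in> carrier_mat n n" "hpd H" "X \<in> carrier_mat n 1" "H * X = 0\<^sub>m n 1"
  shows "X = 0\<^sub>m n 1"
proof (rule ccontr)
  assume "X \<noteq> 0\<^sub>m n 1"
  then have "is_pos_real ((cstar X * H * X) $$ (0, 0))" using assms by (intro hpdD)
  moreover have "cstar X * H * X = 0\<^sub>m 1 1"
    using assms by (simp add: assoc_mult_mat[of _ 1 n _ n _ 1])
  ultimately show False by (simp add: is_pos_real_def)
qed

section \<open>Determinants of definite and of degenerate forms\<close>

definition posdef_on :: "(nat \<Rightarrow> nat \<Rightarrow> quat) \<Rightarrow> nat set \<Rightarrow> bool" where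
  "posdef_on h S \<longleftrightarrow> (\<forall>c. (\<exists>k\<in>S. c k \<noteq> 0) \<longrightarrow> is_pos_real (\<Sum>i\<in>S. qcnj (c i) * (\<Sum>j\<in>S. h i j * c j)))"

text \<open>The form is evaluated at column \<open>i\<close> of the adjugate of
  \<open>insert i S\<close>. Applying \<open>h\<close> to this column leaves only the determinant in
  place \<open>i\<close>, so the value is the product of the determinants of \<open>S\<close> and of
  \<open>insert i S\<close>; positivity passes from the first to the second.\<close>

lemma (in hermitian_function) mdet_pos:
  "finite S \<Longrightarrow> posdef_on h S \<Longrightarrow> is_pos_real (mdet h S)"
proof (induction S rule: finite_induct)
  case empty
  show ?case by (simp add: is_pos_real_def)
next
  case (insert i S)
  let ?T = "insert i S" and ?c = "\<lambda>k. adjf h (insert i S) k i"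
  have "posdef_on h S"
    unfolding posdef_on_def
  proof (intro allI impI)
    fix c :: "nat \<Rightarrow> quat" assume c: "\<exists>k\<in>S. c k \<noteq> 0"
    let ?d = "\<lambda>k. if k \<in> S then c k else 0"
    have "is_pos_real (\<Sum>a\<in>?T. qcnj (?d a) * (\<Sum>b\<in>?T. h a b * ?d b))"
      using insert.prems[unfolded posdef_on_def, rule_format, of ?d] c by auto
    also have "(\<Sum>a\<in>?T. qcnj (?d a) * (\<Sum>b\<in>?T. h a b * ?d b)) = (\<Sum>a\<in>S. qcnj (c a) * (\<Sum>b\<in>S. h a b * c b))"
      using insert.hyps by simp
    finally show "is_pos_real (\<Sum>a\<in>S. qcnj (c a) * (\<Sum>b\<in>S. h a b * c b))" .
  qed
  then have pos: "is_pos_real (mdet h S)" by (rule insert.IH)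
  have ci: "?c i = mdet h S" using insert.hyps by (simp add: adjf_def)
  then have "is_pos_real (\<Sum>a\<in>?T. qcnj (?c a) * (\<Sum>b\<in>?T. h a b * ?c b))"
    using insert.prems[unfolded posdef_on_def, rule_format, of ?c] is_pos_realD(2)[OF pos] by (metis insertI1)
  also have "(\<Sum>a\<in>?T. qcnj (?c a) * (\<Sum>b\<in>?T. h a b * ?c b)) = (\<Sum>a\<in>?T. if a = i then qcnj (?c i) * mdet h ?T else 0)"
    using insert.hyps by (intro sum.cong refl) (simp only: sum_row_adjf_cases finite_insert insertI1, simp)
  also have "\<dots> = mdet h S * mdet h ?T"
    using insert.hyps ci by (simp add: qcnj_mdet)
  finally show ?case
    using is_pos_real_mult_cancel[OF pos] insert.hyps by (simp add: qcnj_mdet)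
qed

lemma (in hermitian_function) sum_adjf_col:
  assumes "finite S" "k \<in> S" "b \<in> S"
  shows "(\<Sum>a\<in>S. adjf h S k a * h a b) = (if k = b then mdet h S else 0)"
proof -
  have "qcnj (\<Sum>a\<in>S. h b a * adjf h S a k) = (\<Sum>a\<in>S. adjf h S k a * h a b)"
    using assms by (simp add: qcnj_sum qcnj_adjf herm)
  then show ?thesis using assms sum_row_adjf_cases[of S k b] by (simp add: qcnj_mdet split: if_splits)
qed

text \<open>Row \<open>k\<close> of the adjugate, applied to the kernel relation, leaves the
  determinant times \<open>c k\<close>.\<close>

lemma (in hermitian_function) mdet_zero:
  assumes S: "finite S" and c: "k \<in> S" "c k \<noteq> 0" and z: "\<And>a. a \<in> S \<Longrightarrow> (\<Sum>b\<in>S. h a b * c b) = 0"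
  shows "mdet h S = 0"
proof -
  have "0 = (\<Sum>a\<in>S. adjf h S k a * (\<Sum>b\<in>S. h a b * c b))" using z by simp
  also have "\<dots> = (\<Sum>b\<in>S. (\<Sum>a\<in>S. adjf h S k a * h a b) * c b)"
    unfolding sum_distrib_left sum_distrib_right by (subst sum.swap) (simp add: mult.assoc)
  also have "\<dots> = (\<Sum>b\<in>S. if k = b then mdet h S * c b else 0)"
    using S c(1) by (intro sum.cong refl) (simp add: sum_adjf_col)
  also have "\<dots> = mdet h S * c k" using S c(1) by simp
  finally show ?thesis using c(2) by simp
qed

lemma hpd_msum_pos:
  assumes H: "H \<in> carrier_mat n n" "hpd H"
  shows "is_pos_real (msum n H)"
proof -
  have "posdef_on (ent H) {0..<n}"
    unfolding posdef_on_def
  proof (intro allI impI)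
    fix c :: "nat \<Rightarrow> quat" assume "\<exists>k\<in>{0..<n}. c k \<noteq> 0"
    then obtain k where k: "k < n" "c k \<noteq> 0" by auto
    define X where "X = mat n 1 (\<lambda>(i, j::nat). c i)"
    have X: "X \<in> carrier_mat n 1" by (simp add: X_def)
    have "X $$ (k, 0) \<noteq> 0\<^sub>m n 1 $$ (k, 0)" using k by (simp add: X_def)
    then have "X \<noteq> 0\<^sub>m n 1" by auto
    then have "is_pos_real ((cstar X * H * X) $$ (0, 0))" using H X by (intro hpdD)
    also have "(cstar X * H * X) $$ (0, 0) = (\<Sum>i\<in>{0..<n}. qcnj (c i) * (\<Sum>j\<in>{0..<n}. ent H i j * c j))"
      unfolding quadratic_form_entry[OF H(1) X] lessThan_atLeast0 sum_distrib_left
      by (intro sum.cong refl) (simp add: X_def ent_carrier[OF H(1)] mult.assoc)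
    finally show "is_pos_real (\<Sum>i\<in>{0..<n}. qcnj (c i) * (\<Sum>j\<in>{0..<n}. ent H i j * c j))" .
  qed
  then show ?thesis
    using hermitian_function.mdet_pos[OF hermitian_function_ent[OF hpd_hermitian[OF H(2)]], of "{0..<n}"] H(1)
    by (simp add: msum_def seqs_full)
qed

subsection \<open>Inverses\<close>

lemma minv_eqI:
  assumes "H \<in> carrier_mat n n" "Y \<in> carrier_mat n n" "H * Y = 1\<^sub>m n" "Y * H = 1\<^sub>m n"
  shows "minv H = Y"
  unfolding minv_def
proof (rule the_equality)
  fix Z assume Z: "Z \<in> carrier_mat (dim_row H) (dim_row H) \<and> H * Z = 1\<^sub>m (dim_row H) \<and> Z * H = 1\<^sub>m (dim_row H)"
  have "Z * (H * Y) = (Z * H) * Y"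
    by (rule assoc_mult_mat[symmetric, of Z n n H n Y n]) (use assms Z in auto)
  moreover have "Z * 1\<^sub>m n = Z" using Z assms(1) by auto
  ultimately show "Z = Y" using assms Z by simp
qed (use assms in auto)

lemma hpd_inverse_eq:
  assumes H: "H \<in> carrier_mat n n" "hpd H"
  shows "minv H = inverse (msum n H) \<cdot>\<^sub>m adjm n H"
proof (rule minv_eqI[OF H(1)])
  note p = hpd_msum_pos[OF H]
  note a = adjm_full[OF H(1) hpd_hermitian[OF H(2)]]
  have c: "adjm n H \<in> carrier_mat n n" using H by simp
  show "inverse (msum n H) \<cdot>\<^sub>m adjm n H \<in> carrier_mat n n" using c by simp
  show "H * (inverse (msum n H) \<cdot>\<^sub>m adjm n H) = 1\<^sub>m n" "inverse (msum n H) \<cdot>\<^sub>m adjm n H * H = 1\<^sub>m n"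
    using H(1) c a is_pos_real_inverse[OF p] is_pos_realD(2)[OF p]
    by (simp_all add: smult_left smult_right smult_mat_smult)
qed

lemma hpd_minv:
  assumes H: "H \<in> carrier_mat n n" "hpd H"
  shows "minv H \<in> carrier_mat n n" "H * minv H = 1\<^sub>m n" "minv H * H = 1\<^sub>m n" "cstar (minv H) = minv H" "hpd (minv H)"
proof -
  note p = hpd_msum_pos[OF H]
  note a = adjm_full[OF H(1) hpd_hermitian[OF H(2)]]
  have c: "adjm n H \<in> carrier_mat n n" using H by simp
  show m: "minv H \<in> carrier_mat n n" using c by (simp add: hpd_inverse_eq[OF H])
  show 1: "H * minv H = 1\<^sub>m n" and 2: "minv H * H = 1\<^sub>m n" unfolding hpd_inverse_eq[OF H]
    using H(1) c a is_pos_real_inverse[OF p] is_pos_realD(2)[OF p]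
    by (simp_all add: smult_left smult_right smult_mat_smult)
  show 3: "cstar (minv H) = minv H"
    unfolding hpd_inverse_eq[OF H] using H
    by (simp add: cstar_smult is_pos_real_inverse[OF p] cstar_adjm[OF _ hpd_hermitian])
  \<comment> \<open>The inverse is congruent to \<open>H\<close> through itself and so inherits
    definiteness.\<close>
  have "hpd (cstar (minv H) * H * minv H)"
  proof (rule hpd_congruence[OF H m])
    fix X assume X: "X \<in> carrier_mat n 1" "minv H * X = 0\<^sub>m n 1"
    then have "H * (minv H * X) = 0\<^sub>m n 1" using H by simp
    moreover have "H * (minv H * X) = X" using assoc_mult_mat[OF H(1) m X(1)] 1 X by simp
    ultimately show "X = 0\<^sub>m n 1" by simp
  qed
  then show "hpd (minv H)" using 2 3 m by simp
qed

subsection \<open>Rank\<close>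

text \<open>Gaussian elimination over a skew field: one equation and one unknown are removed in each
  step, unless the equation is trivial.\<close>

lemma underdetermined_system:
  fixes a :: "nat \<Rightarrow> nat \<Rightarrow> quat"
  assumes "finite J" "r < card J"
  shows "\<exists>c. (\<exists>j\<in>J. c j \<noteq> 0) \<and> (\<forall>i<r. (\<Sum>j\<in>J. a i j * c j) = 0)"
  using assms
proof (induction r arbitrary: J a)
  case 0
  then obtain j where "j \<in> J" by fastforce
  then show ?case by (intro exI[of _ "\<lambda>_. 1"]) auto
next
  case (Suc r)
  show ?case
  proof (cases "\<forall>j\<in>J. a r j = 0")
    case True
    obtain c where "\<exists>j\<in>J. c j \<noteq> 0" "\<forall>i<r. (\<Sum>j\<in>J. a i j * c j) = 0"
      using Suc.IH[of J a] Suc.prems by auto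
    with True show ?thesis by (intro exI[of _ c]) (auto simp: less_Suc_eq)
  next
    case False
    then obtain k where k: "k \<in> J" "a r k \<noteq> 0" by auto
    let ?J = "J - {k}"
    \<comment> \<open>Unknown \<open>k\<close> is eliminated by solving equation \<open>r\<close>
      for it. Coefficients act from the left, so the inverse stands between \<open>a i k\<close> and
      \<open>a r j\<close>.\<close>
    let ?a = "\<lambda>i j. a i j - a i k * (inverse (a r k) * a r j)"
    have "r < card ?J" using Suc.prems k by simp
    then obtain c where c: "\<exists>j\<in>?J. c j \<noteq> 0" "\<forall>i<r. (\<Sum>j\<in>?J. ?a i j * c j) = 0"
      using Suc.IH[of ?J ?a] Suc.prems by auto
    define s where "s = (\<Sum>j\<in>?J. a r j * c j)"
    define d where "d = c(k := - (inverse (a r k) * s))"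
    have sum_d: "(\<Sum>j\<in>J. a i j * d j) = (\<Sum>j\<in>?J. a i j * c j) - a i k * (inverse (a r k) * s)" for i
      using Suc.prems k by (simp add: sum.remove[of J k] d_def)
    have "(\<Sum>j\<in>J. a i j * d j) = 0" if "i < Suc r" for i
    proof (cases "i = r")
      case True
      have "a r k * (inverse (a r k) * s) = s" using k(2) by (simp add: mult.assoc[symmetric])
      then show ?thesis unfolding sum_d using True by (simp add: s_def)
    next
      case False
      then have "0 = (\<Sum>j\<in>?J. ?a i j * c j)" using c that by simp
      also have "\<dots> = (\<Sum>j\<in>?J. a i j * c j) - a i k * (inverse (a r k) * s)"
        by (simp add: s_def left_diff_distrib sum_subtractf sum_distrib_left mult.assoc)
      finally show ?thesis unfolding sum_d by simp
    qed
    moreover have "\<exists>j\<in>J. d j \<noteq> 0" using c(1) by (auto simp: d_def)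
    ultimately show ?thesis by blast
  qed
qed

lemma qrank_witness:
  obtains S where "S \<subseteq> {0..<dim_col C}" "right_lin_indep_cols C S" "card S = qrank C"
  and "\<And>T. T \<subseteq> {0..<dim_col C} \<Longrightarrow> right_lin_indep_cols C T \<Longrightarrow> card T \<le> qrank C"
proof -
  let ?K = "{card S | S. S \<subseteq> {0..<dim_col C} \<and> right_lin_indep_cols C S}"
  have fin: "finite ?K"
    by (rule finite_subset[of _ "card ` Pow {0..<dim_col C}"]) auto
  have "right_lin_indep_cols C {}" by (simp add: right_lin_indep_cols_def)
  then have "?K \<noteq> {}" by auto
  then have "qrank C \<in> ?K" unfolding qrank_def using fin by (rule Max_in[rotated])
  moreover have "card T \<le> qrank C" if "T \<subseteq> {0..<dim_col C}" "right_lin_indep_cols C T" for T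
    unfolding qrank_def using that fin by (intro Max_ge) auto
  ultimately show ?thesis using that by auto
qed

text \<open>More than \<open>r\<close> columns of \<open>F\<close> are dependent, and multiplication
  by \<open>C\<close> from the left keeps the relation.\<close>

lemma qrank_mult_le:
  assumes C: "C \<in> carrier_mat m r" and F: "F \<in> carrier_mat r n"
  shows "qrank (C * F) \<le> r"
proof (rule ccontr)
  assume "\<not> qrank (C * F) \<le> r"
  moreover obtain S where S: "S \<subseteq> {0..<n}" "right_lin_indep_cols (C * F) S" "card S = qrank (C * F)"
    using qrank_witness[of "C * F"] F by (metis carrier_matD(2) index_mult_mat(3))
  ultimately have "r < card S" "finite S" using finite_subset by auto
  then obtain c where c: "\<exists>j\<in>S. c j \<noteq> 0" "\<forall>i<r. (\<Sum>j\<in>S. F $$ (i, j) * c j) = 0"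
    using underdetermined_system[of S r "\<lambda>i j. F $$ (i, j)"] by auto
  have "(\<Sum>j\<in>S. (C * F) $$ (i, j) * c j) = 0" if "i < m" for i
  proof -
    have "(\<Sum>j\<in>S. (C * F) $$ (i, j) * c j) = (\<Sum>j\<in>S. \<Sum>t\<in>{0..<r}. C $$ (i, t) * (F $$ (t, j) * c j))"
      using S(1) that by (intro sum.cong refl) (subst mult_entry[OF C F]; auto simp: sum_distrib_right mult.assoc)
    also have "\<dots> = (\<Sum>t\<in>{0..<r}. C $$ (i, t) * (\<Sum>j\<in>S. F $$ (t, j) * c j))"
      by (subst sum.swap) (simp add: sum_distrib_left)
    finally show ?thesis using c(2) by simp
  qed
  then show False using S(2) c(1) C by (auto simp: right_lin_indep_cols_def)
qed

text \<open>A maximal independent set of columns spans all others from the right. Together with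
  \<open>qrank_mult_le\<close> this makes the rank the least inner dimension of a factorisation, a
  description symmetric under \<open>cstar\<close>.\<close>

lemma qrank_factor:
  assumes A: "A \<in> carrier_mat m n"
  obtains C F where "C \<in> carrier_mat m (qrank A)" "F \<in> carrier_mat (qrank A) n" "A = C * F"
proof -
  obtain S where S: "S \<subseteq> {0..<n}" "right_lin_indep_cols A S" "card S = qrank A"
    and mx: "\<And>T. T \<subseteq> {0..<n} \<Longrightarrow> right_lin_indep_cols A T \<Longrightarrow> card T \<le> qrank A"
    using qrank_witness[of A] A by (metis carrier_matD(2))
  have fin: "finite S" using S(1) finite_subset by blast
  have "\<exists>f. \<forall>i<m. A $$ (i, k) = (\<Sum>j\<in>S. A $$ (i, j) * f j)" if k: "k < n" for k
  proof (cases "k \<in> S")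
    case True
    then show ?thesis using fin by (intro exI[of _ "\<lambda>j. if j = k then 1 else 0"]) (simp add: if_distrib cong: if_cong)
  next
    case False
    then have "\<not> right_lin_indep_cols A (insert k S)"
      using mx[of "insert k S"] S fin k by auto
    then obtain c where c: "\<forall>i<m. (\<Sum>j\<in>insert k S. A $$ (i, j) * c j) = 0" "\<exists>j\<in>insert k S. c j \<noteq> 0"
      using A by (auto simp: right_lin_indep_cols_def)
    have eq: "A $$ (i, k) * c k = - (\<Sum>j\<in>S. A $$ (i, j) * c j)" if "i < m" for i
      using c(1)[rule_format, OF that] fin False by (simp add: eq_neg_iff_add_eq_0)
    have ck: "c k \<noteq> 0"
    proof
      assume 0: "c k = 0"
      then have "\<forall>i<m. (\<Sum>j\<in>S. A $$ (i, j) * c j) = 0" using eq by simp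
      then have "\<forall>j\<in>S. c j = 0" using S(2) A by (auto simp: right_lin_indep_cols_def)
      then show False using c(2) 0 by auto
    qed
    have "A $$ (i, k) = (\<Sum>j\<in>S. A $$ (i, j) * (- (c j * inverse (c k))))" if "i < m" for i
    proof -
      have "A $$ (i, k) = A $$ (i, k) * c k * inverse (c k)" using ck by (simp add: mult.assoc)
      also have "\<dots> = (\<Sum>j\<in>S. A $$ (i, j) * (- (c j * inverse (c k))))"
        unfolding eq[OF that] by (simp add: sum_distrib_right sum_negf mult.assoc)
      finally show ?thesis .
    qed
    then show ?thesis by (intro exI[of _ "\<lambda>j. - (c j * inverse (c k))"]) blast
  qed
  then obtain f where f: "\<And>k i. k < n \<Longrightarrow> i < m \<Longrightarrow> A $$ (i, k) = (\<Sum>j\<in>S. A $$ (i, j) * f k j)"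
    by metis
  obtain e where e: "bij_betw e {0..<card S} S" using ex_bij_betw_nat_finite[OF fin] by auto
  let ?C = "mat m (card S) (\<lambda>(i, t). A $$ (i, e t))" and ?F = "mat (card S) n (\<lambda>(t, k). f k (e t))"
  have "A = ?C * ?F"
  proof (rule eq_matI)
    fix i k assume "i < dim_row (?C * ?F)" "k < dim_col (?C * ?F)"
    then have ik: "i < m" "k < n" by auto
    have "(?C * ?F) $$ (i, k) = (\<Sum>t\<in>{0..<card S}. A $$ (i, e t) * f k (e t))"
      using ik by (subst mult_entry[of _ m "card S" _ n]) auto
    also have "\<dots> = (\<Sum>j\<in>S. A $$ (i, j) * f k j)" by (rule sum.reindex_bij_betw[OF e])
    finally show "A $$ (i, k) = (?C * ?F) $$ (i, k)" using f ik by simp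
  qed (use A in auto)
  then show ?thesis using that[of ?C ?F] S(3) by simp
qed

text \<open>The adjoint of a rank factorisation factors \<open>cstar A\<close> through the same
  inner dimension; applying this twice gives equality.\<close>

lemma qrank_cstar:
  assumes "A \<in> carrier_mat m n"
  shows "qrank (cstar A) = qrank A"
proof -
  have le: "qrank (cstar B) \<le> qrank B" if B: "B \<in> carrier_mat k l" for B k l
  proof -
    obtain C F where CF: "C \<in> carrier_mat k (qrank B)" "F \<in> carrier_mat (qrank B) l" "B = C * F"
      by (rule qrank_factor[OF B])
    have "cstar B = cstar F * cstar C" using CF cstar_mult by metis
    then show ?thesis using qrank_mult_le[of "cstar F" l "qrank B" "cstar C" k] CF(1,2) by simp
  qed
  show ?thesis using le[OF assms] le[OF cstar_carrier[OF assms]] by simp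
qed

lemma qrank_mult_mult_le:
  assumes X: "X \<in> carrier_mat k m" and A: "A \<in> carrier_mat m n" and Y: "Y \<in> carrier_mat n l"
  shows "qrank (X * A * Y) \<le> qrank A"
proof -
  obtain C F where CF: "C \<in> carrier_mat m (qrank A)" "F \<in> carrier_mat (qrank A) n" "A = C * F"
    by (rule qrank_factor[OF A])
  have "X * A * Y = (X * C) * (F * Y)"
    unfolding CF(3) using carrier_matD[OF CF(1)] carrier_matD[OF CF(2)] carrier_matD[OF X] carrier_matD[OF Y]
    by (simp add: mat_assoc)
  then show ?thesis
    using qrank_mult_le[of "X * C" k "qrank A" "F * Y" l] X Y CF(1,2) by simp
qed

lemma qrank_full_inj:
  assumes A: "A \<in> carrier_mat m n" "qrank A = n" and X: "X \<in> carrier_mat n 1" "A * X = 0\<^sub>m m 1"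
  shows "X = 0\<^sub>m n 1"
proof -
  obtain S where S: "S \<subseteq> {0..<n}" "right_lin_indep_cols A S" "card S = n"
    using qrank_witness[of A] A by (metis carrier_matD(2))
  then have "S = {0..<n}" by (intro card_subset_eq) auto
  moreover have "(\<Sum>j\<in>{0..<n}. A $$ (i, j) * X $$ (j, 0)) = 0" if "i < m" for i
    using mult_entry[OF A(1) X(1) that, of 0] X(2) that by simp
  ultimately have "\<forall>j\<in>{0..<n}. X $$ (j, 0) = 0"
    using S(2)[unfolded right_lin_indep_cols_def, rule_format, of "\<lambda>j. X $$ (j, 0)"] A(1) by auto
  then show ?thesis using X(1) by (intro eq_matI) auto
qed

subsection \<open>Gram matrices and the Moore--Penrose inverse\<close>

lemma hermitian_gram: "A \<in> carrier_mat m n \<Longrightarrow> hermitian (cstar A * A)"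
  by (rule hermitianI[of _ n]) (auto simp: cstar_mult')

lemma gram_form:
  assumes A: "A \<in> carrier_mat m n" and S: "S \<subseteq> {0..<n}" and i: "i \<in> S"
  shows "(\<Sum>j\<in>S. ent (cstar A * A) i j * c j) = (\<Sum>t\<in>{0..<m}. qcnj (A $$ (t, i)) * (\<Sum>j\<in>S. A $$ (t, j) * c j))"
proof -
  have lt: "x < n" if "x \<in> S" for x using that S by auto
  have "(\<Sum>j\<in>S. ent (cstar A * A) i j * c j) = (\<Sum>j\<in>S. \<Sum>t\<in>{0..<m}. qcnj (A $$ (t, i)) * (A $$ (t, j) * c j))"
  proof (rule sum.cong[OF refl])
    fix j assume j: "j \<in> S"
    have "ent (cstar A * A) i j = (cstar A * A) $$ (i, j)" using A i j lt by (intro ent_carrier) auto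
    also have "\<dots> = (\<Sum>t\<in>{0..<m}. qcnj (A $$ (t, i)) * A $$ (t, j))"
      using A i j lt by (subst mult_entry[of _ n m _ n]) (auto simp: cstar_entry)
    finally show "ent (cstar A * A) i j * c j = (\<Sum>t\<in>{0..<m}. qcnj (A $$ (t, i)) * (A $$ (t, j) * c j))"
      by (simp add: sum_distrib_right mult.assoc)
  qed
  also have "\<dots> = (\<Sum>t\<in>{0..<m}. qcnj (A $$ (t, i)) * (\<Sum>j\<in>S. A $$ (t, j) * c j))"
    by (subst sum.swap) (simp add: sum_distrib_left)
  finally show ?thesis .
qed

text \<open>The quadratic form of the Gram matrix at \<open>c\<close> is the squared length of
  \<open>A c\<close>. It is positive on independent columns, and a dependency lies in its
  kernel.\<close>

lemma gram_mdet:
  assumes A: "A \<in> carrier_mat m n" and S: "S \<subseteq> {0..<n}"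
  shows "right_lin_indep_cols A S \<Longrightarrow> is_pos_real (mdet (ent (cstar A * A)) S)"
    and "\<not> right_lin_indep_cols A S \<Longrightarrow> mdet (ent (cstar A * A)) S = 0"
proof -
  let ?h = "ent (cstar A * A)"
  interpret hermitian_function ?h by (rule hermitian_function_ent[OF hermitian_gram[OF A]])
  have fin: "finite S" using S finite_subset by blast
  show "is_pos_real (mdet ?h S)" if ind: "right_lin_indep_cols A S"
  proof (rule mdet_pos[OF fin], unfold posdef_on_def, intro allI impI)
    fix c :: "nat \<Rightarrow> quat" assume c: "\<exists>k\<in>S. c k \<noteq> 0"
    let ?z = "\<lambda>t. \<Sum>j\<in>S. A $$ (t, j) * c j"
    have "(\<Sum>i\<in>S. qcnj (c i) * (\<Sum>j\<in>S. ?h i j * c j)) = (\<Sum>i\<in>S. \<Sum>t\<in>{0..<m}. (qcnj (c i) * qcnj (A $$ (t, i))) * ?z t)"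
      using gram_form[OF A S] by (simp add: sum_distrib_left mult.assoc)
    also have "\<dots> = (\<Sum>t\<in>{0..<m}. qcnj (?z t) * ?z t)"
      by (subst sum.swap) (simp add: sum_distrib_right qcnj_sum)
    finally have eq: "(\<Sum>i\<in>S. qcnj (c i) * (\<Sum>j\<in>S. ?h i j * c j)) = (\<Sum>t\<in>{0..<m}. qcnj (?z t) * ?z t)" .
    obtain t where "t < m" "?z t \<noteq> 0" using ind c A by (auto simp: right_lin_indep_cols_def)
    then show "is_pos_real (\<Sum>i\<in>S. qcnj (c i) * (\<Sum>j\<in>S. ?h i j * c j))"
      unfolding eq by (intro is_pos_real_norm_sum[of _ t]) auto
  qed
  show "mdet ?h S = 0" if "\<not> right_lin_indep_cols A S"
  proof -
    obtain c k where "k \<in> S" "c k \<noteq> 0" "\<forall>t<m. (\<Sum>j\<in>S. A $$ (t, j) * c j) = 0"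
      using \<open>\<not> right_lin_indep_cols A S\<close> A by (auto simp: right_lin_indep_cols_def)
    then show ?thesis using gram_form[OF A S, of _ c] by (intro mdet_zero[OF fin, of k c]) auto
  qed
qed

text \<open>No summand is negative at order \<open>qrank A\<close>, and a maximal independent set of
  columns gives a positive one. Any larger set of columns is dependent.\<close>

lemma gram_msum:
  assumes A: "A \<in> carrier_mat m n"
  shows "is_pos_real (msum (qrank A) (cstar A * A))"
    and "s > qrank A \<Longrightarrow> msum s (cstar A * A) = 0"
proof -
  let ?h = "ent (cstar A * A)" and ?r = "qrank A"
  obtain S where S: "S \<subseteq> {0..<n}" "right_lin_indep_cols A S" "card S = ?r"
    and mx: "\<And>T. T \<subseteq> {0..<n} \<Longrightarrow> right_lin_indep_cols A T \<Longrightarrow> card T \<le> ?r"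
    using qrank_witness[of A] A by (metis carrier_matD(2))
  have ms: "msum s (cstar A * A) = (\<Sum>\<beta>\<in>seqs s n. mdet ?h \<beta>)" for s using A by (simp add: msum_def)
  show "s > ?r \<Longrightarrow> msum s (cstar A * A) = 0"
    unfolding ms using mx by (intro sum.neutral ballI gram_mdet(2)[OF A]) (auto simp: seqs_def leD)
  have nn: "Im1 (mdet ?h \<beta>) = 0 \<and> Im2 (mdet ?h \<beta>) = 0 \<and> Im3 (mdet ?h \<beta>) = 0 \<and> Re (mdet ?h \<beta>) \<ge> 0"
    if "\<beta> \<in> seqs ?r n" for \<beta>
    using gram_mdet[OF A, of \<beta>] that by (cases "right_lin_indep_cols A \<beta>") (auto simp: seqs_def is_pos_real_def)
  have "0 < (\<Sum>\<beta>\<in>seqs ?r n. Re (mdet ?h \<beta>))"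
    using S gram_mdet(1)[OF A S(1,2)] nn
    by (intro sum_pos2[of _ S]) (auto simp: seqs_def[of ?r n] is_pos_real_def intro: finite_subset[of _ "Pow {0..<n}"])
  then show "is_pos_real (msum ?r (cstar A * A))"
    unfolding ms is_pos_real_def quat_component_sums using nn by (simp add: sum.neutral)
qed

text \<open>In general this is only an inner inverse of \<open>cstar A * A\<close>: it may act
  non-trivially on the kernel. The product with \<open>cstar A\<close> removes that part.\<close>

definition gram_ginv :: "quat mat \<Rightarrow> quat mat" where
  "gram_ginv A = inverse (msum (qrank A) (cstar A * A)) \<cdot>\<^sub>m adjm (qrank A) (cstar A * A)"

lemma gram_adjm_large:
  assumes A: "A \<in> carrier_mat m n" and s: "s > qrank A"
  shows "cstar A * A * adjm s (cstar A * A) = 0\<^sub>m n n"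
  using s
proof (induction "Suc n - s" arbitrary: s)
  case 0
  then have "adjm s (cstar A * A) = 0\<^sub>m n n" using A by (intro adjm_large) auto
  then show ?case using A by (simp add: right_mult_zero_mat[of _ n n])
next
  case (Suc k)
  let ?H = "cstar A * A"
  let ?Z = "?H * adjm s ?H"
  have H: "?H \<in> carrier_mat n n" "hermitian ?H" using A hermitian_gram by auto
  have c: "adjm s ?H \<in> carrier_mat n n" "adjm (Suc s) ?H \<in> carrier_mat n n" "?Z \<in> carrier_mat n n" using H by auto
  have IH: "?H * adjm (Suc s) ?H = 0\<^sub>m n n" using Suc by simp
  have "?H * (?Z + adjm (Suc s) ?H) = ?H * (0 \<cdot>\<^sub>m 1\<^sub>m n)"
    using adjm_rec[OF H, of s] gram_msum(2)[OF A Suc.prems] by simp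
  also have "0 \<cdot>\<^sub>m 1\<^sub>m n = (0\<^sub>m n n :: quat mat)" by (rule eq_matI) auto
  finally have "?H * ?Z + ?H * adjm (Suc s) ?H = 0\<^sub>m n n"
    using H c by (simp add: mult_add_distrib_mat[of _ n n] right_mult_zero_mat[of _ n n])
  then have HZ: "?H * ?Z = 0\<^sub>m n n" using IH right_add_zero_mat[of "?H * ?Z" n n] H c by simp
  have "cstar ?Z * ?Z = adjm s ?H * (?H * ?Z)"
    using H c cstar_adjm[OF H] hermitian_cstar[OF H(2)]
    by (simp only: cstar_mult[OF H(1) c(1)] assoc_mult_mat[OF c(1) H(1) c(3)])
  then have "cstar ?Z * ?Z = 0\<^sub>m n n" using HZ c by (simp add: right_mult_zero_mat[of _ n n])
  then show ?case using cstar_self_zero[of ?Z] carrier_matD[OF c(3)] by metis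
qed

lemma gram_ginv_props:
  assumes A: "A \<in> carrier_mat m n"
  defines "H \<equiv> cstar A * A" and "G \<equiv> gram_ginv A"
  shows "G \<in> carrier_mat n n" "cstar G = G" "G * H = H * G" "H * (H * G) = H"
proof -
  let ?r = "qrank A"
  let ?d = "msum ?r H"
  have H: "H \<in> carrier_mat n n" "hermitian H" using A hermitian_gram by (auto simp: H_def)
  have p: "is_pos_real ?d" using gram_msum(1)[OF A] by (simp add: H_def)
  note ri = is_pos_real_inverse[OF p]
  have c: "adjm ?r H \<in> carrier_mat n n" "adjm (Suc ?r) H \<in> carrier_mat n n" using H by auto
  have Geq: "G = inverse ?d \<cdot>\<^sub>m adjm ?r H" by (simp add: G_def gram_ginv_def H_def)
  show G: "G \<in> carrier_mat n n" using c by (simp add: Geq)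
  show "cstar G = G" using cstar_adjm[OF H] by (simp add: Geq cstar_smult ri)
  show "G * H = H * G"
    unfolding Geq using adjm_commute[OF H] carrier_matD[OF c(1)] carrier_matD[OF H(1)] ri
    by (simp add: smult_left smult_right)
  have "H * (H * adjm ?r H + adjm (Suc ?r) H) = H * (?d \<cdot>\<^sub>m 1\<^sub>m n)" using adjm_rec[OF H] by simp
  then have "H * (H * adjm ?r H) + H * adjm (Suc ?r) H = ?d \<cdot>\<^sub>m H"
    using carrier_matD[OF H(1)] right_mult_one_mat[OF H(1)] is_pos_realD(1)[OF p] by (simp add: mat_distrib smult_right)
  moreover have "H * adjm (Suc ?r) H = 0\<^sub>m n n" using gram_adjm_large[OF A, of "Suc ?r"] by (simp add: H_def)
  ultimately have "H * (H * adjm ?r H) = ?d \<cdot>\<^sub>m H"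
    using right_add_zero_mat[of "H * (H * adjm ?r H)" n n] H c by simp
  then have "inverse ?d \<cdot>\<^sub>m (H * (H * adjm ?r H)) = H"
    using is_pos_realD(2)[OF p] by (simp add: smult_mat_smult)
  then show "H * (H * G) = H"
    unfolding Geq using H c ri by (simp add: smult_right)
qed

lemma moore_penrose_gram:
  assumes A: "A \<in> carrier_mat m n"
  defines "Y \<equiv> gram_ginv A * cstar A"
  shows "Y \<in> carrier_mat n m" "A * Y * A = A" "Y * A * Y = Y" "cstar (A * Y) = A * Y" "cstar (Y * A) = Y * A"
proof -
  let ?G = "gram_ginv A"
  note g = gram_ginv_props[OF A]
  note d = carrier_matD[OF A] carrier_matD[OF g(1)]
  show "Y \<in> carrier_mat n m" using g(1) A by (simp add: Y_def)
  let ?W = "?G * (cstar A * A)"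
  \<comment> \<open>The product \<open>cstar A * ?Z\<close> vanishes and \<open>cstar ?Z\<close>
    ends in \<open>cstar A\<close>, so \<open>cstar ?Z * ?Z\<close> vanishes too. This cancels
    \<open>cstar A\<close> on the left.\<close>
  let ?Z = "A * ?W - A"
  have W: "?W \<in> carrier_mat n n" using g(1) A by auto
  have Z: "?Z \<in> carrier_mat m n" using A W by (auto intro: minus_carrier_mat)
  have "cstar A * ?Z = cstar A * (A * ?W) - cstar A * A"
    using A W by (intro mult_minus_distrib_mat[of _ n m _ n]) auto
  also have "cstar A * (A * ?W) = cstar A * A"
    using g(3,4) d by (simp add: mat_assoc)
  finally have AZ: "cstar A * ?Z = 0\<^sub>m n n" using A by (auto intro: eq_matI)
  have "cstar ?Z * ?Z = (cstar ?W * cstar A - cstar A) * ?Z"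
    using A W by (simp add: cstar_minus[of _ m n] cstar_mult[of A m n])
  also have "\<dots> = cstar ?W * (cstar A * ?Z) - cstar A * ?Z"
    using d carrier_matD[OF W] carrier_matD[OF Z]
    by (subst mat_distrib(4)) (simp_all add: mat_assoc del: index_mult_mat(1) index_minus_mat(1))
  also have "\<dots> = 0\<^sub>m n n" unfolding AZ using W by (simp add: right_mult_zero_mat[of _ n n] cstar_carrier[of _ n n])
  finally have "?Z = 0\<^sub>m m n" using cstar_self_zero[of ?Z] carrier_matD[OF Z] by metis
  then have AW: "A * ?W = A"
  proof -
    assume z: "?Z = 0\<^sub>m m n"
    show ?thesis
    proof (rule eq_matI)
      fix i j assume ij: "i < dim_row A" "j < dim_col A"
      then have "?Z $$ (i, j) = 0" using z d by simp
      then show "(A * ?W) $$ (i, j) = A $$ (i, j)" using ij d by (simp del: index_mult_mat(1))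
    qed (use d in auto)
  qed
  show "A * Y * A = A" using AW d by (simp add: Y_def mat_assoc)
  have "cstar (A * ?W) = cstar A" using AW by simp
  then have CA: "cstar A * (A * (?G * cstar A)) = cstar A" using d g(2) by (simp add: cstar_mult' mat_assoc)
  show "Y * A * Y = Y" using CA d by (simp add: Y_def mat_assoc)
  show "cstar (A * Y) = A * Y" using d g(2) by (simp add: Y_def cstar_mult' mat_assoc)
  show "cstar (Y * A) = Y * A" using d g(2,3) by (simp add: Y_def cstar_mult' mat_assoc)
qed

subsection \<open>Real polynomials in a Hermitian matrix\<close>

definition qr :: "real \<Rightarrow> quat" where "qr x = Quat x 0 0 0"

lemma qr_simps [simp]: "qr 0 = 0" "qr 1 = 1" "qcnj (qr x) = qr x" "qr (- x) = - qr x"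
  by (simp_all add: qr_def quat_eq_iff)

lemma qr_add: "qr (x + y) = qr x + qr y" and qr_mult: "qr (x * y) = qr x * qr y"
  by (simp_all add: qr_def quat_eq_iff)

lemma qr_Re: "qcnj d = d \<Longrightarrow> qr (Re d) = d"
  by (simp add: qcnj_fixed_iff qr_def quat_eq_iff)

text \<open>Horner evaluation at \<open>H\<close>. Real coefficients keep the scalars central, so
  that evaluation respects products.\<close>

definition pm :: "quat mat \<Rightarrow> real poly \<Rightarrow> quat mat" where
  "pm H p = fold_coeffs (\<lambda>a X. qr a \<cdot>\<^sub>m 1\<^sub>m (dim_row H) + H * X) p (0\<^sub>m (dim_row H) (dim_row H))"

lemma smult_add_mat: "dim_row A = dim_row B \<Longrightarrow> dim_col A = dim_col B \<Longrightarrow> d \<cdot>\<^sub>m (A + B) = d \<cdot>\<^sub>m A + d \<cdot>\<^sub>m (B :: quat mat)"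
  by (rule eq_matI) (auto simp: distrib_left)

context
  fixes H :: "quat mat" and n :: nat
  assumes H: "H \<in> carrier_mat n n"
begin

lemma H_dims: "dim_row H = n" "dim_col H = n" using H by auto

lemma pm_0 [simp]: "pm H 0 = 0\<^sub>m n n"
  using H by (simp add: pm_def)

lemma pm_pCons: "pm H (pCons a p) = qr a \<cdot>\<^sub>m 1\<^sub>m n + H * pm H p"
proof (cases "a = 0 \<and> p = 0")
  case True
  moreover have "0 \<cdot>\<^sub>m 1\<^sub>m n + H * 0\<^sub>m n n = 0\<^sub>m n n"
    using H by (simp add: right_mult_zero_mat[of _ n n]) (auto intro: eq_matI)
  ultimately show ?thesis by simp
next
  case False
  then show ?thesis using H by (auto simp: pm_def)
qed

lemma pm_carrier [simp]: "pm H p \<in> carrier_mat n n"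
  using H by (induction p) (simp_all add: pm_pCons)

lemma pm_dims [simp]: "dim_row (pm H p) = n" "dim_col (pm H p) = n"
  using pm_carrier[of p] by blast+

lemma pm_const: "pm H [:a:] = qr a \<cdot>\<^sub>m 1\<^sub>m n"
  using H by (simp add: pm_pCons right_mult_zero_mat[of _ n n])

lemma pm_linear: "pm H [:a, 1:] = qr a \<cdot>\<^sub>m 1\<^sub>m n + H"
  using H by (simp add: pm_pCons[of a] pm_const)

lemma pm_X: "pm H [:0, 1:] = H"
proof -
  have "0 \<cdot>\<^sub>m 1\<^sub>m n + H = H" using H by (intro eq_matI) auto
  then show ?thesis using pm_linear[of 0] by simp
qed

lemma pm_add: "pm H (p + q) = pm H p + pm H q"
proof (induction p arbitrary: q)
  case 0
  show ?case by simp
next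
  case (pCons a p)
  obtain b r where q: "q = pCons b r" by (cases q)
  have "pm H (pCons a p + q) = (qr a + qr b) \<cdot>\<^sub>m 1\<^sub>m n + (H * pm H p + H * pm H r)"
    using pCons.IH[of r] by (simp add: q pm_pCons qr_add mat_distrib H_dims)
  also have "\<dots> = (qr a \<cdot>\<^sub>m 1\<^sub>m n + H * pm H p) + (qr b \<cdot>\<^sub>m 1\<^sub>m n + H * pm H r)"
    using H_dims by (intro eq_matI) (simp_all add: algebra_simps del: index_mult_mat(1))
  finally show ?case by (simp add: q pm_pCons)
qed

lemma pm_smult: "pm H (smult c p) = qr c \<cdot>\<^sub>m pm H p"
proof (induction p)
  case 0
  show ?case by (simp add: smult_zero_mat)
next
  case (pCons a p)
  then show ?case
    by (simp add: pm_pCons smult_add_mat H_dims smult_mat_smult qr_mult smult_right)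
qed

lemma pm_mult: "pm H (p * q) = pm H p * pm H q"
proof (induction p)
  case 0
  show ?case by (simp add: left_mult_zero_mat[of _ n n])
next
  case (pCons a p)
  have z: "0 \<cdot>\<^sub>m 1\<^sub>m n + H * X = H * X" if "dim_row X = n" "dim_col X = n" for X
    using that H_dims by (intro eq_matI) (auto simp del: index_mult_mat(1))
  have "pm H (pCons a p * q) = qr a \<cdot>\<^sub>m pm H q + H * (pm H p * pm H q)"
    using pCons z by (simp add: pm_add pm_smult pm_pCons)
  also have "\<dots> = (qr a \<cdot>\<^sub>m 1\<^sub>m n + H * pm H p) * pm H q"
    by (simp add: mat_distrib H_dims smult_left mat_assoc left_mult_one_mat[of _ n n])
  finally show ?case by (simp add: pm_pCons)
qed

text \<open>Needed for \<open>H\<close> itself, to take adjoints, and for a second square root of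
  \<open>H\<close> in the proof of uniqueness.\<close>

lemma pm_commute:
  assumes X: "X \<in> carrier_mat n n" and c: "X * H = H * X"
  shows "X * pm H p = pm H p * X"
proof (induction p)
  case 0
  show ?case using X by (simp add: left_mult_zero_mat[of _ n n] right_mult_zero_mat[of _ n n])
next
  case (pCons a p)
  have "X * pm H (pCons a p) = qr a \<cdot>\<^sub>m X + X * H * pm H p"
    using carrier_matD[OF X] right_mult_one_mat[OF X] by (simp add: pm_pCons mat_distrib H_dims smult_right mat_assoc)
  also have "\<dots> = qr a \<cdot>\<^sub>m X + H * (pm H p * X)"
    unfolding c using pCons.IH carrier_matD[OF X] by (simp add: mat_assoc H_dims)
  also have "\<dots> = pm H (pCons a p) * X"
    using carrier_matD[OF X] left_mult_one_mat[OF X] by (simp add: pm_pCons mat_distrib H_dims smult_left mat_assoc)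
  finally show ?case .
qed

lemma cstar_pm:
  assumes "cstar H = H"
  shows "cstar (pm H p) = pm H p"
proof (induction p)
  case 0
  show ?case by (rule eq_matI) (auto simp: cstar_entry)
next
  case (pCons a p)
  have "cstar (pm H (pCons a p)) = qr a \<cdot>\<^sub>m 1\<^sub>m n + cstar (pm H p) * cstar H"
    using H by (simp add: pm_pCons cstar_add[of _ n n] cstar_smult cstar_mult' H_dims)
  then show ?case
    using pCons assms pm_commute[of H p] H by (simp add: pm_pCons)
qed

end

text \<open>A form of Cayley-Hamilton: solving \<open>adjm_rec\<close> for the next adjugate shows
  each \<open>adjm s H\<close> to be a real polynomial in \<open>H\<close>. The one of order
  \<open>Suc n\<close> is zero, while its polynomial has the coefficient \<open>(-1) ^ n\<close> at
  degree \<open>n\<close>.\<close>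

lemma annihilating_polynomial:
  assumes H: "H \<in> carrier_mat n n" "hermitian H"
  obtains f where "f \<noteq> 0" "pm H f = 0\<^sub>m n n"
proof -
  define P where "P = rec_nat 0 (\<lambda>s p. pCons (Re (msum s H)) (smult (-1) p))"
  have P: "P 0 = 0" "P (Suc s) = pCons (Re (msum s H)) (smult (-1) (P s))" for s
    by (simp_all add: P_def)
  have "adjm s H = pm H (P s)" for s
  proof (induction s)
    case 0
    show ?case using H by (simp add: P adjm_0 pm_0)
  next
    case (Suc s)
    note d = carrier_matD[OF H(1)]
    have r: "H * adjm s H + adjm (Suc s) H = msum s H \<cdot>\<^sub>m 1\<^sub>m n" by (rule adjm_rec[OF H])
    have "pm H (P (Suc s)) = msum s H \<cdot>\<^sub>m 1\<^sub>m n + qr (-1) \<cdot>\<^sub>m (H * adjm s H)"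
      unfolding P pm_pCons[OF H(1)] pm_smult[OF H(1)] Suc.IH[symmetric]
      using qcnj_msum[OF H(2)] d by (simp add: qr_Re smult_right)
    also have "\<dots> = adjm (Suc s) H"
      unfolding r[symmetric] using d by (intro eq_matI) (simp_all del: index_mult_mat(1))
    finally show ?case ..
  qed
  moreover have "coeff (P (Suc s)) s = (-1) ^ s" for s
  proof (induction s)
    case 0
    then show ?case by (simp add: P msum_0)
  next
    case (Suc s)
    then show ?case by (subst P(2)) simp
  qed
  then have "P (Suc n) \<noteq> 0" by (metis coeff_0 power_not_zero zero_neq_neg_one)
  ultimately show ?thesis using that[of "P (Suc n)"] adjm_large[OF H(1), of "Suc n"] by simp
qed

text \<open>A complex root gives a linear factor if it is real and a quadratic one otherwise. The
  quadratic factor is kept as a square plus \<open>b\<^sup>2\<close>, the shape that evaluates to a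
  definite matrix.\<close>

lemma real_poly_factor:
  fixes f :: "real poly"
  assumes "degree f > 0"
  obtains (linear) a g where "f = [:-a, 1:] * g"
    | (quadratic) a b g where "b \<noteq> 0" "f = ([:-a, 1:] * [:-a, 1:] + [:b\<^sup>2:]) * g"
proof -
  let ?e = "\<lambda>p z. poly (map_poly complex_of_real p) z"
  have e_add: "?e (p + q) z = ?e p z + ?e q z" for p q z
  proof (induction p arbitrary: q)
    case (pCons a p)
    obtain b r where "q = pCons b r" by (cases q)
    then show ?case using pCons.IH[of r] by (simp add: map_poly_pCons algebra_simps)
  qed simp
  have e_smult: "?e (smult c p) z = of_real c * ?e p z" for c p z
    by (induction p) (simp_all add: map_poly_pCons algebra_simps)
  have e_mult: "?e (p * q) z = ?e p z * ?e q z" for p q z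
    by (induction p) (simp_all add: e_add e_smult map_poly_pCons algebra_simps)
  have e_real: "?e p (of_real x) = of_real (poly p x)" for p x
    by (induction p) (simp_all add: map_poly_pCons)
  have "degree (map_poly complex_of_real f) = degree f" by (rule degree_map_poly) simp
  then have "\<not> constant (poly (map_poly complex_of_real f))" using assms by (simp add: constant_degree)
  then obtain z where z: "?e f z = 0" using fundamental_theorem_of_algebra by blast
  obtain a b where ab: "z = Complex a b" by (cases z)
  show ?thesis
  proof (cases "b = 0")
    case True
    then have "z = of_real a" by (simp add: ab complex_of_real_def)
    then have "poly f a = 0" using z e_real by (metis of_real_eq_0_iff)
    then show ?thesis using linear by (auto simp: poly_eq_0_iff_dvd elim: dvdE)
  next
    case False
    define q where "q = [:-a, 1:] * [:-a, 1:] + [:b\<^sup>2:]"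
    have dq: "degree q = 2" by (simp add: q_def)
    have eq: "?e q z = 0"
      by (simp add: q_def) (simp add: e_add e_mult map_poly_pCons ab complex_eq_iff power2_eq_square algebra_simps)
    \<comment> \<open>The remainder has real coefficients, degree at most one and a non-real root,
      so it is zero.\<close>
    have "?e (q * (f div q) + f mod q) z = 0" using z by (simp only: mult_div_mod_eq)
    then have r: "?e (f mod q) z = 0" by (simp only: e_add e_mult eq mult_zero_left add_0)
    have "q \<noteq> 0" using dq by force
    then have "f mod q = 0 \<or> degree (f mod q) < 2" using degree_mod_less[of q f] dq by simp
    then have le: "degree (f mod q) \<le> 1" by auto
    obtain s p where p: "f mod q = pCons s p" by (cases "f mod q")
    with le have "degree p = 0" by (simp split: if_splits)
    then obtain t where st: "f mod q = [:s, t:]" using p by (metis degree_eq_zeroE)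
    have "s + t * a = 0" "t * b = 0"
      using r unfolding st by (simp_all add: map_poly_pCons ab complex_eq_iff algebra_simps)
    then have "f mod q = 0" using False st by simp
    then have "f = q * (f div q)" by (metis add.right_neutral mult_div_mod_eq)
    then show ?thesis using quadratic[of b a] False unfolding q_def by blast
  qed
qed

section \<open>Cancelling definite factors of an annihilating polynomial\<close>

lemma hpd_cancel:
  assumes K: "K \<in> carrier_mat n n" "hpd K" and W: "W \<in> carrier_mat n k" "K * W = 0\<^sub>m n k"
  shows "W = 0\<^sub>m n k"
proof -
  note i = hpd_minv[OF K]
  have "minv K * (K * W) = W"
    using assoc_mult_mat[OF i(1) K(1) W(1)] i(3) left_mult_one_mat[OF W(1)] by simp
  then show ?thesis using W(2) i(1) by (simp add: right_mult_zero_mat[of _ n n])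
qed

text \<open>A semidefinite plus a definite form. In contrast to \<open>hpd_gram\<close> the matrix
  \<open>C\<close> may be singular, as a shift of \<open>H\<close> by a real number can be.\<close>

lemma hpd_gram_add:
  assumes M: "M \<in> carrier_mat n n" "hpd M" and C: "C \<in> carrier_mat m n"
  shows "hpd (cstar C * C + M)"
proof (rule hpdI)
  show "cstar C * C + M \<in> carrier_mat n n" using C M by auto
  show "cstar (cstar C * C + M) = cstar C * C + M"
  proof -
    have c: "cstar C * C \<in> carrier_mat n n" using C by auto
    show ?thesis using hpd_cstar[OF M(2)] by (simp add: cstar_add[OF c M(1)] cstar_mult')
  qed
next
  fix X :: "quat mat" assume X: "X \<in> carrier_mat n 1" "X \<noteq> 0\<^sub>m n 1"
  note d = carrier_matD[OF X(1)] carrier_matD[OF C] carrier_matD[OF M(1)]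
  have "cstar X * (cstar C * C + M) * X = cstar (C * X) * (C * X) + cstar X * M * X"
    using d by (simp add: mat_distrib cstar_mult' mat_assoc)
  then have "(cstar X * (cstar C * C + M) * X) $$ (0, 0) = (cstar (C * X) * (C * X)) $$ (0, 0) + (cstar X * M * X) $$ (0, 0)"
    using d by (simp del: index_mult_mat(1))
  moreover have "(cstar (C * X) * (C * X)) $$ (0, 0) = (\<Sum>t\<in>{0..<m}. qcnj ((C * X) $$ (t, 0)) * (C * X) $$ (t, 0))"
    using d by (subst mult_entry[of _ 1 m _ 1]) (auto simp: cstar_entry simp del: index_mult_mat(1))
  moreover have "is_pos_real (s + w)" if "is_pos_real w" "Im1 s = 0" "Im2 s = 0" "Im3 s = 0" "Re s \<ge> 0" for s w
    using that by (simp add: is_pos_real_def)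
  moreover have "Re (\<Sum>t\<in>I. qcnj (z t) * z t) \<ge> 0" for I and z :: "nat \<Rightarrow> quat"
    unfolding quat_component_sums qcnj_mult_self by (intro sum_nonneg) simp
  moreover have "Im1 (\<Sum>t\<in>I. qcnj (z t) * z t) = 0" "Im2 (\<Sum>t\<in>I. qcnj (z t) * z t) = 0" "Im3 (\<Sum>t\<in>I. qcnj (z t) * z t) = 0"
    for I and z :: "nat \<Rightarrow> quat"
    unfolding quat_component_sums qcnj_mult_self by simp_all
  ultimately show "is_pos_real ((cstar X * (cstar C * C + M) * X) $$ (0, 0))"
    using hpdD[OF M X] by presburger
qed

lemma hpd_scalar: "x > 0 \<Longrightarrow> hpd (qr x \<cdot>\<^sub>m 1\<^sub>m n)"
proof -
  assume x: "x > 0"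
  let ?C = "qr (sqrt x) \<cdot>\<^sub>m 1\<^sub>m n"
  have c: "?C \<in> carrier_mat n n" by simp
  have "hpd (cstar ?C * ?C)"
  proof (rule hpd_gram[OF c])
    fix X :: "quat mat" assume X: "X \<in> carrier_mat n 1" "?C * X = 0\<^sub>m n 1"
    then have "qr (sqrt x) \<cdot>\<^sub>m X = 0\<^sub>m n 1" by (simp add: smult_left)
    then have "qr (1 / sqrt x) \<cdot>\<^sub>m (qr (sqrt x) \<cdot>\<^sub>m X) = 0\<^sub>m n 1" by (simp add: smult_zero_mat)
    then show "X = 0\<^sub>m n 1" using x by (simp add: smult_mat_smult qr_mult[symmetric])
  qed
  moreover have "cstar ?C * ?C = qr x \<cdot>\<^sub>m 1\<^sub>m n"
    using x by (simp add: cstar_smult smult_left smult_right smult_mat_smult qr_mult[symmetric])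
  ultimately show ?thesis by simp
qed

definition roots_poly :: "real set \<Rightarrow> real poly" where
  "roots_poly A = (\<Prod>a\<in>A. [:-a, 1:])"

lemma roots_poly_insert: "finite A \<Longrightarrow> a \<notin> A \<Longrightarrow> roots_poly (insert a A) = [:-a, 1:] * roots_poly A"
  by (simp add: roots_poly_def)

text \<open>Factors without a positive root evaluate to positive definite matrices and are cancelled;
  a repeated root is dropped because \<open>K\<^sup>2W = 0\<close> implies \<open>KW = 0\<close> for Hermitian \<open>K\<close>.\<close>

lemma annihilated_by_simple_positive_roots:
  assumes H: "H \<in> carrier_mat n n" "hpd H"
  assumes "f \<noteq> 0" "Z \<in> carrier_mat n n" "pm H f * Z = 0\<^sub>m n n"
  shows "\<exists>A. finite A \<and> (\<forall>a\<in>A. a > 0) \<and> pm H (roots_poly A) * Z = 0\<^sub>m n n"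
  using assms(3-)
proof (induction "degree f" arbitrary: f Z rule: less_induct)
  case less
  note pmc = pm_carrier[OF H(1)] and pmd = pm_dims[OF H(1)] and pmm = pm_mult[OF H(1)]
  note Zd = carrier_matD[OF less.prems(2)]
  have comm: "pm H p * (pm H q * W) = pm H q * (pm H p * W)" if "W \<in> carrier_mat n n" for p q W
  proof -
    have "pm H p * (pm H q * W) = pm H (p * q) * W" using that by (simp add: pmm mat_assoc pmd)
    also have "\<dots> = pm H q * (pm H p * W)" using that by (simp add: mult.commute[of p q] pmm mat_assoc pmd)
    finally show ?thesis .
  qed
  have drop: ?case if K: "hpd (pm H k)" and f: "f = k * g" and k: "degree k > 0" for k g
  proof -
    have "pm H k * (pm H g * Z) = 0\<^sub>m n n" using less.prems f by (simp add: pmm mat_assoc pmd Zd)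
    then have "pm H g * Z = 0\<^sub>m n n"
      using hpd_cancel[OF pmc K mult_carrier_mat[OF pmc less.prems(2)]] by simp
    moreover have "g \<noteq> 0" "k \<noteq> 0" using less.prems(1) f by auto
    then have "degree g < degree f" using k f by (simp add: degree_mult_eq)
    ultimately show ?case using less.hyps \<open>g \<noteq> 0\<close> less.prems(2) by blast
  qed
  show ?case
  proof (cases "degree f = 0")
    case True
    then obtain c where c: "f = [:c:]" "c \<noteq> 0" using less.prems(1) by (metis degree_eq_zeroE pCons_0_0)
    then have "qr c \<cdot>\<^sub>m Z = 0\<^sub>m n n"
      using less.prems H(1) left_mult_one_mat[OF less.prems(2)] by (simp add: pm_const smult_left Zd)
    then have "qr (1 / c) \<cdot>\<^sub>m (qr c \<cdot>\<^sub>m Z) = 0\<^sub>m n n" by (simp add: smult_zero_mat)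
    then have "Z = 0\<^sub>m n n" using c(2) by (simp add: smult_mat_smult qr_mult[symmetric])
    then show ?thesis
      using pmc[of "roots_poly {}"] by (intro exI[of _ "{}"]) (auto simp: right_mult_zero_mat[of _ n n])
  next
    case False
    then have "degree f > 0" by simp
    then show ?thesis
    proof (cases rule: real_poly_factor)
      case (quadratic a b g)
      have "pm H ([:-a, 1:] * [:-a, 1:] + [:b\<^sup>2:]) = cstar (pm H [:-a, 1:]) * pm H [:-a, 1:] + qr (b\<^sup>2) \<cdot>\<^sub>m 1\<^sub>m n"
        using H by (simp only: pm_add[OF H(1)] pmm pm_const[OF H(1)] cstar_pm[OF H(1) hpd_cstar[OF H(2)]])
      moreover have "hpd (cstar (pm H [:-a, 1:]) * pm H [:-a, 1:] + qr (b\<^sup>2) \<cdot>\<^sub>m 1\<^sub>m n)"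
        by (rule hpd_gram_add[OF _ hpd_scalar pmc]) (use quadratic in auto)
      ultimately show ?thesis using quadratic by (intro drop[of "[:-a, 1:] * [:-a, 1:] + [:b\<^sup>2:]"]) simp_all
    next
      case (linear a g)
      show ?thesis
      proof (cases "a > 0")
        case False
        have "hpd (pm H [:-a, 1:])"
        proof (cases "a = 0")
          case True
          then show ?thesis using H by (simp add: pm_X)
        next
          case a0: False
          have "hpd (qr (-a) \<cdot>\<^sub>m 1\<^sub>m n + H)" using False a0 H by (intro hpd_add[of _ n] hpd_scalar) auto
          then show ?thesis using pm_linear[OF H(1)] by simp
        qed
        then show ?thesis using linear by (intro drop[of "[:-a, 1:]" g]) simp_all
      next
        case True
        \<comment> \<open>The factor of a positive root cannot be cancelled in general. It is
          absorbed into the matrix on the right, which is why \<open>Z\<close> is arbitrary in the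
          induction.\<close>
        let ?K = "pm H [:-a, 1:]"
        have KZ: "?K * Z \<in> carrier_mat n n" using less.prems(2) pmc[of "[:-a, 1:]"] by auto
        have "pm H ([:-a, 1:] * g) * Z = 0\<^sub>m n n" using less.prems(3) unfolding linear .
        then have "pm H g * (?K * Z) = 0\<^sub>m n n"
          using comm[OF less.prems(2), of g "[:-a, 1:]"] unfolding pmm by (simp add: mat_assoc pmd Zd)
        moreover have "g \<noteq> 0" using less.prems(1) linear by auto
        moreover have "degree g < degree f" using \<open>g \<noteq> 0\<close> unfolding linear by (subst degree_mult_eq) auto
        ultimately obtain A where A: "finite A" "\<forall>a\<in>A. a > 0" "pm H (roots_poly A) * (?K * Z) = 0\<^sub>m n n"
          using less.hyps[of g "?K * Z"] KZ by blast
        show ?thesis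
        proof (cases "a \<in> A")
          case False
          have "pm H (roots_poly (insert a A)) * Z = 0\<^sub>m n n"
            using A comm[OF less.prems(2), of "roots_poly A" "[:-a, 1:]"]
            unfolding roots_poly_insert[OF A(1) False] pmm by (simp add: mat_assoc pmd Zd)
          then show ?thesis using A True by (intro exI[of _ "insert a A"]) auto
        next
          case aA: True
          let ?B = "roots_poly (A - {a})"
          have RA: "roots_poly A = [:-a, 1:] * ?B"
            using roots_poly_insert[of "A - {a}" a] A(1) aA by (simp add: insert_absorb)
          let ?W = "pm H ?B * Z"
          have W: "?W \<in> carrier_mat n n" using less.prems(2) pmc[of ?B] by auto
          have "?K * (?K * ?W) = 0\<^sub>m n n"
            using A(3) comm[OF less.prems(2), of ?B "[:-a, 1:]"] unfolding RA pmm by (simp add: mat_assoc pmd Zd)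
          then have "cstar (?K * ?W) * (?K * ?W) = cstar ?W * 0\<^sub>m n n"
            using cstar_pm[OF H(1) hpd_cstar[OF H(2)], of "[:-a, 1:]"] carrier_matD[OF W]
            by (simp add: cstar_mult' mat_assoc pmd Zd)
          then have "cstar (?K * ?W) * (?K * ?W) = 0\<^sub>m n n"
            using right_mult_zero_mat[OF cstar_carrier[OF W]] by simp
          then have "?K * ?W = 0\<^sub>m n n"
            using cstar_self_zero[of "?K * ?W"] by (simp add: pmd Zd)
          then have "pm H (roots_poly A) * Z = 0\<^sub>m n n" unfolding RA pmm by (simp add: mat_assoc pmd Zd)
          then show ?thesis using A by blast
        qed
      qed
    qed
  qed
qed

section \<open>Interpolation on finitely many real nodes\<close>

lemma interpolating_polynomial:
  fixes y :: "real \<Rightarrow> real"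
  assumes "finite A"
  shows "\<exists>f. \<forall>a\<in>A. poly f a = y a"
  using assms
proof (induction A rule: finite_induct)
  case (insert a A)
  then obtain f where f: "\<forall>a\<in>A. poly f a = y a" by blast
  let ?R = "roots_poly A"
  have R: "poly ?R x = (\<Prod>b\<in>A. x - b)" for x by (simp add: roots_poly_def poly_prod)
  have "poly ?R a \<noteq> 0" using insert.hyps by (auto simp: R)
  moreover have "poly ?R b = 0" if "b \<in> A" for b using that insert.hyps by (auto simp: R)
  ultimately show ?case
    using f by (intro exI[of _ "f + smult ((y a - poly f a) / poly ?R a) ?R"]) auto
qed auto

lemma roots_poly_dvd:
  assumes "finite A" "\<forall>a\<in>A. poly p a = 0"
  shows "roots_poly A dvd p"
  using assms
proof (induction A arbitrary: p rule: finite_induct)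
  case (insert a A)
  then have "roots_poly A dvd p" by simp
  then obtain q where q: "p = roots_poly A * q" by (rule dvdE)
  have "poly (roots_poly A) a \<noteq> 0" using insert.hyps by (auto simp: roots_poly_def poly_prod)
  moreover have "poly p a = 0" using insert.prems by simp
  ultimately have "poly q a = 0" using q by simp
  then have "[:-a, 1:] dvd q" by (simp add: poly_eq_0_iff_dvd)
  then show ?case unfolding roots_poly_insert[OF insert.hyps] q by (metis mult.commute mult_dvd_mono dvd_refl)
qed (simp add: roots_poly_def)

subsection \<open>Square roots\<close>

lemma hpd_sqrt_exists:
  assumes H: "H \<in> carrier_mat n n" "hpd H"
  obtains p where "hpd (pm H p)" "pm H p * pm H p = H"
proof -
  note pmc = pm_carrier[OF H(1)] and pmd = pm_dims[OF H(1)] and pmm = pm_mult[OF H(1)]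
  obtain f where f: "f \<noteq> 0" "pm H f = 0\<^sub>m n n" by (rule annihilating_polynomial[OF H(1) hpd_hermitian[OF H(2)]])
  then have "pm H f * 1\<^sub>m n = 0\<^sub>m n n" by simp
  then obtain A where A: "finite A" "\<forall>a\<in>A. a > 0" "pm H (roots_poly A) * 1\<^sub>m n = 0\<^sub>m n n"
    using annihilated_by_simple_positive_roots[OF H f(1) one_carrier_mat] by blast
  then have R: "pm H (roots_poly A) = 0\<^sub>m n n" using right_mult_one_mat[OF pmc] by simp
  \<comment> \<open>Fourth roots are taken so that \<open>?p\<close>, the square of
    \<open>g\<close>, has the values \<open>sqrt a\<close> and evaluates at \<open>H\<close> to a
    Gram matrix, which gives positivity.\<close>
  obtain g where g: "\<forall>a\<in>A. poly g a = sqrt (sqrt a)" using interpolating_polynomial[OF A(1), of "\<lambda>a. sqrt (sqrt a)"] by blast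
  let ?p = "g * g"
  have "poly (?p * ?p - [:0, 1:]) a = 0" if "a \<in> A" for a
  proof -
    have "sqrt (sqrt a) * sqrt (sqrt a) = sqrt a" "sqrt a * sqrt a = a" using A(2) that by auto
    then show ?thesis using g that by simp
  qed
  \<comment> \<open>The polynomial vanishes on \<open>A\<close>, hence is a multiple of
    \<open>roots_poly A\<close>, which annihilates \<open>H\<close>.\<close>
  then obtain h where h: "?p * ?p - [:0, 1:] = roots_poly A * h"
    using roots_poly_dvd[OF A(1), of "?p * ?p - [:0, 1:]"] by (auto elim: dvdE)
  then have "?p * ?p = roots_poly A * h + [:0, 1:]" by (simp add: algebra_simps)
  then have "pm H (?p * ?p) = 0\<^sub>m n n * pm H h + H"
    by (simp only: pm_add[OF H(1)] pmm R pm_X[OF H(1)])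
  then have sq: "pm H ?p * pm H ?p = H"
    using left_mult_zero_mat[OF pmc] left_add_zero_mat[OF H(1)] by (simp add: pmm)
  have Sg: "pm H ?p = cstar (pm H g) * pm H g" by (simp add: pmm cstar_pm[OF H(1) hpd_cstar[OF H(2)]])
  have "hpd (cstar (pm H g) * pm H g)"
  proof (rule hpd_gram[OF pmc])
    fix X assume X: "X \<in> carrier_mat n 1" "pm H g * X = 0\<^sub>m n 1"
    have "H * X = pm H ?p * pm H ?p * X" by (simp only: sq)
    also have "\<dots> = pm H ?p * (pm H g * (pm H g * X))"
      using carrier_matD[OF X(1)] by (simp add: pmm mat_assoc pmd)
    also have "\<dots> = 0\<^sub>m n 1" using X(2) right_mult_zero_mat[OF pmc] by simp
    finally show "X = 0\<^sub>m n 1" using hpd_inj[OF H X(1)] by simp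
  qed
  then have "hpd (pm H ?p)" by (simp only: Sg)
  from that[OF this sq] show ?thesis .
qed

lemma hpd_sqrt:
  assumes H: "H \<in> carrier_mat n n" "hpd H"
  shows "hpd_sqrt H \<in> carrier_mat n n" "hpd (hpd_sqrt H)" "hpd_sqrt H * hpd_sqrt H = H"
proof -
  obtain p where p: "hpd (pm H p)" "pm H p * pm H p = H" by (rule hpd_sqrt_exists[OF H])
  let ?S = "pm H p"
  have S: "?S \<in> carrier_mat n n" by (rule pm_carrier[OF H(1)])
  have "hpd_sqrt H = ?S"
    unfolding hpd_sqrt_def
  proof (rule the_equality)
    show "hpd ?S \<and> dim_row ?S = dim_row H \<and> ?S * ?S = H" using p S H by auto
    fix T assume T: "hpd T \<and> dim_row T = dim_row H \<and> T * T = H"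
    then have Tc: "T \<in> carrier_mat n n" using H by (auto simp: hpd_def hermitian_def)
    note d = carrier_matD[OF Tc] carrier_matD[OF S]
    \<comment> \<open>A second root \<open>T\<close> commutes with \<open>H = T T\<close>, hence
      with the polynomial \<open>?S\<close>. The product of \<open>?S + T\<close> and
      \<open>T - ?S\<close> is then zero, and its first factor is definite.\<close>
    have "T * H = H * T" using T d by (metis mat_assoc)
    then have c: "T * ?S = ?S * T" by (rule pm_commute[OF H(1) Tc])
    have ST: "?S + T \<in> carrier_mat n n" "hpd (?S + T)" using hpd_add[OF S p(1) Tc] T Tc S by auto
    have "(?S + T) * (T - ?S) = T * T - ?S * ?S"
      using d c by (simp add: mat_distrib) (intro eq_matI; simp add: d algebra_simps del: index_mult_mat(1))
    also have "\<dots> = 0\<^sub>m n n" using T p H by (auto intro: eq_matI)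
    finally have "T - ?S = 0\<^sub>m n n" using hpd_cancel[OF ST, of "T - ?S" n] Tc S by (auto intro: minus_carrier_mat)
    show "T = ?S"
    proof (rule eq_matI)
      fix i j assume ij: "i < dim_row ?S" "j < dim_col ?S"
      then have "(T - ?S) $$ (i, j) = 0" using \<open>T - ?S = 0\<^sub>m n n\<close> d by simp
      then show "T $$ (i, j) = ?S $$ (i, j)" using ij d by simp
    qed (use d in auto)
  qed
  then show "hpd_sqrt H \<in> carrier_mat n n" "hpd (hpd_sqrt H)" "hpd_sqrt H * hpd_sqrt H = H"
    using p S by simp_all
qed

lemma hpd_isqrt:
  assumes H: "H \<in> carrier_mat n n" "hpd H"
  shows "hpd_isqrt H \<in> carrier_mat n n" "cstar (hpd_isqrt H) = hpd_isqrt H"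
    "hpd_sqrt H * hpd_isqrt H = 1\<^sub>m n" "hpd_isqrt H * hpd_sqrt H = 1\<^sub>m n"
    "hpd_isqrt H * hpd_isqrt H = minv H"
proof -
  note s = hpd_sqrt[OF H]
  note i = hpd_minv[OF s(1,2), folded hpd_isqrt_def]
  show "hpd_isqrt H \<in> carrier_mat n n" "cstar (hpd_isqrt H) = hpd_isqrt H"
    "hpd_sqrt H * hpd_isqrt H = 1\<^sub>m n" "hpd_isqrt H * hpd_sqrt H = 1\<^sub>m n" using i by auto
  let ?S = "hpd_sqrt H" and ?T = "hpd_isqrt H"
  note d = carrier_matD[OF s(1)] carrier_matD[OF i(1)]
  have cancel: "?S * (?T * X) = X" "?T * (?S * X) = X" if "dim_row X = n" for X
  proof -
    have X: "X \<in> carrier_mat n (dim_col X)" using that by auto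
    show "?S * (?T * X) = X" "?T * (?S * X) = X"
      using assoc_mult_mat[OF s(1) i(1) X] assoc_mult_mat[OF i(1) s(1) X] i(2,3) left_mult_one_mat[OF X] by simp_all
  qed
  have "minv (?S * ?S) = ?T * ?T"
    by (rule minv_eqI[of _ n]) (use s(1) i(1,2,3) cancel d in \<open>auto simp: mat_assoc\<close>)
  then show "?T * ?T = minv H" using s(3) by simp
qed

subsection \<open>The weighted Moore--Penrose inverse\<close>

lemma hpd_mult_cancel:
  assumes "K \<in> carrier_mat n n" "hpd K" "X \<in> carrier_mat n k" "Y \<in> carrier_mat n k" "K * X = K * Y"
  shows "X = Y"
proof -
  note i = hpd_minv[OF assms(1,2)]
  have "minv K * (K * W) = W" if "W \<in> carrier_mat n k" for W
    using assoc_mult_mat[OF i(1) assms(1) that] i(3) left_mult_one_mat[OF that] by simp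
  from this[OF assms(3)] this[OF assms(4)]
  show ?thesis unfolding assms(5) by (rule trans[OF sym])
qed

text \<open>Penrose's uniqueness argument with weights: adjoints let \<open>A Y A = A\<close> absorb
  the inner \<open>Y\<close>, so \<open>M A Y = M A Z\<close>, and similarly
  \<open>N Y A = N Z A\<close>. Cancelling the definite weights gives
  \<open>Z = Z A Z = Y A Y = Y\<close>.\<close>

lemma wmp_inv_eq:
  assumes A: "A \<in> carrier_mat m n" and M: "M \<in> carrier_mat m m" "hpd M" and N: "N \<in> carrier_mat n n" "hpd N"
    and Y: "Y \<in> carrier_mat n m" "A * Y * A = A" "Y * A * Y = Y"
      "cstar (M * A * Y) = M * A * Y" "cstar (N * Y * A) = N * Y * A"
  shows "wmp_inv A M N = Y"
  unfolding wmp_inv_def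
proof (rule the_equality)
  fix Z assume "Z \<in> carrier_mat (dim_col A) (dim_row A) \<and> A * Z * A = A \<and> Z * A * Z = Z \<and>
    cstar (M * A * Z) = M * A * Z \<and> cstar (N * Z * A) = N * Z * A"
  then have Z: "Z \<in> carrier_mat n m" "A * Z * A = A" "Z * A * Z = Z"
    "cstar (M * A * Z) = M * A * Z" "cstar (N * Z * A) = N * Z * A" using A by auto
  note d = carrier_matD[OF A] carrier_matD[OF M(1)] carrier_matD[OF N(1)] carrier_matD[OF Y(1)] carrier_matD[OF Z(1)]
  note hM = hpd_cstar[OF M(2)] and hN = hpd_cstar[OF N(2)]
  have hY: "cstar Y * (cstar A * M) = M * (A * Y)" using Y(4) hM d by (simp add: cstar_mult' mat_assoc)
  have hZ: "cstar Z * (cstar A * M) = M * (A * Z)" using Z(4) hM d by (simp add: cstar_mult' mat_assoc)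
  have hY': "cstar A * (cstar Y * N) = N * (Y * A)" using Y(5) hN d by (simp add: cstar_mult' mat_assoc)
  have hZ': "cstar A * (cstar Z * N) = N * (Z * A)" using Z(5) hN d by (simp add: cstar_mult' mat_assoc)
  have "M * (A * Y) = M * (A * Z * A * Y)" using Z(2) by simp
  also have "\<dots> = (M * (A * Z)) * (A * Y)" using d by (simp add: mat_assoc)
  also have "\<dots> = cstar Z * (cstar A * (M * (A * Y)))" unfolding hZ[symmetric] using d by (simp add: mat_assoc)
  also have "\<dots> = cstar Z * (cstar (A * Y * A) * M)" unfolding hY[symmetric] using d by (simp add: mat_assoc cstar_mult')
  also have "\<dots> = M * (A * Z)" using Y(2) hZ by simp
  finally have AYZ: "A * Y = A * Z"
    by (rule hpd_mult_cancel[OF M _ _, rotated 2]) (use A Y Z in auto)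
  have "N * (Y * A) = N * (Y * (A * Z * A))" using Z(2) by simp
  also have "\<dots> = (N * (Y * A)) * (Z * A)" using d by (simp add: mat_assoc)
  also have "\<dots> = cstar A * (cstar Y * (N * (Z * A)))" unfolding hY'[symmetric] using d by (simp add: mat_assoc)
  also have "\<dots> = cstar (A * Y * A) * (cstar Z * N)" unfolding hZ'[symmetric] using d by (simp add: mat_assoc cstar_mult')
  also have "\<dots> = N * (Z * A)" using Y(2) hZ' by simp
  finally have YZA: "Y * A = Z * A"
    by (rule hpd_mult_cancel[OF N _ _, rotated 2]) (use A Y Z in auto)
  have "Z = Z * (A * Z)" using Z(3) d by (simp add: mat_assoc)
  also have "\<dots> = (Y * A) * Y" unfolding AYZ[symmetric] using YZA d by (simp add: mat_assoc[symmetric])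
  finally show "Z = Y" using Y(3) by simp
qed (use assms in auto)

text \<open>The weights act by congruence: the third condition for \<open>A\<close> concerns
  \<open>hpd_sqrt M * (C * Y) * hpd_sqrt M\<close> and the fourth
  \<open>hpd_sqrt N * (Y * C) * hpd_sqrt N\<close>, which are Hermitian because \<open>C * Y\<close>
  and \<open>Y * C\<close> are.\<close>

lemma wmp_inv_from_penrose:
  assumes A: "A \<in> carrier_mat m n" and M: "M \<in> carrier_mat m m" "hpd M" and N: "N \<in> carrier_mat n n" "hpd N"
  defines "C \<equiv> hpd_sqrt M * A * hpd_isqrt N"
  assumes Y: "Y \<in> carrier_mat n m" "C * Y * C = C" "Y * C * Y = Y" "cstar (C * Y) = C * Y" "cstar (Y * C) = Y * C"
  shows "wmp_inv A M N = hpd_isqrt N * Y * hpd_sqrt M"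
proof -
  let ?Mh = "hpd_sqrt M" and ?Mi = "hpd_isqrt M" and ?Nh = "hpd_sqrt N" and ?Ni = "hpd_isqrt N"
  note Ms = hpd_sqrt[OF M] and Mi = hpd_isqrt[OF M] and Ns = hpd_sqrt[OF N] and Ni = hpd_isqrt[OF N]
  note h = hpd_cstar[OF Ms(2)] hpd_cstar[OF Ns(2)] Mi(2) Ni(2)
  note d = carrier_matD[OF A] carrier_matD[OF Ms(1)] carrier_matD[OF Ns(1)] carrier_matD[OF Mi(1)]
    carrier_matD[OF Ni(1)] carrier_matD[OF Y(1)]
  have cancel: "?Mi * (?Mh * X) = X" if "dim_row X = m" for X
  proof -
    have X: "X \<in> carrier_mat m (dim_col X)" using that by auto
    show ?thesis using assoc_mult_mat[OF Mi(1) Ms(1) X] Mi(4) left_mult_one_mat[OF X] by simp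
  qed
  have cancelN: "?Nh * (?Ni * X) = X" "?Ni * (?Nh * X) = X" if "dim_row X = n" for X
  proof -
    have X: "X \<in> carrier_mat n (dim_col X)" using that by auto
    show "?Nh * (?Ni * X) = X" "?Ni * (?Nh * X) = X"
      using assoc_mult_mat[OF Ns(1) Ni(1) X] assoc_mult_mat[OF Ni(1) Ns(1) X] Ni(3,4) left_mult_one_mat[OF X] by simp_all
  qed
  have C: "C \<in> carrier_mat m n" using A Ms Ni by (auto simp: C_def)
  have Cd: "dim_row C = m" "dim_col C = n" using C by auto
  have AN: "A * (?Ni * ?Nh) = A" using Ni(4) right_mult_one_mat[OF A] by simp
  have CN: "C * ?Nh = ?Mh * A" using AN d by (simp add: C_def mat_assoc)
  have Aeq: "A = ?Mi * (C * ?Nh)" unfolding CN using cancel d by simp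
  let ?Y = "?Ni * Y * ?Mh"
  have MA: "M * A * ?Y = ?Mh * (C * Y) * ?Mh"
    using Ms(3) d by (metis C_def mat_assoc index_mult_mat(2,3))
  have YA: "?Y * A = ?Ni * (Y * C) * ?Nh"
    using CN d Cd by (simp add: mat_assoc)
  have "?Nh * (?Nh * (?Y * A)) = ?Nh * (Y * C) * ?Nh"
    unfolding YA using cancelN(1) d Cd by (simp add: mat_assoc)
  then have NYA: "N * ?Y * A = ?Nh * (Y * C) * ?Nh"
    using Ns(3) d by (metis mat_assoc index_mult_mat(2,3))
  show ?thesis
  proof (rule wmp_inv_eq[OF A M N])
    show "?Y \<in> carrier_mat n m" using Ms Ni Y by auto
    have "?Mh * (A * ?Y * A) = C * Y * C * ?Nh"
      using CN YA d Cd by (simp add: mat_assoc) (simp add: C_def mat_assoc d)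
    then have "?Mh * (A * ?Y * A) = ?Mh * A" using Y(2) CN by simp
    then have "?Mi * (?Mh * (A * ?Y * A)) = ?Mi * (?Mh * A)" by simp
    then show "A * ?Y * A = A" using cancel d by simp
    have "?Y * A * ?Y = ?Ni * (Y * C * Y) * ?Mh"
      unfolding YA using cancelN(1) d Cd by (simp add: mat_assoc)
    then show "?Y * A * ?Y = ?Y" using Y(3) by simp
    show "cstar (M * A * ?Y) = M * A * ?Y"
      unfolding MA using h Y(4) d Cd by (simp add: cstar_mult' mat_assoc)
    show "cstar (N * ?Y * A) = N * ?Y * A"
      unfolding NYA using h Y(5) d Cd by (simp add: cstar_mult' mat_assoc)
  qed
qed

section \<open>Weighted inverses in terms of minors\<close>

lemma qrank_weighted:
  assumes A: "A \<in> carrier_mat m n" and M: "M \<in> carrier_mat m m" "hpd M" and N: "N \<in> carrier_mat n n" "hpd N"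
  shows "qrank (hpd_sqrt M * A * hpd_isqrt N) = qrank A"
proof (rule antisym)
  let ?Mh = "hpd_sqrt M" and ?Mi = "hpd_isqrt M" and ?Nh = "hpd_sqrt N" and ?Ni = "hpd_isqrt N"
  note Ms = hpd_sqrt[OF M] and Mi = hpd_isqrt[OF M] and Ns = hpd_sqrt[OF N] and Ni = hpd_isqrt[OF N]
  note d = carrier_matD[OF A] carrier_matD[OF Ms(1)] carrier_matD[OF Ns(1)] carrier_matD[OF Mi(1)] carrier_matD[OF Ni(1)]
  show "qrank (?Mh * A * ?Ni) \<le> qrank A" by (rule qrank_mult_mult_le[OF Ms(1) A Ni(1)])
  have "?Mi * (?Mh * A * ?Ni) * ?Nh = (?Mi * ?Mh) * (A * (?Ni * ?Nh))" using d by (simp add: mat_assoc)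
  also have "\<dots> = A" using Mi(4) Ni(4) left_mult_one_mat[OF A] right_mult_one_mat[OF A] by simp
  finally show "qrank A \<le> qrank (?Mh * A * ?Ni)"
    using qrank_mult_mult_le[OF Mi(1) _ Ns(1), of "?Mh * A * ?Ni"] A Ms Ni by simp
qed

text \<open>The factor \<open>hpd_isqrt N\<close> occurs twice in the inverse: one copy joins the
  generalised inverse to form \<open>L\<close>, the other comes from \<open>cstar C\<close> and goes
  into the transformed right-hand side. Multiplied by \<open>d\<close>, the generalised inverse is
  the compound adjugate, whose rows produce sums of column minors.\<close>

lemma wmp_left_minor_sums:
  assumes A: "A \<in> carrier_mat m n" and M: "M \<in> carrier_mat m m" "hpd M" and N: "N \<in> carrier_mat n n" "hpd N"
    and r: "qrank A \<ge> 1"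
  defines "C \<equiv> hpd_sqrt M * A * hpd_isqrt N"
  defines "L \<equiv> hpd_isqrt N * gram_ginv C" and "d \<equiv> principal_minor_sum (qrank A) (cstar C * C)"
  shows "L \<in> carrier_mat n n" "wmp_inv A M N = L * (hpd_isqrt N * cstar A * M)" "is_pos_real d"
    and "\<And>v i. i < n \<Longrightarrow> (\<Sum>k<n. hpd_isqrt N $$ (i, k) * cdet_minor_sum (qrank A) (cstar C * C) k v)
        = d * (\<Sum>t\<in>{0..<n}. L $$ (i, t) * v $ t)"
proof -
  let ?Mh = "hpd_sqrt M" and ?Ni = "hpd_isqrt N"
  note Ms = hpd_sqrt[OF M] and Ni = hpd_isqrt[OF N]
  have C: "C \<in> carrier_mat m n" using A Ms Ni by (auto simp: C_def)
  have rk: "qrank C = qrank A" unfolding C_def by (rule qrank_weighted[OF A M N])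
  let ?H = "cstar C * C"
  have H: "?H \<in> carrier_mat n n" "hermitian ?H" using C hermitian_gram by auto
  have dm: "d = msum (qrank C) ?H" using principal_minor_sum_msum[OF H(1)] r rk by (simp add: d_def)
  then show p: "is_pos_real d" using gram_msum(1)[OF C] by simp
  note g = gram_ginv_props[OF C]
  show L: "L \<in> carrier_mat n n" using g(1) Ni(1) by (auto simp: L_def)
  note dd = carrier_matD[OF A] carrier_matD[OF M(1)] carrier_matD[OF Ms(1)] carrier_matD[OF Ni(1)] carrier_matD[OF g(1)] carrier_matD[OF C]
  have "wmp_inv A M N = ?Ni * (gram_ginv C * cstar C) * ?Mh"
    using wmp_inv_from_penrose[OF A M N, folded C_def] moore_penrose_gram[OF C] by simp
  also have "cstar C = ?Ni * (cstar A * ?Mh)"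
    using dd Ni(2) hpd_cstar[OF Ms(2)] by (simp add: C_def cstar_mult' mat_assoc)
  also have "?Ni * (gram_ginv C * (?Ni * (cstar A * ?Mh))) * ?Mh = L * (?Ni * cstar A * (?Mh * ?Mh))"
    using dd by (simp add: L_def mat_assoc)
  finally show "wmp_inv A M N = L * (?Ni * cstar A * M)" using Ms(3) by simp
  have G: "d * gram_ginv C $$ (k, t) = adjm (qrank A) ?H $$ (k, t)" if "k < n" "t < n" for k t
    using that dd is_pos_realD(2)[OF p]
    by (simp add: gram_ginv_def dm[symmetric] rk[symmetric] mult.assoc[symmetric] del: index_mult_mat(1))
  fix v :: "quat vec" and i assume i: "i < n"
  have "(\<Sum>k<n. ?Ni $$ (i, k) * cdet_minor_sum (qrank A) ?H k v)
     = (\<Sum>k\<in>{0..<n}. ?Ni $$ (i, k) * (\<Sum>t\<in>{0..<n}. d * gram_ginv C $$ (k, t) * v $ t))"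
    unfolding lessThan_atLeast0 by (intro sum.cong refl) (simp add: cdet_minor_sum_adjm[OF H] G)
  also have "\<dots> = (\<Sum>k\<in>{0..<n}. \<Sum>t\<in>{0..<n}. d * (?Ni $$ (i, k) * gram_ginv C $$ (k, t) * v $ t))"
  proof -
    have "x * (d * y * z) = d * (x * y * z)" for x y z
      by (metis mult.assoc qcnj_fixed_commute[OF is_pos_realD(1)[OF p]])
    then show ?thesis by (simp add: sum_distrib_left)
  qed
  also have "\<dots> = (\<Sum>t\<in>{0..<n}. d * (L $$ (i, t) * v $ t))"
    using i by (subst sum.swap) (simp add: L_def mult_entry[OF Ni(1) g(1)] sum_distrib_left sum_distrib_right del: index_mult_mat(1))
  finally show "(\<Sum>k<n. ?Ni $$ (i, k) * cdet_minor_sum (qrank A) ?H k v) = d * (\<Sum>t\<in>{0..<n}. L $$ (i, t) * v $ t)"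
    by (simp add: sum_distrib_left)
qed

text \<open>Full column rank makes \<open>K\<close> definite, and the candidate \<open>Y\<close>
  satisfies \<open>Y A = I\<close>. The last Penrose condition then says that \<open>N\<close> is
  Hermitian.\<close>

lemma wmp_left_full:
  assumes A: "A \<in> carrier_mat m n" and M: "M \<in> carrier_mat m m" "hpd M" and N: "N \<in> carrier_mat n n" "hpd N"
    and r: "qrank A = n" "n \<ge> 1"
  defines "K \<equiv> cstar A * M * A"
  shows "minv K \<in> carrier_mat n n" "wmp_inv A M N = minv K * (cstar A * M)" "is_pos_real (hdet K)"
    and "\<And>v i. i < n \<Longrightarrow> cdet i (repl_col K i v) = hdet K * (\<Sum>t\<in>{0..<n}. minv K $$ (i, t) * v $ t)"
proof -
  have K: "K \<in> carrier_mat n n" "hpd K"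
    using A M hpd_congruence[OF M A qrank_full_inj[OF A r(1)]] by (auto simp: K_def)
  note Ki = hpd_minv[OF K]
  show "minv K \<in> carrier_mat n n" by (rule Ki(1))
  have h: "hdet K = msum n K" by (rule hdet_msum[OF K(1) r(2)])
  show p: "is_pos_real (hdet K)" using hpd_msum_pos[OF K] h by simp
  note d = carrier_matD[OF A] carrier_matD[OF M(1)] carrier_matD[OF N(1)] carrier_matD[OF Ki(1)]
  have YA: "minv K * (cstar A * (M * A)) = 1\<^sub>m n" using Ki(3) d by (simp add: K_def mat_assoc)
  show "wmp_inv A M N = minv K * (cstar A * M)"
  proof (rule wmp_inv_eq[OF A M N])
    show "minv K * (cstar A * M) \<in> carrier_mat n m" using Ki(1) A M by auto
    show "A * (minv K * (cstar A * M)) * A = A" using YA d right_mult_one_mat[OF A] by (simp add: mat_assoc)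
    have "minv K * (cstar A * M) * A * (minv K * (cstar A * M)) = (minv K * (cstar A * (M * A))) * (minv K * (cstar A * M))"
      using d by (simp add: mat_assoc)
    also have "\<dots> = minv K * (cstar A * M)"
      unfolding YA using Ki(1) A M by (intro left_mult_one_mat[of _ n m]) auto
    finally show "minv K * (cstar A * M) * A * (minv K * (cstar A * M)) = minv K * (cstar A * M)" .
    show "cstar (M * A * (minv K * (cstar A * M))) = M * A * (minv K * (cstar A * M))"
      using d Ki(4) hpd_cstar[OF M(2)] by (simp add: cstar_mult' mat_assoc)
    have "N * (minv K * (cstar A * M)) * A = N" using YA d right_mult_one_mat[OF N(1)] by (simp add: mat_assoc)
    then show "cstar (N * (minv K * (cstar A * M)) * A) = N * (minv K * (cstar A * M)) * A"
      using hpd_cstar[OF N(2)] by simp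
  qed
  fix v :: "quat vec" and i assume i: "i < n"
  have "hdet K * minv K $$ (i, t) = adjm n K $$ (i, t)" if "t < n" for t
    using that i carrier_matD[OF K(1)] is_pos_realD(2)[OF p]
    by (simp add: hpd_inverse_eq[OF K] h[symmetric] mult.assoc[symmetric])
  then show "cdet i (repl_col K i v) = hdet K * (\<Sum>t\<in>{0..<n}. minv K $$ (i, t) * v $ t)"
    using cdet_repl_col_adjm[OF K(1) hpd_hermitian[OF K(2)] i] by (simp add: sum_distrib_left mult.assoc[symmetric])
qed

text \<open>Obtained from the Gram matrix of \<open>cstar C\<close>, where taking adjoints exchanges
  the two symmetry conditions. The two copies of \<open>hpd_isqrt Q\<close> merge into
  \<open>minv Q\<close>; of the two copies of \<open>hpd_sqrt P\<close> one belongs to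
  \<open>R\<close>.\<close>

lemma wmp_right_minor_sums:
  assumes B: "B \<in> carrier_mat p q" and P: "P \<in> carrier_mat p p" "hpd P" and Q: "Q \<in> carrier_mat q q" "hpd Q"
    and r: "qrank B \<ge> 1"
  defines "C \<equiv> hpd_sqrt P * B * hpd_isqrt Q"
  defines "R \<equiv> gram_ginv (cstar C) * hpd_sqrt P" and "d \<equiv> principal_minor_sum (qrank B) (C * cstar C)"
  shows "R \<in> carrier_mat p p" "wmp_inv B P Q = minv Q * cstar B * hpd_sqrt P * R" "is_pos_real d"
    and "\<And>v j. j < p \<Longrightarrow> (\<Sum>l<p. rdet_minor_sum (qrank B) (C * cstar C) l v * hpd_sqrt P $$ (l, j))
        = d * (\<Sum>t\<in>{0..<p}. v $ t * R $$ (t, j))"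
proof -
  let ?Ph = "hpd_sqrt P" and ?Qi = "hpd_isqrt Q"
  note Ps = hpd_sqrt[OF P] and Qi = hpd_isqrt[OF Q]
  have C: "C \<in> carrier_mat p q" using B Ps Qi by (auto simp: C_def)
  then have C': "cstar C \<in> carrier_mat q p" by simp
  have rk: "qrank (cstar C) = qrank B" using qrank_weighted[OF B P Q] qrank_cstar[OF C] by (simp add: C_def)
  let ?H = "C * cstar C" and ?G = "gram_ginv (cstar C)"
  have H: "?H \<in> carrier_mat p p" "hermitian ?H" using C C' hermitian_gram[OF C'] by auto
  have dm: "d = msum (qrank (cstar C)) ?H" using principal_minor_sum_msum[OF H(1)] r rk by (simp add: d_def)
  then show p: "is_pos_real d" using gram_msum(1)[OF C'] by simp
  note g = gram_ginv_props[OF C']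
  show R: "R \<in> carrier_mat p p" using g(1) Ps(1) by (auto simp: R_def)
  note dd = carrier_matD[OF B] carrier_matD[OF Q(1)] carrier_matD[OF Ps(1)] carrier_matD[OF Qi(1)] carrier_matD[OF g(1)] carrier_matD[OF C]
  note mp = moore_penrose_gram[OF C', simplified]
  have "wmp_inv B P Q = ?Qi * (cstar C * ?G) * ?Ph"
  proof (rule wmp_inv_from_penrose[OF B P Q, folded C_def])
    show "cstar C * ?G \<in> carrier_mat q p" using g(1) C' by auto
    show "C * (cstar C * ?G) * C = C"
      using arg_cong[OF mp(2), of cstar] g(2) dd by (simp add: cstar_mult' mat_assoc)
    show "cstar C * ?G * C * (cstar C * ?G) = cstar C * ?G"
      using arg_cong[OF mp(3), of cstar] g(2) dd by (simp add: cstar_mult' mat_assoc)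
    show "cstar (C * (cstar C * ?G)) = C * (cstar C * ?G)"
      using mp(5) g(2) dd by (simp add: cstar_mult' mat_assoc)
    show "cstar (cstar C * ?G * C) = cstar C * ?G * C"
      using mp(4) g(2) dd by (simp add: cstar_mult' mat_assoc)
  qed
  also have "cstar C * ?G = ?Qi * (cstar B * ?Ph) * ?G"
    using dd Qi(2) hpd_cstar[OF Ps(2)]
    by (intro arg_cong[where f = "\<lambda>Z. Z * ?G"]) (simp add: C_def cstar_mult' mat_assoc)
  also have "?Qi * (?Qi * (cstar B * ?Ph) * ?G) * ?Ph = (?Qi * ?Qi) * cstar B * ?Ph * (?G * ?Ph)"
    using dd by (simp add: mat_assoc)
  finally show "wmp_inv B P Q = minv Q * cstar B * ?Ph * R"
    unfolding Qi(5) by (simp add: R_def)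
  have G: "d * ?G $$ (k, t) = adjm (qrank B) ?H $$ (k, t)" if "k < p" "t < p" for k t
    using that dd is_pos_realD(2)[OF p]
    by (simp add: gram_ginv_def dm[symmetric] rk[symmetric] mult.assoc[symmetric] del: index_mult_mat(1))
  fix v :: "quat vec" and j assume j: "j < p"
  have "(\<Sum>l<p. rdet_minor_sum (qrank B) ?H l v * ?Ph $$ (l, j))
     = (\<Sum>l\<in>{0..<p}. (\<Sum>t\<in>{0..<p}. v $ t * (d * ?G $$ (t, l))) * ?Ph $$ (l, j))"
    unfolding lessThan_atLeast0 by (intro sum.cong refl) (simp add: rdet_minor_sum_adjm[OF H(1)] G)
  also have "\<dots> = (\<Sum>l\<in>{0..<p}. \<Sum>t\<in>{0..<p}. d * (v $ t * (?G $$ (t, l) * ?Ph $$ (l, j))))"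
  proof -
    have "x * (d * y) * z = d * (x * (y * z))" for x y z
      by (metis mult.assoc qcnj_fixed_commute[OF is_pos_realD(1)[OF p]])
    then show ?thesis by (simp add: sum_distrib_right)
  qed
  also have "\<dots> = (\<Sum>t\<in>{0..<p}. d * (v $ t * R $$ (t, j)))"
    using j by (subst sum.swap) (simp add: R_def mult_entry[OF g(1) Ps(1)] sum_distrib_left del: index_mult_mat(1))
  finally show "(\<Sum>l<p. rdet_minor_sum (qrank B) ?H l v * ?Ph $$ (l, j)) = d * (\<Sum>t\<in>{0..<p}. v $ t * R $$ (t, j))"
    by (simp add: sum_distrib_left)
qed

text \<open>Full row rank of \<open>B\<close> is full column rank of \<open>cstar B\<close>, so
  \<open>K\<close> is a congruence transform of the definite matrix \<open>minv Q\<close>, and the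
  candidate \<open>Y\<close> satisfies \<open>B Y = I\<close>.\<close>

lemma wmp_right_full:
  assumes B: "B \<in> carrier_mat p q" and P: "P \<in> carrier_mat p p" "hpd P" and Q: "Q \<in> carrier_mat q q" "hpd Q"
    and r: "qrank B = p" "p \<ge> 1"
  defines "K \<equiv> B * minv Q * cstar B"
  shows "minv K \<in> carrier_mat p p" "wmp_inv B P Q = minv Q * cstar B * minv K" "is_pos_real (hdet K)"
    and "\<And>v j. j < p \<Longrightarrow> rdet j (repl_row K j v) = hdet K * (\<Sum>t\<in>{0..<p}. v $ t * minv K $$ (t, j))"
proof -
  have B': "cstar B \<in> carrier_mat q p" "qrank (cstar B) = p" using B qrank_cstar[OF B] r by auto
  note Qi = hpd_minv[OF Q]
  have K: "K \<in> carrier_mat p p" "hpd K"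
    using B Qi hpd_congruence[OF Qi(1,5) B'(1) qrank_full_inj[OF B']] by (auto simp: K_def)
  note Ki = hpd_minv[OF K]
  show "minv K \<in> carrier_mat p p" by (rule Ki(1))
  have h: "hdet K = msum p K" by (rule hdet_msum[OF K(1) r(2)])
  show pos: "is_pos_real (hdet K)" using hpd_msum_pos[OF K] h by simp
  note d = carrier_matD[OF B] carrier_matD[OF P(1)] carrier_matD[OF Q(1)] carrier_matD[OF Qi(1)] carrier_matD[OF Ki(1)]
  have BY: "B * (minv Q * (cstar B * minv K)) = 1\<^sub>m p" using Ki(2) d by (simp add: K_def mat_assoc)
  show "wmp_inv B P Q = minv Q * cstar B * minv K"
  proof (rule wmp_inv_eq[OF B P Q])
    let ?Y = "minv Q * cstar B * minv K"
    show "?Y \<in> carrier_mat q p" using Ki(1) B Qi by auto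
    have BY': "B * ?Y = 1\<^sub>m p" using BY d by (simp add: mat_assoc)
    show "B * ?Y * B = B" unfolding BY' using B by simp
    have "?Y * B * ?Y = ?Y * (B * ?Y)" using d by (simp add: mat_assoc)
    then show "?Y * B * ?Y = ?Y" unfolding BY' using Ki(1) B Qi by (simp add: right_mult_one_mat[of _ q p])
    have "P * B * ?Y = P" using BY d right_mult_one_mat[OF P(1)] by (simp add: mat_assoc)
    then show "cstar (P * B * ?Y) = P * B * ?Y" using hpd_cstar[OF P(2)] by simp
    have "Q * (minv Q * X) = X" if "X \<in> carrier_mat q k" for X k
      using assoc_mult_mat[OF Q(1) Qi(1) that] Qi(2) left_mult_one_mat[OF that] by simp
    from this[of "cstar B * (minv K * B)" q, OF mult_carrier_mat[OF B'(1) mult_carrier_mat[OF Ki(1) B]]] have "Q * ?Y * B = cstar B * (minv K * B)"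
      using d by (simp add: mat_assoc)
    then show "cstar (Q * ?Y * B) = Q * ?Y * B" using Ki(4) d by (simp add: cstar_mult' mat_assoc)
  qed
  fix v :: "quat vec" and j assume j: "j < p"
  have a: "adjm p K $$ (t, j) = hdet K * minv K $$ (t, j)" if "t < p" for t
    using that j carrier_matD[OF K(1)] is_pos_realD(2)[OF pos]
    by (simp add: hpd_inverse_eq[OF K] h[symmetric] mult.assoc[symmetric])
  have "x * (hdet K * y) = hdet K * (x * y)" for x y
    by (metis mult.assoc qcnj_fixed_commute[OF is_pos_realD(1)[OF pos]])
  then show "rdet j (repl_row K j v) = hdet K * (\<Sum>t\<in>{0..<p}. v $ t * minv K $$ (t, j))"
    using rdet_repl_row_adjm[OF K(1) j] by (simp add: sum_distrib_left a)
qed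

text \<open>As \<open>X = L Dt R\<close>, the two formulas are the two bracketings: \<open>R\<close>
  applied to the rows of \<open>Dt\<close> and then \<open>L\<close>, or \<open>L\<close> applied to
  the columns and then \<open>R\<close>. Abstract \<open>fA\<close> and \<open>fB\<close> cover all
  four combinations of ranks.\<close>

lemma two_sided_cramer:
  fixes fA :: "quat vec \<Rightarrow> nat \<Rightarrow> quat" and fB :: "quat vec \<Rightarrow> nat \<Rightarrow> quat"
  assumes L: "L \<in> carrier_mat n n" and KA: "KA \<in> carrier_mat n m" and D: "D \<in> carrier_mat m q"
    and KB: "KB \<in> carrier_mat q p" and R: "R \<in> carrier_mat p p"
    and fA: "\<And>v i. i < n \<Longrightarrow> fA v i = dA * (\<Sum>t\<in>{0..<n}. L $$ (i, t) * v $ t)"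
    and fB: "\<And>v j. j < p \<Longrightarrow> fB v j = dB * (\<Sum>t\<in>{0..<p}. v $ t * R $$ (t, j))"
    and pos: "is_pos_real dA" "is_pos_real dB"
    and Dt: "Dt = KA * D * KB" and X: "X = L * KA * D * (KB * R)" and ij: "i < n" "j < p"
  shows "X $$ (i, j) = fA (vec n (\<lambda>t. fB (row Dt t) j)) i / (dA * dB) \<and>
         X $$ (i, j) = fB (vec p (\<lambda>f. fA (col Dt f) i)) j / (dA * dB)"
proof -
  note d = carrier_matD[OF L] carrier_matD[OF KA] carrier_matD[OF D] carrier_matD[OF KB] carrier_matD[OF R]
  have Dc: "Dt \<in> carrier_mat n p" using KA D KB by (simp add: Dt)
  have X1: "X = L * (Dt * R)" and X2: "X = L * Dt * R" using d by (simp_all add: X Dt mat_assoc)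
  have cA: "dA * x = x * dA" and cB: "dB * x = x * dB" for x
    using pos is_pos_realD(1) qcnj_fixed_commute by blast+
  \<comment> \<open>Division multiplies by the inverse from the right, whereas the scalars stand on
    the left; both are real and hence central.\<close>
  have quot: "dA * dB * x / (dA * dB) = x" for x
  proof -
    have "dA * dB * x = x * (dA * dB)" by (metis cA cB mult.assoc)
    moreover have "x * c / c = x" if "c \<noteq> 0" for c :: quat
      using that by (simp add: divide_inverse mult.assoc)
    ultimately show ?thesis using is_pos_realD(2)[OF pos(1)] is_pos_realD(2)[OF pos(2)] by simp
  qed
  have c1: "y * (dB * z) = dB * (y * z)" for y z
    by (metis cB mult.assoc)
  have "fB (row Dt t) j = dB * (Dt * R) $$ (t, j)" if "t < n" for t
    using fB[OF ij(2), of "row Dt t"] that Dc R ij by (simp add: mult_entry[OF Dc R] del: index_mult_mat(1))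
  then have "fA (vec n (\<lambda>t. fB (row Dt t) j)) i = dA * dB * X $$ (i, j)"
    using ij Dc R unfolding fA[OF ij(1)] X1
    by (simp add: mult_entry[OF L, of "Dt * R" p] c1 sum_distrib_left mult.assoc del: index_mult_mat(1))
  moreover have "fA (col Dt f) i = dA * (L * Dt) $$ (i, f)" if "f < p" for f
    using fA[OF ij(1), of "col Dt f"] that Dc L ij by (simp add: mult_entry[OF L Dc] del: index_mult_mat(1))
  then have "fB (vec p (\<lambda>f. fA (col Dt f) i)) j = dB * (dA * X $$ (i, j))"
    using ij Dc L unfolding fB[OF ij(2)] X2
    by (simp add: mult_entry[of "L * Dt" n p R p] R sum_distrib_left mult.assoc del: index_mult_mat(1))
  then have "fB (vec p (\<lambda>f. fA (col Dt f) i)) j = dA * dB * X $$ (i, j)"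
    by (metis cA mult.assoc)
  ultimately show ?thesis using quot by simp
qed

theorem theorem3p2:
  fixes A M N B P Q D :: "quat mat" and m n p q :: nat
  defines "r1 \<equiv> qrank A" and "r2 \<equiv> qrank B"
    and "X \<equiv> wmp_inv A M N * D * wmp_inv B P Q"
  assumes A: "A \<in> carrier_mat m n" and B: "B \<in> carrier_mat p q" and D: "D \<in> carrier_mat m q"
    and M: "M \<in> carrier_mat m m" "hpd M" and N: "N \<in> carrier_mat n n" "hpd N"
    and P: "P \<in> carrier_mat p p" "hpd P" and Q: "Q \<in> carrier_mat q q" "hpd Q"
    and r1: "r1 \<ge> 1" and r2: "r2 \<ge> 1"
    and nhA: "\<not> hermitian (minv N * cstar A * M * A)"
    and nhB: "\<not> hermitian (B * minv Q * cstar B * P)"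
  shows
    "let Nmh = hpd_isqrt N; Ph = hpd_sqrt P;
         At = hpd_sqrt M * A * hpd_isqrt N; Bt = hpd_sqrt P * B * hpd_isqrt Q;
         AA = cstar At * At; BB = Bt * cstar Bt;
         HA = cstar A * M * A; HB = B * minv Q * cstar B;
         DeltaA = principal_minor_sum r1 AA; DeltaB = principal_minor_sum r2 BB;
         numA1 = (\<lambda>v i. \<Sum>k<n. Nmh $$ (i,k) * cdet_minor_sum r1 AA k v);
         numB1 = (\<lambda>v j. \<Sum>l<p. rdet_minor_sum r2 BB l v * Ph $$ (l,j));
         numA2 = (\<lambda>v i. cdet i (repl_col HA i v));
         numB2 = (\<lambda>v j. rdet j (repl_row HB j v))
     in
    (r1 < n \<and> r2 < p \<longrightarrow>
       (let Dt = Nmh * cstar A * M * D * minv Q * cstar B * Ph;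
            dB = (\<lambda>j. vec n (\<lambda>t. numB1 (row Dt t) j));
            dA = (\<lambda>i. vec p (\<lambda>f. numA1 (col Dt f) i))
        in \<forall>i<n. \<forall>j<p. X $$ (i,j) = numA1 (dB j) i / (DeltaA * DeltaB) \<and>
                         X $$ (i,j) = numB1 (dA i) j / (DeltaA * DeltaB)))
   \<and> (r1 = n \<and> r2 = p \<longrightarrow>
       (let Dt = cstar A * M * D * minv Q * cstar B;
            dB = (\<lambda>j. vec n (\<lambda>t. numB2 (row Dt t) j));
            dA = (\<lambda>i. vec p (\<lambda>f. numA2 (col Dt f) i))
        in \<forall>i<n. \<forall>j<p. X $$ (i,j) = numA2 (dB j) i / (hdet HA * hdet HB) \<and>
                         X $$ (i,j) = numB2 (dA i) j / (hdet HA * hdet HB)))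
   \<and> (r1 = n \<and> r2 < p \<longrightarrow>
       (let Dt = cstar A * M * D * minv Q * cstar B * Ph;
            dB = (\<lambda>j. vec n (\<lambda>t. numB1 (row Dt t) j));
            dA = (\<lambda>i. vec p (\<lambda>f. numA2 (col Dt f) i))
        in \<forall>i<n. \<forall>j<p. X $$ (i,j) = numA2 (dB j) i / (hdet HA * DeltaB) \<and>
                         X $$ (i,j) = numB1 (dA i) j / (hdet HA * DeltaB)))
   \<and> (r1 < n \<and> r2 = p \<longrightarrow>
       (let Dt = Nmh * cstar A * M * D * minv Q * cstar B;
            dB = (\<lambda>j. vec n (\<lambda>t. numB2 (row Dt t) j));
            dA = (\<lambda>i. vec p (\<lambda>f. numA1 (col Dt f) i))
        in \<forall>i<n. \<forall>j<p. X $$ (i,j) = numB2 (dA i) j / (DeltaA * hdet HB) \<and>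
                         X $$ (i,j) = numA1 (dB j) i / (DeltaA * hdet HB)))"
proof -
  note dm = carrier_matD[OF A] carrier_matD[OF B] carrier_matD[OF D] carrier_matD[OF M(1)] carrier_matD[OF N(1)]
    carrier_matD[OF P(1)] carrier_matD[OF Q(1)] carrier_matD[OF hpd_isqrt(1)[OF N]] carrier_matD[OF hpd_sqrt(1)[OF P]]
    carrier_matD[OF hpd_minv(1)[OF Q]]
  have carr: "hpd_isqrt N * cstar A * M \<in> carrier_mat n m" "cstar A * M \<in> carrier_mat n m"
    "minv Q * cstar B * hpd_sqrt P \<in> carrier_mat q p" "minv Q * cstar B \<in> carrier_mat q p"
    using dm by (auto intro!: carrier_matI)
  \<comment> \<open>Positive rank excludes the empty matrix, on which \<open>hdet\<close> would read
    a missing entry.\<close>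
  have full: "qrank A = n" "n \<ge> 1" if "r1 = n" using that r1 by (simp_all add: r1_def)
  have full': "qrank B = p" "p \<ge> 1" if "r2 = p" using that r2 by (simp_all add: r2_def)
  note A1 = wmp_left_minor_sums[OF A M N r1[unfolded r1_def], folded r1_def]
  note A2 = wmp_left_full[OF A M N full]
  note B1 = wmp_right_minor_sums[OF B P Q r2[unfolded r2_def], folded r2_def]
  note B2 = wmp_right_full[OF B P Q full']
  have X: "X = L * KA * D * (KB * R)" if "wmp_inv A M N = L * KA" "wmp_inv B P Q = KB * R" for L KA KB R
    by (simp only: X_def that)
  \<comment> \<open>Each case picks one of two left factors and one of two right factors; what
    remains is to reassociate the transformed right-hand side.\<close>
  show ?thesis
    unfolding Let_def
    apply (intro conjI[of "_ \<longrightarrow> _"] impI allI)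
    subgoal for i j
      by (rule two_sided_cramer[OF A1(1) carr(1) D carr(3) B1(1) A1(4) B1(4) A1(3) B1(3) _ X[OF A1(2) B1(2)]])
        (use dm in \<open>auto simp: mat_assoc\<close>)
    subgoal for i j
      by (rule two_sided_cramer[OF A2(1) carr(2) D carr(4) B2(1) A2(4) B2(4) A2(3) B2(3) _ X[OF A2(2) B2(2)]])
        (use dm in \<open>auto simp: mat_assoc\<close>)
    subgoal for i j
      by (rule two_sided_cramer[OF A2(1) carr(2) D carr(3) B1(1) A2(4) B1(4) A2(3) B1(3) _ X[OF A2(2) B1(2)]])
        (use dm in \<open>auto simp: mat_assoc\<close>)
    \<comment> \<open>The fourth case states the row formula before the column formula.\<close>
    subgoal for i j
      by (subst conj_commute, rule two_sided_cramer[OF A1(1) carr(1) D carr(4) B2(1) A1(4) B2(4) A1(3) B2(3) _ X[OF A1(2) B2(2)]])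
        (use dm in \<open>auto simp: mat_assoc\<close>)
    done
qed

end
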